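(* Let $W^{CT}$ be the limit random variable (defined in the context) of the continuous-time urn process started from one red ball and no black ball, and let $\mathcal{F}(t)=\mathbb{E}(e^{itW^{CT}})$, $t\in\mathbb{R}$, be its characteristic function. Then the density $p$ on $\mathbb{R}$ of $W^{CT}$ is given, for any $x\neq0$, by $$p(x)=\frac{1}{2i\pi x}\int_{\mathbb{R}}e^{-itx}\,\mathcal{F}'(t)\,dt .$$
   Context: Standing assumptions (balanced, large, nontriangular urn): $m,S,b$ are integers with $m+2\le S\le 2m-1$ and $1\le b\le S-m-1$; put $a=S-b$, $c=S-m-b$, $d=m+b$. $(U^{CT}(t))_{t\ge0}$ is the Markov jump process on $\mathbb{N}^2\setminus\{(0,0)\}$ started at $(1,0)$ which, from a state $(x,y)$, jumps to $(x+a,y+b)$ at rate $x$ and to $(x+c,y+d)$ at rate $y$. With $u_2(x,y)=\frac1S(bx-cy)$, $W^{CT}=\lim_{t\to+\infty}e^{-mt}u_2(U^{CT}(t))$ (limit a.s. and in every $L^p$, $p\ge1$). The characteristic function $\mathcal{F}$ is differentiable with $\mathcal{F}'\in L^1(\mathbb{R})$. *)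

theory Defs
  imports "HOL-Probability.Probability"
begin

definition total_rate :: "('s \<Rightarrow> 's \<Rightarrow> real) \<Rightarrow> 's \<Rightarrow> real" where
  "total_rate q z = (\<Sum>\<^sub>\<infinity>z'. q z z')"

text \<open>
  A Markov jump process with jump rates \<open>q z z'\<close> (\<open>q z z = 0\<close>, and positive finite total rate in
  every reachable state), started at \<open>z0\<close>, given by its jump chain \<open>Z\<close> and holding times \<open>T\<close>:
  \<open>Z\<close> is a Markov chain with transition probabilities \<open>q z z' / total_rate q z\<close> and, given \<open>Z\<close>,
  the \<open>T k\<close> are independent and exponential with parameters \<open>total_rate q (Z k)\<close>. The displayed
  probabilities determine the joint law of \<open>Z\<close> and \<open>T\<close>. The path of the process is \<open>Z n\<close> from the
  \<open>n\<close>-th jump time up to the next one. Nothing is prescribed after an explosion; the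
  urn process almost surely does not explode.
\<close>

definition markov_jump_process ::
  "'w measure \<Rightarrow> ('s::countable \<Rightarrow> 's \<Rightarrow> real) \<Rightarrow> 's \<Rightarrow> (real \<Rightarrow> 'w \<Rightarrow> 's) \<Rightarrow> bool" where
  "markov_jump_process M q z0 U \<longleftrightarrow>
     (\<forall>t\<ge>0. U t \<in> measurable M (count_space UNIV)) \<and>
     (\<exists>(Z :: nat \<Rightarrow> 'w \<Rightarrow> 's) (T :: nat \<Rightarrow> 'w \<Rightarrow> real).
        (\<forall>n. Z n \<in> measurable M (count_space UNIV)) \<and>
        (\<forall>n. T n \<in> borel_measurable M) \<and>
        (\<forall>n z t. (\<forall>k<n. 0 \<le> t k) \<longrightarrow>
           measure M {\<omega> \<in> space M. (\<forall>k\<le>n. Z k \<omega> = z k) \<and> (\<forall>k<n. t k < T k \<omega>)} =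
             (if z 0 = z0
              then (\<Prod>k<n. q (z k) (z (Suc k)) / total_rate q (z k) *
                            exp (- total_rate q (z k) * t k))
              else 0)) \<and>
        (AE \<omega> in M. \<forall>n t. (\<Sum>k<n. T k \<omega>) \<le> t \<and> t < (\<Sum>k<Suc n. T k \<omega>) \<longrightarrow> U t \<omega> = Z n \<omega>))"

definition urn_rate :: "nat \<Rightarrow> nat \<Rightarrow> nat \<Rightarrow> nat \<Rightarrow> nat \<times> nat \<Rightarrow> nat \<times> nat \<Rightarrow> real" where
  "urn_rate a b c d z z' =
     (case z of (x, y) \<Rightarrow>
        real x * of_bool (z' = (x + a, y + b)) + real y * of_bool (z' = (x + c, y + d)))"

definition u2 :: "nat \<Rightarrow> nat \<Rightarrow> nat \<Rightarrow> nat \<times> nat \<Rightarrow> real" where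
  "u2 S b c z = (case z of (x, y) \<Rightarrow> (real b * real x - real c * real y) / real S)"

definition as_limit :: "'w measure \<Rightarrow> (real \<Rightarrow> 'w \<Rightarrow> real) \<Rightarrow> ('w \<Rightarrow> real) \<Rightarrow> bool" where
  "as_limit M X W \<longleftrightarrow> (AE \<omega> in M. ((\<lambda>t. X t \<omega>) \<longlongrightarrow> W \<omega>) at_top)"

definition Lp_limit :: "'w measure \<Rightarrow> real \<Rightarrow> (real \<Rightarrow> 'w \<Rightarrow> real) \<Rightarrow> ('w \<Rightarrow> real) \<Rightarrow> bool" where
  "Lp_limit M p X W \<longleftrightarrow>
     (\<forall>t\<ge>0. integrable M (\<lambda>\<omega>. \<bar>X t \<omega>\<bar> powr p)) \<and>
     integrable M (\<lambda>\<omega>. \<bar>W \<omega>\<bar> powr p) \<and>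
     ((\<lambda>t. \<integral>\<omega>. \<bar>X t \<omega> - W \<omega>\<bar> powr p \<partial>M) \<longlongrightarrow> 0) at_top"

end

theory Submission
  imports Defs
begin

text \<open>
  The urn is balanced: every jump adds \<open>S = a + b = c + d\<close> balls, so the state after \<open>n\<close> jumps has
  \<open>1 + n S\<close> balls and this deterministic number is its total jump rate. Hence the holding times
  \<open>T\<^sub>0, T\<^sub>1, \<dots>\<close> are independent exponential variables with known rates, and they are independent of
  the embedded chain \<open>Z\<^sub>0, Z\<^sub>1, \<dots>\<close> of compositions. Along the jump times the limit reads
  \<open>W = lim exp (- m (T\<^sub>0 + \<dots> + T\<^bsub>n-1\<^esub>)) u\<^sub>2(Z\<^sub>n)\<close>.
  The proof exploits this independence in two ways, once for the regularity of the law of \<open>W\<close> away from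
  \<open>0\<close> and once to exclude an atom at \<open>0\<close>.

  \<^emph>\<open>The derivative is integrable.\<close> Pulling out the first two holding times gives \<open>W = R V\<close>
  with \<open>R = exp (- m (T\<^sub>0 + T\<^sub>1))\<close> independent of \<open>V\<close> (\<open>distr_limit_scale_mixture\<close>). If
  \<open>\<kappa>(x) = E (i R exp (i x R))\<close> is the derivative of the characteristic function of \<open>R\<close>, then
  \<open>F'(x) = E (V \<kappa>(x V))\<close>, and \<open>\<integral> |v| |\<kappa>(x v)| dx = \<integral> |\<kappa>|\<close> for every \<open>v \<noteq> 0\<close>. So integrability of
  \<open>F'\<close> follows from integrability of \<open>\<kappa>\<close>, for every integrable \<open>V\<close>
  (\<open>integrable_char_deriv_scale_mixture\<close>). One exponential factor would give only
  \<open>\<kappa>(x) = O(1/x)\<close>, because the density of \<open>exp (- m T\<^sub>0)\<close> jumps at \<open>1\<close>; with two factors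
  \<open>\<kappa>(x) = O(|x|\<^bsup>-1-d\<^esup>)\<close> for some \<open>d > 0\<close> (\<open>integrable_char_scale_law_deriv\<close>).

  \<^emph>\<open>The inversion formula.\<close> On an interval that does not contain \<open>0\<close>, Levy's inversion
  formula can be integrated by parts. This trades \<open>F\<close>, whose integrability is unknown, for \<open>F'(t) / x\<close>, and
  the boundary terms vanish as soon as \<open>F\<close> tends to \<open>0\<close> at infinity. If moreover \<open>W\<close> has no atom
  at \<open>0\<close>, these intervals determine its law (\<open>density_from_char_derivative\<close>). Both requirements
  reduce to \<open>P(W = 0) = 0\<close>: by dominated convergence \<open>F(x) = E \<psi>(x V)\<close> tends to \<open>P(V = 0)\<close>,
  where \<open>\<psi>\<close> is the characteristic function of \<open>R\<close>.

  \<^emph>\<open>The limit does not vanish.\<close> From any state that is reached at a time \<open>k \<ge> 1\<close>, the fourth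
  moment of the discounted process is at most a constant times the square of its second moment, and
  the constant depends neither on the state nor on \<open>k\<close>: fresh noise of constant order enters at every
  draw, so the second moment can never be small compared with the fluctuations. Hence, given the
  state at time \<open>k\<close>, the limit is nonzero with probability bounded below
  (\<open>tail_limit_nonzero_prob_ge\<close>). If \<open>W = 0\<close> had positive probability, then for small \<open>\<epsilon>\<close> and large
  \<open>k\<close> the event that the discounted process at time \<open>k\<close> lies within \<open>\<epsilon>\<close> of \<open>0\<close> would consist almost
  entirely of outcomes with \<open>W = 0\<close>, against this bound (\<open>AE_limit_nonzero\<close>).
\<close>

section \<open>Derivatives of characteristic functions and inversion\<close>

lemma norm_iexp_diff_le: "cmod (iexp u - iexp v) \<le> \<bar>u - v\<bar>"
proof -
  have "iexp u - iexp v = iexp v * (iexp (u - v) - 1)"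
    by (simp add: algebra_simps flip: exp_add)
  then have "cmod (iexp u - iexp v) = cmod (iexp (u - v) - 1)"
    by (simp add: norm_mult)
  also have "\<dots> \<le> \<bar>u - v\<bar>"
    using iexp_approx1[of "u - v" 0] by simp
  finally show ?thesis .
qed

text \<open>
  Differentiation under the expectation: the difference quotients of \<open>iexp (t * x)\<close> differ from
  their limit by at most \<open>2 * \<bar>x\<bar>\<close>, which is integrable.
\<close>
lemma (in real_distribution) char_has_vector_derivative:
  assumes "integrable M (\<lambda>x. x)"
  shows "(char M has_vector_derivative (CLINT x|M. \<i> * of_real x * iexp (t * x))) (at t)"
proof -
  define D where "D = (\<lambda>x t. \<i> * complex_of_real x * iexp (t * x))"
  have [measurable]: "(\<lambda>x. D x t) \<in> borel_measurable M" for t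
    unfolding D_def by measurable
  have nD: "cmod (D x t) = \<bar>x\<bar>" for x t
    by (simp add: D_def norm_mult)
  have D: "((\<lambda>t. iexp (t * x)) has_vector_derivative D x t) (at t)" for x t
    unfolding D_def by (auto intro!: derivative_eq_intros
        simp: Re_exp Im_exp has_vector_derivative_complex_iff)
  have intD: "integrable M (\<lambda>x. D x t)" for t
    by (rule Bochner_Integration.integrable_bound[OF assms]) (auto simp: nD)
  have inte: "integrable M (\<lambda>x. iexp (t * x))" for t :: real
    by (intro integrable_iexp) auto
  define q where "q = (\<lambda>h x. (iexp ((t + h) * x) - iexp (t * x) - h *\<^sub>R D x t) /\<^sub>R h)"
  have "((\<lambda>h. CLINT x|M. q h x) \<longlongrightarrow> (CLINT x|M. 0)) (at 0)"
    unfolding tendsto_at_iff_sequentially comp_def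
  proof (intro allI impI, rule integral_dominated_convergence[where w = "\<lambda>x. 2 * \<bar>x\<bar>"])
    fix H :: "nat \<Rightarrow> real" assume H: "\<forall>i. H i \<in> UNIV - {0}" "H \<longlonglongrightarrow> 0"
    show "AE x in M. (\<lambda>i. q (H i) x) \<longlonglongrightarrow> 0"
    proof (rule AE_I2)
      fix x
      have "((\<lambda>h. norm (iexp ((t + h) * x) - iexp (t * x) - h *\<^sub>R D x t) / norm h) \<longlongrightarrow> 0) (at 0)"
        using D[of x t] unfolding has_vector_derivative_def has_derivative_at by auto
      then have "(\<lambda>i. norm (iexp ((t + H i) * x) - iexp (t * x) - H i *\<^sub>R D x t) / norm (H i)) \<longlonglongrightarrow> 0"
        using H unfolding tendsto_at_iff_sequentially comp_def by blast
      then have "(\<lambda>i. norm (q (H i) x)) \<longlonglongrightarrow> 0"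
        by (simp add: q_def divide_inverse mult.commute)
      then show "(\<lambda>i. q (H i) x) \<longlonglongrightarrow> 0"
        by (rule tendsto_norm_zero_cancel)
    qed
    show "AE x in M. cmod (q (H i) x) \<le> 2 * \<bar>x\<bar>" for i
    proof (rule AE_I2)
      fix x
      have "cmod (iexp ((t + H i) * x) - iexp (t * x) - H i *\<^sub>R D x t)
          \<le> cmod (iexp ((t + H i) * x) - iexp (t * x)) + cmod (H i *\<^sub>R D x t)"
        by (rule norm_triangle_ineq4)
      also have "\<dots> \<le> \<bar>(t + H i) * x - t * x\<bar> + \<bar>H i\<bar> * \<bar>x\<bar>"
        by (intro add_mono norm_iexp_diff_le) (simp add: nD)
      also have "\<dots> = \<bar>H i\<bar> * (2 * \<bar>x\<bar>)"
        by (simp add: algebra_simps abs_mult)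
      finally show "cmod (q (H i) x) \<le> 2 * \<bar>x\<bar>"
        using H(1)[rule_format, of i] by (simp add: q_def divide_simps mult.commute)
    qed
    show "q (H i) \<in> borel_measurable M" for i
      unfolding q_def by measurable
    show "integrable M (\<lambda>x. 2 * \<bar>x\<bar>)"
      using assms by (intro integrable_mult_right integrable_abs)
  qed measurable
  then have "((\<lambda>h. norm (CLINT x|M. q h x)) \<longlongrightarrow> 0) (at 0)"
    by (auto intro: tendsto_norm_zero)
  moreover have "(CLINT x|M. q h x) = (char M (t + h) - char M t - h *\<^sub>R (CLINT x|M. D x t)) /\<^sub>R h" for h
    using intD[of t] inte[of t] inte[of "t + h"]
    unfolding q_def char_def
    by (subst integral_scaleR_right, subst Bochner_Integration.integral_diff,
        simp, simp, subst Bochner_Integration.integral_diff, simp_all only: integral_scaleR_right)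
  ultimately have "((\<lambda>h. norm (char M (t + h) - char M t - h *\<^sub>R (CLINT x|M. D x t)) / norm h) \<longlongrightarrow> 0) (at 0)"
    by (simp add: divide_inverse mult.commute)
  then show ?thesis
    unfolding has_vector_derivative_def has_derivative_at D_def
    by (auto intro: bounded_linear_scaleR_left)
qed

lemma (in real_distribution) isCont_char_deriv:
  assumes "integrable M (\<lambda>x. x)"
  shows "isCont (\<lambda>t. CLINT x|M. \<i> * of_real x * iexp (t * x)) t"
  unfolding continuous_at_sequentially comp_def
proof (intro allI impI, rule integral_dominated_convergence[where w = "\<lambda>x. \<bar>x\<bar>"])
  fix X :: "nat \<Rightarrow> real" assume X: "X \<longlonglongrightarrow> t"
  show "AE x in M. (\<lambda>i. \<i> * of_real x * iexp (X i * x)) \<longlonglongrightarrow> \<i> * of_real x * iexp (t * x)"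
    by (intro AE_I2 tendsto_intros X)
qed (use assms in \<open>auto simp: norm_mult\<close>)

lemma isCont_iexp_transform:
  assumes "integrable lborel (f :: real \<Rightarrow> complex)"
  shows "isCont (\<lambda>x. CLBINT t. iexp (-(t * x)) * f t) x"
  unfolding continuous_at_sequentially comp_def
proof (intro allI impI, rule integral_dominated_convergence[where w = "\<lambda>t. norm (f t)"])
  fix X :: "nat \<Rightarrow> real" assume X: "X \<longlonglongrightarrow> x"
  show "AE t in lborel. (\<lambda>i. iexp (-(t * X i)) * f t) \<longlonglongrightarrow> iexp (-(t * x)) * f t"
    by (intro AE_I2 tendsto_intros X)
qed (use assms in \<open>auto simp: norm_mult\<close>)

text \<open>
  The step that makes the inversion work: the truncated Fourier integral of the characteristic
  function becomes that of its derivative, divided by \<open>\<i> * x\<close>, up to boundary terms.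
\<close>
lemma (in real_distribution) char_by_parts:
  fixes T :: real
  assumes int: "integrable M (\<lambda>x. x)" and "0 \<le> T" "x \<noteq> 0"
  defines "F' \<equiv> \<lambda>t. vector_derivative (char M) (at t)"
  shows "(CLBINT t=-T..T. iexp (-(t * x)) * char M t) =
    ((CLBINT t=-T..T. iexp (-(t * x)) * F' t) - (iexp (-(T * x)) * char M T - iexp (T * x) * char M (-T))) / (\<i> * x)"
proof -
  have D: "(char M has_vector_derivative F' t) (at t)" for t
    using char_has_vector_derivative[OF int, of t] vector_derivative_at F'_def by metis
  have F': "F' = (\<lambda>t. CLINT x|M. \<i> * of_real x * iexp (t * x))"
    using vector_derivative_at[OF char_has_vector_derivative[OF int]] by (auto simp: F'_def)
  have contF': "continuous_on S F'" for S
    unfolding F' by (intro continuous_at_imp_continuous_on ballI isCont_char_deriv int)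
  have contF: "continuous_on S (char M)" for S
    by (intro continuous_at_imp_continuous_on ballI isCont_char)
  have E: "((\<lambda>t. iexp (-(t * x))) has_vector_derivative (- \<i> * x) * iexp (-(t * x))) (at t within S)" for t S
    by (auto intro!: derivative_eq_intros simp: Re_exp Im_exp has_vector_derivative_complex_iff)
  let ?e = "\<lambda>t. iexp (-(t * x))"
  have "(CLBINT t=-T..T. ?e t * F' t + ((- \<i> * x) * ?e t) * char M t)
      = iexp (-(T * x)) * char M T - iexp (-((-T) * x)) * char M (-T)"
  proof (rule interval_integral_FTC_finite)
    show "continuous_on {min (-T) T..max (-T) T} (\<lambda>t. ?e t * F' t + ((- \<i> * x) * ?e t) * char M t)"
      by (intro continuous_intros contF contF')
    show "((\<lambda>t. ?e t * char M t) has_vector_derivative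
        ?e t * F' t + ((- \<i> * x) * ?e t) * char M t) (at t within {min (-T) T..max (-T) T})" for t
      using has_vector_derivative_mult[OF E has_vector_derivative_at_within[OF D]] by simp
  qed
  moreover have "(CLBINT t=-T..T. ?e t * F' t + ((- \<i> * x) * ?e t) * char M t)
      = (CLBINT t=-T..T. ?e t * F' t) + (CLBINT t=-T..T. (- \<i> * x) * (?e t * char M t))"
    by (subst interval_lebesgue_integral_add(2)[symmetric])
       (auto intro!: interval_integrable_continuous_on continuous_intros contF contF' simp: \<open>0 \<le> T\<close> mult.assoc)
  moreover have "(CLBINT t=-T..T. (- \<i> * x) * (?e t * char M t)) = (- \<i> * x) * (CLBINT t=-T..T. ?e t * char M t)"
    by (rule interval_lebesgue_integral_mult_right)
  ultimately show ?thesis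
    using \<open>x \<noteq> 0\<close> by (simp add: field_simps)
qed

lemma iexp_difference_quotient:
  assumes "a < b" "t \<noteq> 0"
  shows "(iexp (-(t * a)) - iexp (-(t * b))) / (\<i> * t) = (CLBINT x. indicator {a..b} x *\<^sub>R iexp (-(t * x)))"
proof -
  have "((\<lambda>x. iexp (-(t * x)) * (\<i> / t)) has_vector_derivative iexp (-(t * x))) (at x within S)" for x S
    using \<open>t \<noteq> 0\<close>
    by (auto intro!: derivative_eq_intros simp: Re_exp Im_exp has_vector_derivative_complex_iff Re_divide Im_divide
         power2_eq_square)
  then have "(CLBINT x. indicator {a..b} x *\<^sub>R iexp (-(t * x))) = iexp (-(t * b)) * (\<i> / t) - iexp (-(t * a)) * (\<i> / t)"
    using \<open>a < b\<close> by (intro integral_FTC_atLeastAtMost) (auto intro!: continuous_intros)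
  then show ?thesis
    by (simp add: divide_inverse algebra_simps)
qed

text \<open>
  The kernel of Levy's formula is the integral of \<open>iexp (-(t * x))\<close> over \<open>x\<close> between \<open>a\<close> and \<open>b\<close>, so
  Fubini's theorem turns Levy's integral into an average over \<open>x\<close> of truncated Fourier integrals.
\<close>
lemma (in real_distribution) Levy_integral_eq:
  fixes T :: real
  assumes "a < b" "0 \<le> T"
  shows "(CLBINT t=-T..T. (iexp (-(t * a)) - iexp (-(t * b))) / (\<i> * t) * char M t)
    = (CLBINT x. indicator {a..b} x *\<^sub>R (CLBINT t=-T..T. iexp (-(t * x)) * char M t))"
proof -
  let ?f = "\<lambda>(t::real, x::real). (indicator {-T<..<T} t * indicator {a..b} x) *\<^sub>R (iexp (-(t * x)) * char M t)"
  have "(CLBINT t=-T..T. (iexp (-(t * a)) - iexp (-(t * b))) / (\<i> * t) * char M t)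
     = (CLBINT t. (CLBINT x. ?f (t, x)))"
    unfolding interval_lebesgue_integral_def set_lebesgue_integral_def
  proof (subst if_P, simp add: \<open>0 \<le> T\<close>, rule integral_cong_AE)
    show "AE t in lborel. indicator (einterval (ereal (- T)) (ereal T)) t *\<^sub>R
        ((iexp (-(t * a)) - iexp (-(t * b))) / (\<i> * t) * char M t) = (CLBINT x. ?f (t, x))"
    proof (rule AE_I'[of "{0}"])
      show "{t \<in> space lborel. indicator (einterval (ereal (- T)) (ereal T)) t *\<^sub>R
        ((iexp (-(t * a)) - iexp (-(t * b))) / (\<i> * t) * char M t) \<noteq> (CLBINT x. ?f (t, x))} \<subseteq> {0}"
      proof (rule ccontr)
        assume "\<not> ?thesis"
        then obtain t :: real where t: "t \<noteq> 0" "indicator (einterval (ereal (- T)) (ereal T)) t *\<^sub>R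
          ((iexp (-(t * a)) - iexp (-(t * b))) / (\<i> * t) * char M t) \<noteq> (CLBINT x. ?f (t, x))"
          by auto
        have "(CLBINT x. ?f (t, x)) = (CLBINT x. (indicator {-T<..<T} t *\<^sub>R char M t) * (indicator {a..b} x *\<^sub>R iexp (-(t * x))))"
          by (intro Bochner_Integration.integral_cong refl) (auto simp: indicator_def)
        also have "\<dots> = (indicator {-T<..<T} t *\<^sub>R char M t) * (CLBINT x. indicator {a..b} x *\<^sub>R iexp (-(t * x)))"
          by (rule integral_mult_right_zero)
        also have "\<dots> = indicator {-T<..<T} t *\<^sub>R
            ((iexp (-(t * a)) - iexp (-(t * b))) / (\<i> * t) * char M t)"
          unfolding iexp_difference_quotient[OF assms(1) t(1)] by simp
        finally show False
          using t(2) by (simp add: einterval_eq)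
      qed
    qed (rule finite_imp_null_set_lborel, simp)
  qed (auto intro!: borel_measurable_lebesgue_integral)
  also have "\<dots> = (CLBINT x. (CLBINT t. ?f (t, x)))"
  proof (intro lborel_pair.Fubini_integral[symmetric] integrableI_bounded_set[where B=1 and A = "{-T..T} \<times> {a..b}"])
    show "emeasure (lborel \<Otimes>\<^sub>M lborel) ({-T..T} \<times> {a..b}) < \<infinity>"
      using assms by (subst lborel.emeasure_pair_measure_Times) (auto simp: ennreal_mult_less_top)
    show "AE x\<in>{-T..T} \<times> {a..b} in lborel \<Otimes>\<^sub>M lborel. cmod (case x of (t, x) \<Rightarrow> ?f (t, x)) \<le> 1"
      by (intro AE_I2) (auto simp: indicator_def norm_mult cmod_char_le_1)
    show "(\<lambda>(t, x). ?f (t, x)) \<in> borel_measurable (lborel \<Otimes>\<^sub>M lborel)"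
      by measurable
    show "AE z in lborel \<Otimes>\<^sub>M lborel. z \<notin> {-T..T} \<times> {a..b} \<longrightarrow> (case z of (t, x) \<Rightarrow> ?f (t, x)) = 0"
      by (intro AE_I2) (auto simp: indicator_def)
    show "{-T..T} \<times> {a..b} \<in> sets (lborel \<Otimes>\<^sub>M lborel)"
      by (intro pair_measureI) auto
  qed
  also have "\<dots> = (CLBINT x. indicator {a..b} x *\<^sub>R (CLBINT t=-T..T. iexp (-(t * x)) * char M t))"
  proof (intro Bochner_Integration.integral_cong refl)
    fix x
    have "(CLBINT t. ?f (t, x)) = (CLBINT t. indicator {a..b} x *\<^sub>R (indicator {-T<..<T} t *\<^sub>R (iexp (-(t * x)) * char M t)))"
      by (intro Bochner_Integration.integral_cong refl) (auto simp: indicator_def)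
    also have "\<dots> = indicator {a..b} x *\<^sub>R (CLBINT t. indicator {-T<..<T} t *\<^sub>R (iexp (-(t * x)) * char M t))"
      by (rule integral_scaleR_right)
    finally show "(CLBINT t. ?f (t, x)) = indicator {a..b} x *\<^sub>R (CLBINT t=-T..T. iexp (-(t * x)) * char M t)"
      using \<open>0 \<le> T\<close> by (simp add: interval_lebesgue_integral_def set_lebesgue_integral_def)
  qed
  finally show ?thesis .
qed

lemma interval_integral_LIMSEQ:
  assumes "integrable lborel (f :: real \<Rightarrow> complex)"
  shows "(\<lambda>n::nat. CLBINT t=-real n..real n. f t) \<longlonglongrightarrow> (CLBINT t. f t)"
proof -
  have [measurable]: "f \<in> borel_measurable borel"
    using assms by auto
  have "(\<lambda>n::nat. CLBINT t. indicator {-real n<..<real n} t *\<^sub>R f t) \<longlonglongrightarrow> (CLBINT t. f t)"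
  proof (rule integral_dominated_convergence[where w = "\<lambda>t. norm (f t)"])
    show "AE t in lborel. (\<lambda>n. indicator {-real n<..<real n} t *\<^sub>R f t) \<longlonglongrightarrow> f t"
    proof (rule AE_I2)
      fix t
      obtain n0 where "\<bar>t\<bar> < real n0" using reals_Archimedean2 by blast
      then have "\<forall>\<^sub>F n in sequentially. indicator {-real n<..<real n} t *\<^sub>R f t = f t"
        by (intro eventually_sequentiallyI[of n0]) (auto simp: indicator_def)
      then show "(\<lambda>n. indicator {-real n<..<real n} t *\<^sub>R f t) \<longlonglongrightarrow> f t"
        by (simp add: tendsto_eventually)
    qed
  qed (use assms in \<open>auto simp: indicator_def\<close>)
  then show ?thesis
    by (simp add: interval_lebesgue_integral_def set_lebesgue_integral_def)
qed

text \<open>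
  The right-hand side of the inversion formula; at \<open>x = 0\<close> its value is the default \<open>0\<close>.
\<close>
definition inversion_density :: "real measure \<Rightarrow> real \<Rightarrow> complex" where
  "inversion_density M x = 1 / (2 * \<i> * of_real pi * of_real x) *
     (CLBINT t. iexp (-(t * x)) * vector_derivative (char M) (at t))"

lemma isCont_inversion_density:
  assumes "integrable lborel (\<lambda>t. vector_derivative (char M) (at t))" "x \<noteq> 0"
  shows "isCont (inversion_density M) x"
  using assms(2) isCont_iexp_transform[OF assms(1), of x] unfolding inversion_density_def
  by (intro continuous_intros) auto

text \<open>
  Let the truncation in Levy's formula tend to infinity. After integration by parts the truncated
  Fourier integrals are bounded by \<open>(N + 2) / \<bar>x\<bar>\<close>, where \<open>N\<close> is the \<open>L\<^sup>1\<close> norm of the derivative;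
  away from \<open>0\<close> this bound is constant, and dominated convergence applies on \<open>{a..b}\<close>.
\<close>
lemma (in real_distribution) measure_Ioc_eq_integral:
  assumes int: "integrable M (\<lambda>x. x)"
    and F': "integrable lborel (\<lambda>t. vector_derivative (char M) (at t))"
    and lim: "(char M \<longlongrightarrow> 0) at_top" "(char M \<longlongrightarrow> 0) at_bot"
    and ab: "a < b" "0 \<notin> {a..b}" and null: "measure M {a} = 0" "measure M {b} = 0"
  shows "complex_of_real (measure M {a<..b}) = (CLBINT x. indicator {a..b} x *\<^sub>R inversion_density M x)"
proof -
  define F' where "F' = (\<lambda>t. vector_derivative (char M) (at t))"
  have iF': "integrable lborel F'" using assms(2) by (simp add: F'_def)
  then have mF'[measurable]: "F' \<in> borel_measurable borel" by auto
  define N where "N = (LBINT t. norm (F' t))"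
  define K where "K = (N + 2) / min \<bar>a\<bar> \<bar>b\<bar>"
  define J where "J = (\<lambda>(n::nat) x. CLBINT t=-real n..real n. iexp (-(t * x)) * char M t)"
  have J: "J n x = ((CLBINT t=-real n..real n. iexp (-(t * x)) * F' t) -
      (iexp (-(n * x)) * char M n - iexp (n * x) * char M (-real n))) / (\<i> * x)" if "x \<noteq> 0" for n x
    unfolding J_def F'_def using char_by_parts[OF int _ that, of "real n"] by simp
  have ieF': "integrable lborel (\<lambda>t. iexp (-(t * x)) * F' t)" for x
    by (rule Bochner_Integration.integrable_bound[OF iF']) (auto simp: norm_mult)
  have N0: "0 \<le> N" by (simp add: N_def)
  have mina: "0 < min \<bar>a\<bar> \<bar>b\<bar>" using ab by auto
  have "(\<lambda>n. CLBINT x. indicator {a..b} x *\<^sub>R J n x) \<longlonglongrightarrow>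
    (CLBINT x. indicator {a..b} x *\<^sub>R (2 * pi * inversion_density M x))"
  proof (rule integral_dominated_convergence[where w = "\<lambda>x. indicator {a..b} x * K"])
    have "isCont (inversion_density M) x" if "x \<noteq> 0" for x
      using iF' that unfolding F'_def by (rule isCont_inversion_density)
    then have "continuous_on {a..b} (inversion_density M)"
      using ab by (intro continuous_at_imp_continuous_on) auto
    then have "(\<lambda>x. indicator {a..b} x *\<^sub>R inversion_density M x) \<in> borel_measurable borel"
      by (intro borel_measurable_continuous_on_indicator) auto
    then have "(\<lambda>x. (2 * pi) * (indicator {a..b} x *\<^sub>R inversion_density M x)) \<in> borel_measurable borel"
      by (intro borel_measurable_times) auto
    then show "(\<lambda>x. indicator {a..b} x *\<^sub>R (2 * pi * inversion_density M x)) \<in> borel_measurable lborel"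
      by simp
    show "(\<lambda>x. indicator {a..b} x *\<^sub>R J n x) \<in> borel_measurable lborel" for n
      unfolding J_def interval_lebesgue_integral_def set_lebesgue_integral_def by (simp add: einterval_eq)
    show "integrable lborel (\<lambda>x. indicator {a..b} x * K)"
      using ab by (intro integrable_mult_left integrable_real_indicator) auto
    show "AE x in lborel. (\<lambda>n. indicator {a..b} x *\<^sub>R J n x) \<longlonglongrightarrow> indicator {a..b} x *\<^sub>R (2 * pi * inversion_density M x)"
    proof (rule AE_I2)
      fix x
      show "(\<lambda>n. indicator {a..b} x *\<^sub>R J n x) \<longlonglongrightarrow> indicator {a..b} x *\<^sub>R (2 * pi * inversion_density M x)"
      proof (cases "x \<in> {a..b}")
        case True
        then have x0: "x \<noteq> 0" using ab by auto
        have 1: "(\<lambda>n::nat. char M (real n)) \<longlonglongrightarrow> 0"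
          using lim(1) filterlim_real_sequentially by (rule filterlim_compose)
        have 2: "(\<lambda>n::nat. char M (-real n)) \<longlonglongrightarrow> 0"
          by (rule filterlim_compose[OF lim(2)]) (simp add: filterlim_real_sequentially filterlim_uminus_at_bot)
        have "(\<lambda>n::nat. iexp (-(n * x)) * char M n) \<longlonglongrightarrow> 0" "(\<lambda>n::nat. iexp (n * x) * char M (-real n)) \<longlonglongrightarrow> 0"
          using tendsto_norm_zero[OF 1] tendsto_norm_zero[OF 2]
          by (rule_tac [!] tendsto_norm_zero_cancel) (simp_all add: norm_mult)
        then have "(\<lambda>n. J n x) \<longlonglongrightarrow> ((CLBINT t. iexp (-(t * x)) * F' t) - (0 - 0)) / (\<i> * x)"
          unfolding J[OF x0] using x0 by (intro tendsto_intros interval_integral_LIMSEQ ieF') auto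
        also have "((CLBINT t. iexp (-(t * x)) * F' t) - (0 - 0)) / (\<i> * x) = 2 * pi * inversion_density M x"
          using x0 by (simp add: inversion_density_def F'_def)
        finally show ?thesis using True by simp
      qed simp
    qed
    show "AE x in lborel. cmod (indicator {a..b} x *\<^sub>R J n x) \<le> indicator {a..b} x * K" for n
    proof (rule AE_I2)
      fix x
      show "cmod (indicator {a..b} x *\<^sub>R J n x) \<le> indicator {a..b} x * K"
      proof (cases "x \<in> {a..b}")
        case True
        then have x0: "x \<noteq> 0" and xm: "min \<bar>a\<bar> \<bar>b\<bar> \<le> \<bar>x\<bar>" using ab by auto
        have "cmod (CLBINT t=-real n..real n. iexp (-(t * x)) * F' t)
            = cmod (CLBINT t. indicator {-real n<..<real n} t *\<^sub>R (iexp (-(t * x)) * F' t))"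
          by (simp add: interval_lebesgue_integral_def set_lebesgue_integral_def)
        also have "\<dots> \<le> (LBINT t. norm (indicator {-real n<..<real n} t *\<^sub>R (iexp (-(t * x)) * F' t)))"
          by (rule integral_norm_bound)
        also have "\<dots> \<le> N"
          unfolding N_def
        proof (rule integral_mono)
          show "integrable lborel (\<lambda>t. norm (indicator {-real n<..<real n} t *\<^sub>R (iexp (-(t * x)) * F' t)))"
            by (rule Bochner_Integration.integrable_bound[OF iF']) (auto simp: norm_mult indicator_def)
        qed (use iF' in \<open>auto simp: norm_mult indicator_def\<close>)
        finally have 1: "cmod (CLBINT t=-real n..real n. iexp (-(t * x)) * F' t) \<le> N" .
        have 2: "cmod (iexp (-(n * x)) * char M n) \<le> 1" "cmod (iexp (n * x) * char M (-real n)) \<le> 1"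
          using cmod_char_le_1 by (auto simp: norm_mult)
        have "cmod (J n x) * \<bar>x\<bar> = cmod ((CLBINT t=-real n..real n. iexp (-(t * x)) * F' t) -
             (iexp (-(n * x)) * char M n - iexp (n * x) * char M (-real n)))"
          unfolding J[OF x0] using x0 by (simp add: norm_divide norm_mult)
        also have "\<dots> \<le> N + (1 + 1)"
          using 1 2 by (intro order_trans[OF norm_triangle_ineq4] add_mono) auto
        finally have "cmod (J n x) \<le> (N + 2) / \<bar>x\<bar>"
          using x0 by (simp add: field_simps)
        also have "\<dots> \<le> K"
          unfolding K_def using xm mina N0 by (intro divide_left_mono) auto
        finally show ?thesis using True by simp
      qed simp
    qed
  qed
  then have "(\<lambda>n. 1 / (2 * pi) * (CLBINT x. indicator {a..b} x *\<^sub>R J n x)) \<longlonglongrightarrow>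
    1 / (2 * pi) * (CLBINT x. indicator {a..b} x *\<^sub>R (2 * pi * inversion_density M x))"
    by (intro tendsto_intros)
  moreover have "(\<lambda>n. 1 / (2 * pi) * (CLBINT x. indicator {a..b} x *\<^sub>R J n x)) \<longlonglongrightarrow> measure M {a<..b}"
    using Levy_Inversion[of a b] ab null
    unfolding J_def by (subst Levy_integral_eq[symmetric]) auto
  ultimately have "complex_of_real (measure M {a<..b}) =
      1 / (2 * pi) * (CLBINT x. indicator {a..b} x *\<^sub>R (2 * pi * inversion_density M x))"
    using LIMSEQ_unique by blast
  also have "(CLBINT x. indicator {a..b} x *\<^sub>R (2 * pi * inversion_density M x))
      = (CLBINT x. (2 * pi) * (indicator {a..b} x *\<^sub>R (inversion_density M x)))"
    by (intro Bochner_Integration.integral_cong refl) simp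
  also have "\<dots> = (2 * pi) * (CLBINT x. indicator {a..b} x *\<^sub>R (inversion_density M x))"
    by (rule integral_mult_right_zero)
  finally show ?thesis by simp
qed

lemma norm_integral_indicator_le:
  assumes "a \<le> b" "\<And>x. x \<in> {a..b} \<Longrightarrow> norm (f x :: complex) \<le> B" "0 \<le> B"
  shows "norm (CLBINT x. indicator {a..b} x *\<^sub>R f x) \<le> B * (b - a)"
proof -
  have "norm (CLBINT x. indicator {a..b} x *\<^sub>R f x) \<le> (LBINT x. norm (indicator {a..b} x *\<^sub>R f x))"
    by (rule integral_norm_bound)
  also have "\<dots> \<le> (LBINT x. B * indicator {a..b} x)"
  proof (rule integral_mono')
    show "integrable lborel (\<lambda>x. B * indicator {a..b} x)"
      using assms(1) by (intro integrable_mult_right integrable_real_indicator) auto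
  qed (use assms in \<open>auto simp: indicator_def\<close>)
  also have "\<dots> = B * (b - a)"
    using assms by simp
  finally show ?thesis .
qed

text \<open>
  Levy's formula speaks only of intervals whose endpoints are not atoms, so atoms are excluded first: an
  atom at \<open>x \<noteq> 0\<close> lies in short intervals with harmless endpoints, whose mass is at most their
  length times a bound of the continuous function \<open>inversion_density M\<close>. Averaging that function
  over shrinking intervals then shows that its values are nonnegative reals, and exhaustion of the
  half lines by intervals away from \<open>0\<close> identifies the measure.
\<close>
lemma (in real_distribution) density_from_char_derivative:
  assumes int: "integrable M (\<lambda>x. x)"
    and F': "integrable lborel (\<lambda>t. vector_derivative (char M) (at t))"
    and lim: "(char M \<longlongrightarrow> 0) at_top" "(char M \<longlongrightarrow> 0) at_bot"
    and null: "measure M {0} = 0"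
  obtains p where "\<And>x. 0 \<le> p x" "p \<in> borel_measurable borel"
    "M = density lborel (\<lambda>x. ennreal (p x))"
    "\<And>x. x \<noteq> 0 \<Longrightarrow> complex_of_real (p x) = inversion_density M x"
proof -
  define h where "h = inversion_density M"
  have cont: "isCont h x" if "x \<noteq> 0" for x
    unfolding h_def using F' that by (rule isCont_inversion_density)
  have mh[measurable]: "h \<in> borel_measurable borel"
  proof -
    have [measurable]: "(\<lambda>t. vector_derivative (char M) (at t)) \<in> borel_measurable borel"
      using F' by auto
    show ?thesis unfolding h_def inversion_density_def by measurable
  qed
  have inth: "complex_integrable lborel (\<lambda>x. indicator {a..b} x *\<^sub>R h x)" if "0 \<notin> {a..b}" for a b
    using that cont by (intro borel_integrable_compact continuous_at_imp_continuous_on) auto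

  have atom: "measure M {x} = 0" for x
  proof (cases "x = 0")
    case False
    define A where "A = {y. measure M {y} \<noteq> 0}"
    have "countable A" unfolding A_def by (rule countable_support)
    have "compact {x - \<bar>x\<bar> / 2..x + \<bar>x\<bar> / 2}" by simp
    moreover have "continuous_on {x - \<bar>x\<bar> / 2..x + \<bar>x\<bar> / 2} h"
      using False by (intro continuous_at_imp_continuous_on ballI cont) auto
    ultimately have "compact (h ` {x - \<bar>x\<bar> / 2..x + \<bar>x\<bar> / 2})"
      by (intro compact_continuous_image)
    then obtain B where B: "0 < B" "\<And>y. y \<in> {x - \<bar>x\<bar> / 2..x + \<bar>x\<bar> / 2} \<Longrightarrow> norm (h y) \<le> B"
      by (auto dest!: compact_imp_bounded simp: bounded_pos)
    have "measure M {x} \<le> 0 + e" if "0 < e" for e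
    proof -
      \<comment> \<open>Half the distance to \<open>0\<close> keeps the interval inside the region where \<open>B\<close> bounds the density.\<close>
      define d where "d = min (\<bar>x\<bar> / 2) (e / (2 * B))"
      have d: "0 < d" "d \<le> \<bar>x\<bar> / 2" "B * (2 * d) \<le> e"
        using False B(1) that by (auto simp: d_def min_def field_simps)
      obtain a where a: "x - d < a" "a < x" "a \<notin> A"
        using real_interval_avoid_countable_set[of "x - d" x A] \<open>countable A\<close> d by auto
      obtain b where b: "x < b" "b < x + d" "b \<notin> A"
        using real_interval_avoid_countable_set[of x "x + d" A] \<open>countable A\<close> d by auto
      have "measure M {x} \<le> measure M {a<..b}"
        using a b by (intro finite_measure_mono) auto
      also have "\<dots> = norm (complex_of_real (measure M {a<..b}))" by simp
      also have "\<dots> = norm (CLBINT y. indicator {a..b} y *\<^sub>R h y)"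
        unfolding h_def using a b d False
        by (subst measure_Ioc_eq_integral[OF int F' lim]) (auto simp: A_def)
      also have "\<dots> \<le> B * (b - a)"
        using a b d B by (intro norm_integral_indicator_le) auto
      also have "\<dots> \<le> B * (2 * d)"
        using a b B by (intro mult_left_mono) auto
      finally show ?thesis using d by simp
    qed
    then have "measure M {x} \<le> 0" by (rule field_le_epsilon)
    then show ?thesis by (simp add: measure_le_0_iff)
  qed (use null in simp)

  have Ioc: "complex_of_real (measure M {a<..b}) = (CLBINT y. indicator {a..b} y *\<^sub>R h y)"
    if "a < b" "0 \<notin> {a..b}" for a b
    unfolding h_def using measure_Ioc_eq_integral[OF int F' lim that atom atom] .

  have nonneg: "h x \<in> \<real>\<^sub>\<ge>\<^sub>0" if "x \<noteq> 0" for x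
  proof -
    have "\<exists>y\<in>\<real>\<^sub>\<ge>\<^sub>0. dist y (h x) < e" if "0 < e" for e
    proof -
      obtain r where r: "0 < r" "\<And>y. dist y x < r \<Longrightarrow> dist (h y) (h x) < e / 2"
        using cont[OF \<open>x \<noteq> 0\<close>] \<open>0 < e\<close> unfolding continuous_at_eps_delta by (metis half_gt_zero)
      define d where "d = min (r / 2) (\<bar>x\<bar> / 2)"
      have d: "0 < d" "d < r" "0 \<notin> {x..x + d}" using r \<open>x \<noteq> 0\<close> by (auto simp: d_def min_def)
      have "(CLBINT y. indicator {x..x + d} y *\<^sub>R (h y - h x)) = (CLBINT y. indicator {x..x + d} y *\<^sub>R h y - indicator {x..x + d} y *\<^sub>R h x)"
        by (simp add: scaleR_diff_right)
      also have "\<dots> = (CLBINT y. indicator {x..x + d} y *\<^sub>R h y) - (CLBINT y. indicator {x..x + d} y *\<^sub>R h x)"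
        using d by (intro Bochner_Integration.integral_diff inth integrable_scaleR_left integrable_real_indicator) auto
      also have "\<dots> = complex_of_real (measure M {x<..x + d}) - d *\<^sub>R h x"
        using d by (subst Ioc[symmetric]) auto
      finally have eq: "(CLBINT y. indicator {x..x + d} y *\<^sub>R (h y - h x)) =
          complex_of_real (measure M {x<..x + d}) - d *\<^sub>R h x" .
      have "norm (complex_of_real (measure M {x<..x + d}) - d *\<^sub>R h x) \<le> e / 2 * (x + d - x)"
        unfolding eq[symmetric]
      proof (rule norm_integral_indicator_le)
        fix y assume "y \<in> {x..x + d}"
        then have "dist y x < r" using d by (auto simp: dist_real_def)
        from r(2)[OF this] show "norm (h y - h x) \<le> e / 2" by (simp add: dist_norm)
      qed (use d \<open>0 < e\<close> in auto)
      moreover have "complex_of_real (measure M {x<..x + d}) - d *\<^sub>R h x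
          = d *\<^sub>R (complex_of_real (measure M {x<..x + d} / d) - h x)"
        using d by (simp add: scaleR_conv_of_real right_diff_distrib)
      ultimately have "d * norm (complex_of_real (measure M {x<..x + d} / d) - h x) \<le> d * (e / 2)"
        using d by (simp add: mult.commute)
      then have "dist (complex_of_real (measure M {x<..x + d} / d)) (h x) \<le> e / 2"
        using d by (simp add: dist_norm)
      moreover have "complex_of_real (measure M {x<..x + d} / d) \<in> \<real>\<^sub>\<ge>\<^sub>0"
        using d by (simp only: nonneg_Reals_of_real_iff) simp
      ultimately show ?thesis using \<open>0 < e\<close> by (intro bexI) auto
    qed
    then show ?thesis
      using closed_approachable[OF closed_nonneg_Reals_complex] by blast
  qed

  define p where "p = (\<lambda>x. if x = 0 then 0 else Re (h x))"
  have p0: "0 \<le> p x" for x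
    using nonneg[of x] by (auto simp: p_def complex_nonneg_Reals_iff)
  have ph: "complex_of_real (p x) = h x" if "x \<noteq> 0" for x
    using nonneg[OF that] that by (auto simp: p_def complex_nonneg_Reals_iff complex_eq_iff)
  have mp[measurable]: "p \<in> borel_measurable borel"
    unfolding p_def by measurable
  define N where "N = density lborel (\<lambda>x. ennreal (p x))"
  have [measurable_cong, simp]: "sets N = sets borel" by (simp add: N_def)

  have eq_Ioc: "emeasure M {a<..b} = emeasure N {a<..b}" if "a < b" "0 \<notin> {a..b}" for a b
  proof -
    have eq: "indicator {a..b} y *\<^sub>R h y = complex_of_real (indicator {a..b} y * p y)" for y
      using that ph[of y] by (auto simp: indicator_def)
    have "complex_of_real (measure M {a<..b}) = complex_of_real (LBINT y. indicator {a..b} y * p y)"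
      unfolding Ioc[OF that] eq by (rule integral_complex_of_real)
    then have m: "measure M {a<..b} = (LBINT y. indicator {a..b} y * p y)"
      by (simp only: of_real_eq_iff)
    have i: "integrable lborel (\<lambda>y. indicator {a..b} y * p y)"
      using inth[OF that(2)] unfolding eq by (simp only: complex_of_real_integrable_eq)
    have "emeasure N {a<..b} = (\<integral>\<^sup>+y. ennreal (p y) * indicator {a<..b} y \<partial>lborel)"
      unfolding N_def by (subst emeasure_density) auto
    also have "\<dots> = (\<integral>\<^sup>+y. ennreal (indicator {a..b} y * p y) \<partial>lborel)"
      by (intro nn_integral_cong_AE AE_I'[of "{a}"] finite_imp_null_set_lborel)
         (auto simp: indicator_def)
    also have "\<dots> = ennreal (LBINT y. indicator {a..b} y * p y)"
      using i by (intro nn_integral_eq_integral) (auto simp: p0)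
    finally show ?thesis by (simp add: emeasure_eq_measure m)
  qed

  have eq_Union: "emeasure M (\<Union>n. A n) = emeasure N (\<Union>n. A n)"
    if "\<And>n. emeasure M (A n) = emeasure N (A n)" "\<And>n. A n \<in> sets borel" "incseq A" for A :: "nat \<Rightarrow> real set"
    using that by (subst (1 2) SUP_emeasure_incseq[symmetric]) auto

  have pos: "emeasure M {x<..} = emeasure N {x<..}" if "0 < x" for x
  proof -
    have U: "{x<..} = (\<Union>n::nat. {x<..x + 1 + n})"
    proof safe
      fix y assume "x < y"
      moreover obtain n :: nat where "y - x < n" using reals_Archimedean2 by blast
      ultimately show "y \<in> (\<Union>n::nat. {x<..x + 1 + n})" by (auto intro!: exI[of _ n])
    qed auto
    show ?thesis unfolding U
      using that by (intro eq_Union eq_Ioc) (auto simp: incseq_def)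
  qed
  have zero: "emeasure M {0<..} = emeasure N {0<..}"
  proof -
    have U: "{0<..} = (\<Union>n::nat. {1 / Suc n<..})"
    proof safe
      fix y :: real assume "0 < y"
      then obtain n where "1 / Suc n < y" using nat_approx_posE by blast
      then show "y \<in> (\<Union>n::nat. {1 / Suc n<..})" by auto
    qed (auto intro: less_trans[rotated])
    show ?thesis unfolding U
      by (intro eq_Union pos) (auto simp: incseq_def field_simps intro: order_le_less_trans[rotated])
  qed
  have "M = N"
  proof (rule measure_eqI_lessThan)
    fix x :: real
    consider "0 < x" | "x = 0" | "x < 0" by linarith
    then show "emeasure M {x<..} = emeasure N {x<..}"
    proof cases
      case 3
      have U: "{x<..<0} = (\<Union>n::nat. {x<..x / (real n + 2)})"
      proof (intro set_eqI iffI)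
        fix y :: real assume "y \<in> {x<..<0}"
        then have "x < y" "y < 0" by auto
        obtain n :: nat where "x / y < n" using reals_Archimedean2 by blast
        then have "y \<le> x / (real n + 2)" using \<open>x < y\<close> \<open>y < 0\<close> by (simp add: field_simps)
        then have "y \<in> {x<..x / (real n + 2)}" using \<open>x < y\<close> by simp
        then show "y \<in> (\<Union>n::nat. {x<..x / (real n + 2)})" by (rule UN_I[OF UNIV_I])
      next
        fix y :: real assume "y \<in> (\<Union>n::nat. {x<..x / (real n + 2)})"
        then obtain n :: nat where "y \<in> {x<..x / (real n + 2)}" by blast
        moreover have "x / (real n + 2) < 0" using 3 by (intro divide_neg_pos) auto
        ultimately show "y \<in> {x<..<0}" by auto
      qed
      have neg: "emeasure M {x<..<0} = emeasure N {x<..<0}"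
        unfolding U
      proof (intro eq_Union eq_Ioc)
        show "x < x / (real n + 2)" for n :: nat
          using 3 mult_neg_pos[of x "real n + 1"] by (simp add: field_simps)
        show "0 \<notin> {x..x / (real n + 2)}" for n :: nat
          using 3 divide_neg_pos[of x "real n + 2"] by auto
        show "incseq (\<lambda>n::nat. {x<..x / (real n + 2)})"
        proof (rule incseq_SucI, rule subsetI)
          fix n :: nat and y assume "y \<in> {x<..x / (real n + 2)}"
          moreover have "x / (real n + 2) \<le> x / (real (Suc n) + 2)"
            using 3 by (intro divide_left_mono_neg) auto
          ultimately show "y \<in> {x<..x / (real (Suc n) + 2)}" by auto
        qed
      qed auto
      have split: "emeasure L {x<..} = emeasure L {x<..<0} + (emeasure L {0} + emeasure L {0<..})"
        if [simp]: "sets L = sets borel" for L :: "real measure"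
      proof -
        have S: "{x<..} = {x<..<0} \<union> ({0} \<union> {0<..})" using 3 by auto
        show ?thesis
          unfolding S by (subst plus_emeasure[symmetric], simp, simp, force, subst plus_emeasure[symmetric]) auto
      qed
      have "emeasure N {0} = 0"
        unfolding N_def by (subst emeasure_density) (auto simp: p_def intro!: nn_integral_0_iff_AE[THEN iffD2] AE_I2)
      moreover have "emeasure M {0} = 0" by (simp add: emeasure_eq_measure null)
      ultimately show ?thesis
        using neg zero by (simp add: split)
    qed (auto simp: pos zero)
  qed (auto simp: emeasure_eq_measure)
  then show thesis
    using that[of p] p0 mp ph unfolding N_def h_def by blast
qed

section \<open>A product of two exponential scale factors\<close>

abbreviation exp_law :: "real \<Rightarrow> real measure" where
  "exp_law l \<equiv> density lborel (exponential_density l)"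

lemma real_distribution_exp_law: "0 < l \<Longrightarrow> real_distribution (exp_law l)"
  unfolding real_distribution_def real_distribution_axioms_def
  by (simp add: prob_space_exponential_density)

lemma AE_exp_law_nonneg: "AE t in exp_law l. 0 \<le> t"
  by (subst AE_density) (auto simp: exponential_density_def)

lemma exp_law_moment:
  assumes "0 < l" "r < l"
  shows "integrable (exp_law l) (\<lambda>t. exp (r * t))" "(LINT t|exp_law l. exp (r * t)) = l / (l - r)"
proof -
  interpret P: prob_space "exp_law (l - r)"
    using assms by (intro prob_space_exponential_density) simp
  have i: "integrable lborel (\<lambda>t. exponential_density (l - r) t *\<^sub>R (1::real))"
    using assms by (intro integrable_density[where f = "\<lambda>_. 1::real" and g = "exponential_density (l - r)", THEN iffD1])
      (auto simp: exponential_density_nonneg)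
  have I: "(LBINT t. exponential_density (l - r) t *\<^sub>R (1::real)) = 1"
    using assms P.prob_space
    by (subst integral_density[where f = "\<lambda>_. 1::real", symmetric])
      (auto simp: exponential_density_nonneg simp del: space_density)
  have eq: "exponential_density l t *\<^sub>R exp (r * t) = (l / (l - r)) * (exponential_density (l - r) t *\<^sub>R (1::real))" for t
  proof -
    have "exp (- t * l) * exp (r * t) = exp (- t * (l - r))"
      by (simp add: algebra_simps flip: exp_add)
    then show ?thesis
      using assms by (simp add: exponential_density_def)
  qed
  have "integrable lborel (\<lambda>t. exponential_density l t *\<^sub>R exp (r * t))"
    unfolding eq by (rule integrable_mult_right[OF i])
  then show "integrable (exp_law l) (\<lambda>t. exp (r * t))"
    using assms by (subst integrable_density) (auto simp: exponential_density_nonneg)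
  have "(LINT t|exp_law l. exp (r * t)) = (LBINT t. exponential_density l t *\<^sub>R exp (r * t))"
    using assms by (intro integral_density) (auto simp: exponential_density_nonneg)
  also have "\<dots> = l / (l - r)"
    unfolding eq by (subst integral_mult_right_zero) (simp only: I)
  finally show "(LINT t|exp_law l. exp (r * t)) = l / (l - r)" .
qed

text \<open>
  The integrand times the exponential density is the derivative of
  \<open>t \<mapsto> - exp (- l * t) * iexp (w * exp (- m * t))\<close>. In terms of \<open>R = exp (- m * T)\<close>, whose
  characteristic function is \<open>\<psi>\<close>, this is the differential equation \<open>\<psi>(w) + (m w / l) \<psi>'(w) = iexp w\<close>.
\<close>
lemma exp_law_identity:
  fixes m l w :: real
  assumes "0 < l" "0 < m"
  shows "(CLINT t|exp_law l. (1 + \<i> * (m * w / l) * exp (- m * t)) * iexp (w * exp (- m * t))) = iexp w"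
proof -
  interpret P: prob_space "exp_law l"
    using assms by (intro prob_space_exponential_density)
  define g where "g = (\<lambda>t. (1 + \<i> * (m * w / l) * exp (- m * t)) * iexp (w * exp (- m * t)))"
  define f where "f = (\<lambda>t. (l * exp (- l * t)) *\<^sub>R g t)"
  define \<Phi> where "\<Phi> = (\<lambda>t. - (exp (- l * t) *\<^sub>R iexp (w * exp (- m * t))))"
  have mg[measurable]: "g \<in> borel_measurable borel" unfolding g_def by measurable
  have ig: "integrable (exp_law l) g"
  proof (rule P.integrable_const_bound[where B = "1 + \<bar>m * w / l\<bar>"])
    show "AE t in exp_law l. cmod (g t) \<le> 1 + \<bar>m * w / l\<bar>"
      using AE_exp_law_nonneg
    proof eventually_elim
      fix t :: real assume "0 \<le> t"
      then have e: "exp (- m * t) \<le> 1" using assms by simp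
      have "cmod (g t) = cmod (1 + \<i> * (m * w / l) * exp (- m * t))" by (simp add: g_def norm_mult)
      also have "\<dots> \<le> 1 + \<bar>m * w / l\<bar> * exp (- m * t)"
        by (rule order_trans[OF norm_triangle_ineq]) (simp add: norm_mult norm_divide abs_mult)
      also have "\<dots> \<le> 1 + \<bar>m * w / l\<bar>"
        using mult_left_mono[OF e, of "\<bar>m * w / l\<bar>"] by simp
      finally show "cmod (g t) \<le> 1 + \<bar>m * w / l\<bar>" .
    qed
  qed simp
  have AEeq: "AE t in lborel. exponential_density l t *\<^sub>R g t = indicator (einterval 0 \<infinity>) t *\<^sub>R f t"
    by (intro AE_I'[of "{0}"] finite_imp_null_set_lborel)
       (auto simp: exponential_density_def f_def indicator_def einterval_def mult.commute)
  have "integrable lborel (\<lambda>t. exponential_density l t *\<^sub>R g t)"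
    using ig assms by (subst (asm) integrable_density) (auto simp: exponential_density_nonneg)
  then have sf: "set_integrable lborel (einterval 0 \<infinity>) f"
    unfolding set_integrable_def
    by (rule integrable_cong_AE_imp) (use AEeq in \<open>auto simp: f_def\<close>)
  have "(CLINT t|exp_law l. g t) = (CLBINT t. exponential_density l t *\<^sub>R g t)"
    using assms by (intro integral_density) (auto simp: exponential_density_nonneg)
  also have "\<dots> = (CLBINT t. indicator (einterval 0 \<infinity>) t *\<^sub>R f t)"
    by (rule integral_cong_AE) (use AEeq in \<open>auto simp: f_def\<close>)
  also have "\<dots> = (CLBINT t=0..\<infinity>. f t)"
    by (simp add: interval_lebesgue_integral_def set_lebesgue_integral_def)
  also have "\<dots> = 0 - (- iexp w)"
  proof (rule interval_integral_FTC_integrable[where F = \<Phi>])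
    show "set_integrable lborel (einterval 0 \<infinity>) f" by (rule sf)
    show "isCont f t" for t unfolding f_def g_def by (intro continuous_intros)
    show "(\<Phi> has_vector_derivative f t) (at t)" for t
      using assms unfolding \<Phi>_def f_def g_def
      by (auto intro!: derivative_eq_intros simp: Re_exp Im_exp has_vector_derivative_complex_iff
            field_simps simp flip: of_real_mult of_real_divide)
    have "(\<Phi> \<longlongrightarrow> \<Phi> 0) (at_right 0)"
    proof -
      have "isCont \<Phi> 0" unfolding \<Phi>_def by (intro continuous_intros)
      then show ?thesis by (simp add: isCont_def filterlim_at_split)
    qed
    then show "((\<Phi> \<circ> real_of_ereal) \<longlongrightarrow> - iexp w) (at_right 0)"
      unfolding zero_ereal_def ereal_tendsto_simps by (simp add: \<Phi>_def)
    have "((\<lambda>t. exp (- l * t)) \<longlongrightarrow> 0) at_top"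
      using assms by real_asymp
    then have "(\<Phi> \<longlongrightarrow> 0) at_top"
      by (intro tendsto_norm_zero_cancel[of \<Phi>]) (simp add: \<Phi>_def)
    then show "((\<Phi> \<circ> real_of_ereal) \<longlongrightarrow> 0) (at_left \<infinity>)"
      unfolding ereal_tendsto_simps .
  qed simp_all
  finally show ?thesis by (simp add: g_def)
qed

lemma norm_exp_law_transform_le_1:
  assumes "0 < l"
  shows "norm (CLINT t|exp_law l. iexp (g t)) \<le> 1"
proof -
  interpret P: prob_space "exp_law l"
    using assms by (intro prob_space_exponential_density)
  have "norm (CLINT t|exp_law l. iexp (g t)) \<le> (LINT t|exp_law l. norm (iexp (g t)))"
    by (rule integral_norm_bound)
  also have "\<dots> = 1" by (simp del: space_density add: P.prob_space)
  finally show ?thesis .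
qed

text \<open>
  Since \<open>l > m\<close>, one factor \<open>exp (- m * t)\<close> may be split off the exponential density, which leaves an
  exponential density of rate \<open>l - m\<close>; \<open>exp_law_identity\<close> for this rate expresses the transform as
  \<open>1 / w\<close> times a bounded quantity.
\<close>
lemma norm_exp_law_transform_le:
  fixes m l w :: real
  assumes "0 < m" "m < l" "w \<noteq> 0"
  shows "norm (CLINT t|exp_law l. iexp (w * exp (- m * t))) \<le> 2 * l / (m * \<bar>w\<bar>)"
proof -
  define k where "k = l - m"
  have k: "0 < k" using assms by (simp add: k_def)
  interpret P: prob_space "exp_law k"
    using k by (intro prob_space_exponential_density)
  let ?e = "\<lambda>t. iexp (w * exp (- m * t))"
  define c where "c = \<i> * (m * w / k)"
  have i1: "integrable (exp_law k) ?e"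
    by (intro P.integrable_iexp) auto
  have i2: "integrable (exp_law k) (\<lambda>t. exp (- m * t) *\<^sub>R ?e t)"
  proof (rule Bochner_Integration.integrable_bound)
    show "integrable (exp_law k) (\<lambda>t. exp (- m * t))"
      using exp_law_moment(1)[of k "-m"] k assms by simp
  qed (auto simp del: of_real_exp)
  have eq: "exponential_density k t *\<^sub>R (exp (- m * t) *\<^sub>R ?e t) = (k / l) *\<^sub>R (exponential_density l t *\<^sub>R ?e t)" for t
  proof -
    have "exp (- t * k) * exp (- m * t) = exp (- t * l)"
      by (simp add: k_def algebra_simps flip: exp_add)
    then have "exponential_density k t * exp (- m * t) = (k / l) * exponential_density l t"
      using assms by (simp add: exponential_density_def)
    then show ?thesis by (simp only: scaleR_scaleR)
  qed
  have "(CLINT t|exp_law k. exp (- m * t) *\<^sub>R ?e t) = (CLBINT t. exponential_density k t *\<^sub>R (exp (- m * t) *\<^sub>R ?e t))"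
    using k by (intro integral_density) (auto simp: exponential_density_nonneg)
  also have "\<dots> = (k / l) *\<^sub>R (CLBINT t. exponential_density l t *\<^sub>R ?e t)"
    unfolding eq by (rule integral_scaleR_right)
  also have "(CLBINT t. exponential_density l t *\<^sub>R ?e t) = (CLINT t|exp_law l. ?e t)"
    using assms by (intro integral_density[symmetric]) (auto simp: exponential_density_nonneg)
  finally have A: "(CLINT t|exp_law k. exp (- m * t) *\<^sub>R ?e t) = (k / l) *\<^sub>R (CLINT t|exp_law l. ?e t)" .
  have "iexp w = (CLINT t|exp_law k. (1 + \<i> * (m * w / k) * exp (- m * t)) * ?e t)"
    using exp_law_identity[OF k assms(1)] by simp
  also have "\<dots> = (CLINT t|exp_law k. ?e t + c * (exp (- m * t) *\<^sub>R ?e t))"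
    by (intro Bochner_Integration.integral_cong refl) (simp add: c_def scaleR_conv_of_real algebra_simps)
  also have "\<dots> = (CLINT t|exp_law k. ?e t) + c * (CLINT t|exp_law k. exp (- m * t) *\<^sub>R ?e t)"
    by (subst Bochner_Integration.integral_add[OF i1 integrable_mult_right[OF i2]]) (simp only: integral_mult_right_zero)
  finally have "c * ((k / l) *\<^sub>R (CLINT t|exp_law l. ?e t)) = iexp w - (CLINT t|exp_law k. ?e t)"
    unfolding A by simp
  then have "norm (c * ((k / l) *\<^sub>R (CLINT t|exp_law l. ?e t))) \<le> norm (iexp w) + norm (CLINT t|exp_law k. ?e t)"
    by (simp only: norm_triangle_ineq4)
  also have "\<dots> \<le> 1 + 1"
    by (intro add_mono norm_exp_law_transform_le_1 k) simp
  finally have "m * \<bar>w\<bar> / l * norm (CLINT t|exp_law l. ?e t) \<le> 2"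
    using assms k by (simp add: c_def norm_mult norm_divide abs_mult)
  then show ?thesis
    using assms by (simp add: field_simps)
qed

text \<open>
  The law of \<open>exp (- m * (s + t))\<close> for independent exponential \<open>s\<close> and \<open>t\<close> of rates \<open>l\<close> and \<open>k\<close>.
\<close>
definition scale_law :: "real \<Rightarrow> real \<Rightarrow> real \<Rightarrow> real measure" where
  "scale_law m l k = distr (exp_law l \<Otimes>\<^sub>M exp_law k) borel (\<lambda>(s, t). exp (- m * (s + t)))"

lemma sets_scale_law [simp, measurable_cong]: "sets (scale_law m l k) = sets borel"
  by (simp add: scale_law_def)

context
  fixes m l k :: real
  assumes m: "0 < m" and l: "0 < l" and k: "m < k"
begin

interpretation P1: prob_space "exp_law l"
  using l by (rule prob_space_exponential_density)

interpretation P2: prob_space "exp_law k"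
  using m k by (intro prob_space_exponential_density) simp

interpretation P: pair_prob_space "exp_law l" "exp_law k" ..

lemma real_distribution_scale_law: "real_distribution (scale_law m l k)"
proof -
  interpret prob_space "scale_law m l k"
    unfolding scale_law_def by (rule P.prob_space_distr) measurable
  show ?thesis
    by unfold_locales (simp_all add: scale_law_def)
qed

lemma AE_scale_law: "AE r in scale_law m l k. 0 < r \<and> r \<le> 1"
proof -
  have "AE z in exp_law l \<Otimes>\<^sub>M exp_law k. 0 \<le> fst z \<and> 0 \<le> snd z"
  proof (rule P.AE_pair_measure)
    show "AE x in exp_law l. AE y in exp_law k. 0 \<le> fst (x, y) \<and> 0 \<le> snd (x, y)"
      using AE_exp_law_nonneg[of l]
    proof eventually_elim
      fix x :: real assume x: "0 \<le> x"
      have "AE y in exp_law k. 0 \<le> y" by (rule AE_exp_law_nonneg)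
      then show "AE y in exp_law k. 0 \<le> fst (x, y) \<and> 0 \<le> snd (x, y)"
        by eventually_elim (simp add: x)
    qed
  qed measurable
  then have "AE z in exp_law l \<Otimes>\<^sub>M exp_law k. (case z of (s, t) \<Rightarrow> exp (- m * (s + t))) \<le> 1"
    by eventually_elim (use m in \<open>auto simp: split_beta\<close>)
  then show ?thesis
    unfolding scale_law_def by (subst AE_distr_iff) (auto simp: split_beta)
qed

lemma integrable_scale_law: "integrable (scale_law m l k) (\<lambda>r. r)"
proof -
  interpret real_distribution "scale_law m l k" by (rule real_distribution_scale_law)
  show ?thesis
    using AE_scale_law by (intro integrable_const_bound[where B = 1]) auto
qed

lemma integral_scale_law:
  fixes f :: "real \<Rightarrow> complex"
  assumes [measurable]: "f \<in> borel_measurable borel" and f: "\<And>r. 0 < r \<Longrightarrow> r \<le> 1 \<Longrightarrow> norm (f r) \<le> B"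
  shows "(CLINT r|scale_law m l k. f r) = (CLINT t|exp_law k. (CLINT s|exp_law l. f (exp (- m * (s + t)))))"
    and "(CLINT r|scale_law m l k. f r) = (CLINT s|exp_law l. (CLINT t|exp_law k. f (exp (- m * (s + t)))))"
proof -
  interpret S: real_distribution "scale_law m l k" by (rule real_distribution_scale_law)
  have "integrable (scale_law m l k) f"
    using AE_scale_law f by (intro S.integrable_const_bound[where B = B]) auto
  then have i: "integrable (exp_law l \<Otimes>\<^sub>M exp_law k) (\<lambda>(s, t). f (exp (- m * (s + t))))"
    unfolding scale_law_def by (subst (asm) integrable_distr_eq) (auto simp: case_prod_beta')
  have "(CLINT r|scale_law m l k. f r) = (CLINT z|exp_law l \<Otimes>\<^sub>M exp_law k. (case z of (s, t) \<Rightarrow> f (exp (- m * (s + t)))))"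
    unfolding scale_law_def by (subst integral_distr) (auto simp: case_prod_beta')
  with P.integral_fst[OF i] P.integral_snd[OF i]
  show "(CLINT r|scale_law m l k. f r) = (CLINT t|exp_law k. (CLINT s|exp_law l. f (exp (- m * (s + t)))))"
    "(CLINT r|scale_law m l k. f r) = (CLINT s|exp_law l. (CLINT t|exp_law k. f (exp (- m * (s + t)))))"
    by simp_all
qed

text \<open>
  The differential equation of a single exponential factor, applied to the first factor with \<open>w\<close>
  replaced by \<open>x\<close> times the second factor, and then averaged over the second factor.
\<close>
lemma char_scale_law_ode:
  "char (scale_law m l k) x + (m * x / l) * (CLINT r|scale_law m l k. \<i> * of_real r * iexp (x * r)) =
   (CLINT t|exp_law k. iexp (x * exp (- m * t)))"
proof -
  interpret S: real_distribution "scale_law m l k" by (rule real_distribution_scale_law)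
  have i1: "integrable (scale_law m l k) (\<lambda>r. iexp (x * r))"
    by (intro S.integrable_iexp) auto
  have i2: "integrable (scale_law m l k) (\<lambda>r. \<i> * of_real r * iexp (x * r))"
    by (rule Bochner_Integration.integrable_bound[OF integrable_scale_law]) (auto simp: norm_mult)
  have "char (scale_law m l k) x + (m * x / l) * (CLINT r|scale_law m l k. \<i> * of_real r * iexp (x * r))
    = (CLINT r|scale_law m l k. iexp (x * r) + (m * x / l) * (\<i> * of_real r * iexp (x * r)))"
    unfolding char_def
    by (subst Bochner_Integration.integral_add[OF i1 integrable_mult_right[OF i2]]) (simp only: integral_mult_right_zero)
  also have "\<dots> = (CLINT r|scale_law m l k. (1 + \<i> * (m * x / l) * r) * iexp (x * r))"
    by (intro Bochner_Integration.integral_cong refl) (simp add: algebra_simps)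
  also have "\<dots> = (CLINT t|exp_law k. (CLINT s|exp_law l. (1 + \<i> * (m * x / l) * exp (- m * (s + t))) * iexp (x * exp (- m * (s + t)))))"
  proof (rule integral_scale_law(1)[where B = "1 + \<bar>m * x / l\<bar>"])
    fix r :: real assume r: "0 < r" "r \<le> 1"
    have "cmod ((1 + \<i> * (m * x / l) * r) * iexp (x * r)) = cmod (1 + \<i> * (m * x / l) * r)" by (simp add: norm_mult)
    also have "\<dots> \<le> 1 + \<bar>m * x / l\<bar> * r"
      using r by (intro order_trans[OF norm_triangle_ineq]) (simp add: norm_mult norm_divide abs_mult)
    also have "\<dots> \<le> 1 + \<bar>m * x / l\<bar>"
      using mult_left_mono[OF r(2), of "\<bar>m * x / l\<bar>"] by simp
    finally show "cmod ((1 + \<i> * (m * x / l) * r) * iexp (x * r)) \<le> 1 + \<bar>m * x / l\<bar>" .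
  qed measurable
  also have "\<dots> = (CLINT t|exp_law k. iexp (x * exp (- m * t)))"
  proof (intro Bochner_Integration.integral_cong refl)
    fix t :: real
    have e: "exp (- m * (s + t)) = exp (- m * t) * exp (- m * s)" for s
      by (simp add: algebra_simps flip: exp_add)
    have "(CLINT s|exp_law l. (1 + \<i> * (m * x / l) * exp (- m * (s + t))) * iexp (x * exp (- m * (s + t))))
        = (CLINT s|exp_law l. (1 + \<i> * (m * (x * exp (- m * t)) / l) * exp (- m * s)) * iexp (x * exp (- m * t) * exp (- m * s)))"
      unfolding e by (intro Bochner_Integration.integral_cong refl) (simp add: mult.assoc)
    also have "\<dots> = iexp (x * exp (- m * t))"
      using exp_law_identity[OF l m, of "x * exp (- m * t)"] by simp
    finally show "(CLINT s|exp_law l. (1 + \<i> * (m * x / l) * exp (- m * (s + t))) * iexp (x * exp (- m * (s + t))))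
        = iexp (x * exp (- m * t))" .
  qed
  finally show ?thesis .
qed

text \<open>
  Conditionally on the first factor \<open>exp (- m * s)\<close>, the modulus is at most \<open>1\<close> and at most
  \<open>D exp (m * s) / \<bar>x\<bar>\<close>, hence at most the \<open>d\<close>-th power of the latter; this power has a finite
  expectation when \<open>m * d < l\<close>.
\<close>
lemma norm_char_scale_law_le:
  assumes "x \<noteq> 0" and d: "0 < d" "d \<le> 1" "m * d < l"
  shows "norm (char (scale_law m l k) x) \<le> (2 * k / m) powr d * (l / (l - m * d)) * \<bar>x\<bar> powr (- d)"
proof -
  define D where "D = 2 * k / m"
  have D: "0 < D" using m k by (simp add: D_def)
  have inner: "norm (CLINT t|exp_law k. iexp (x * exp (- m * (s + t)))) \<le> (D / \<bar>x\<bar>) powr d * exp (m * d * s)" for s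
  proof -
    let ?N = "norm (CLINT t|exp_law k. iexp (x * exp (- m * (s + t))))"
    \<comment> \<open>\<open>q\<close> is the bound of order \<open>1 / w\<close> for \<open>w = x * exp (- m * s)\<close>; the other bound is \<open>1\<close>.\<close>
    define q where "q = D / (\<bar>x\<bar> * exp (- m * s))"
    have q: "0 < q" using D assms by (simp add: q_def)
    have e: "x * exp (- m * (s + t)) = (x * exp (- m * s)) * exp (- m * t)" for t
      by (simp add: algebra_simps flip: exp_add)
    have "?N \<le> 2 * k / (m * \<bar>x * exp (- m * s)\<bar>)"
      unfolding e using assms m k by (intro norm_exp_law_transform_le) auto
    then have 1: "?N \<le> q" by (simp add: q_def D_def abs_mult)
    have 2: "?N \<le> 1" using m k by (intro norm_exp_law_transform_le_1) simp
    have "?N \<le> q powr d"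
    proof (cases "1 \<le> q")
      case True
      then show ?thesis using 2 ge_one_powr_ge_zero[of q d] d by linarith
    next
      case False
      then have "q powr 1 \<le> q powr d" using q d by (intro powr_mono') auto
      then show ?thesis using 1 q by simp
    qed
    also have "q = (D / \<bar>x\<bar>) * exp (m * s)" by (simp add: q_def exp_minus field_simps)
    also have "\<dots> powr d = (D / \<bar>x\<bar>) powr d * exp (m * d * s)"
      using D by (subst powr_mult) (auto simp: exp_powr_real mult_ac)
    finally show ?thesis .
  qed
  have "norm (char (scale_law m l k) x) = norm (CLINT s|exp_law l. (CLINT t|exp_law k. iexp (x * exp (- m * (s + t)))))"
    unfolding char_def by (subst integral_scale_law(2)[where B = 1]) auto
  also have "\<dots> \<le> (LINT s|exp_law l. norm (CLINT t|exp_law k. iexp (x * exp (- m * (s + t)))))"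
    by (rule integral_norm_bound)
  also have "\<dots> \<le> (LINT s|exp_law l. (D / \<bar>x\<bar>) powr d * exp (m * d * s))"
    using inner exp_law_moment(1)[OF l d(3)]
    by (intro integral_mono') (auto intro!: integrable_mult_right)
  also have "\<dots> = (D / \<bar>x\<bar>) powr d * (l / (l - m * d))"
    using exp_law_moment(2)[OF l d(3)] by simp
  also have "(D / \<bar>x\<bar>) powr d = D powr d * \<bar>x\<bar> powr (- d)"
    using D by (simp add: powr_divide powr_minus_divide)
  finally show ?thesis by (simp add: D_def algebra_simps)
qed

lemma char_scale_law_tendsto_0:
  "(char (scale_law m l k) \<longlongrightarrow> 0) at_top" "(char (scale_law m l k) \<longlongrightarrow> 0) at_bot"
proof -
  define d where "d = min 1 (l / (2 * m))"
  have d: "0 < d" "d \<le> 1" "m * d < l"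
    using m l by (auto simp: d_def min_def field_simps)
  define C where "C = (2 * k / m) powr d * (l / (l - m * d))"
  have le: "norm (char (scale_law m l k) x) \<le> C * \<bar>x\<bar> powr (- d)" if "x \<noteq> 0" for x
    unfolding C_def using norm_char_scale_law_le[OF that d] .
  have "((\<lambda>x. C * \<bar>x\<bar> powr (- d)) \<longlongrightarrow> 0) at_top" "((\<lambda>x. C * \<bar>x\<bar> powr (- d)) \<longlongrightarrow> 0) at_bot"
    using d by real_asymp+
  moreover have "\<forall>\<^sub>F x in at_top. norm (char (scale_law m l k) x) \<le> C * \<bar>x\<bar> powr (- d)"
    using eventually_ge_at_top[of 1] by eventually_elim (rule le, simp)
  moreover have "\<forall>\<^sub>F x in at_bot. norm (char (scale_law m l k) x) \<le> C * \<bar>x\<bar> powr (- d)"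
    using eventually_le_at_bot[of "-1"] by eventually_elim (rule le, simp)
  ultimately show "(char (scale_law m l k) \<longlongrightarrow> 0) at_top" "(char (scale_law m l k) \<longlongrightarrow> 0) at_bot"
    by (auto intro: Lim_null_comparison)
qed

text \<open>
  The differential equation bounds \<open>\<bar>x\<bar>\<close> times the derivative by the decay of the two characteristic
  functions in it, which is at least of order \<open>\<bar>x\<bar> powr (- d)\<close>. So the derivative is
  \<open>O(\<bar>x\<bar> powr (- d - 1))\<close> at infinity, and it is bounded by \<open>1\<close> everywhere.
\<close>
lemma integrable_char_scale_law_deriv:
  "integrable lborel (\<lambda>x. CLINT r|scale_law m l k. \<i> * of_real r * iexp (x * r))" (is "integrable _ ?D")
proof -
  interpret S: real_distribution "scale_law m l k" by (rule real_distribution_scale_law)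
  define d where "d = min 1 (l / (2 * m))"
  have d: "0 < d" "d \<le> 1" "m * d < l"
    using m l by (auto simp: d_def min_def field_simps)
  define C where "C = l / m * ((2 * k / m) + (2 * k / m) powr d * (l / (l - m * d)))"
  have C: "0 \<le> C" using m l k d by (simp add: C_def)
  have far: "norm (?D x) \<le> C * \<bar>x\<bar> powr (- d - 1)" if x: "1 \<le> \<bar>x\<bar>" for x
  proof -
    have x0: "x \<noteq> 0" using x by auto
    have "m * \<bar>x\<bar> / l * norm (?D x) = norm ((m * x / l) * ?D x)"
      using m l by (simp add: norm_mult norm_divide)
    also have "(m * x / l) * ?D x = (CLINT t|exp_law k. iexp (x * exp (- m * t))) - char (scale_law m l k) x"
      using char_scale_law_ode[of x] by (simp add: algebra_simps)
    also have "norm \<dots> \<le> 2 * k / (m * \<bar>x\<bar>) + (2 * k / m) powr d * (l / (l - m * d)) * \<bar>x\<bar> powr (- d)"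
      using norm_exp_law_transform_le[OF m k x0] norm_char_scale_law_le[OF x0 d]
      by (intro order_trans[OF norm_triangle_ineq4] add_mono)
    also have "2 * k / (m * \<bar>x\<bar>) = (2 * k / m) * \<bar>x\<bar> powr (- 1)"
      using x0 by (simp add: powr_minus_divide)
    also have "\<dots> \<le> (2 * k / m) * \<bar>x\<bar> powr (- d)"
      using x d m k by (intro mult_left_mono powr_mono) auto
    finally have "m * \<bar>x\<bar> / l * norm (?D x) \<le> ((2 * k / m) + (2 * k / m) powr d * (l / (l - m * d))) * \<bar>x\<bar> powr (- d)"
      by (simp add: distrib_right)
    then have "norm (?D x) \<le> C * (\<bar>x\<bar> powr (- d) / \<bar>x\<bar>)"
      using m l x0 by (simp add: C_def field_simps)
    also have "\<bar>x\<bar> powr (- d) / \<bar>x\<bar> = \<bar>x\<bar> powr (- d - 1)"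
      using x0 by (simp add: powr_diff)
    finally show ?thesis .
  qed
  have near: "norm (?D x) \<le> 1" for x
  proof -
    have "norm (?D x) \<le> (LINT r|scale_law m l k. norm (\<i> * of_real r * iexp (x * r)))"
      by (rule integral_norm_bound)
    also have "\<dots> \<le> (LINT r|scale_law m l k. 1)"
      by (rule integral_mono_AE')
         (use AE_scale_law in \<open>auto simp: norm_mult\<close>)
    finally show ?thesis by (simp del: S.space_eq_univ add: S.prob_space)
  qed
  define f where "f = (\<lambda>x::real. indicator {1..} x * x powr (- d - 1))"
  have f: "integrable lborel f"
  proof (rule integrableI_nonneg)
    have "(\<integral>\<^sup>+x. ennreal (f x) \<partial>lborel) = (\<integral>\<^sup>+x. ennreal (x powr (- d - 1)) * indicator {1..} x \<partial>lborel)"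
      by (intro nn_integral_cong) (auto simp: f_def indicator_def)
    also have "\<dots> = ennreal (0 - (- (1 powr (- d) / d)))"
    proof (rule nn_integral_FTC_atLeast)
      show "((\<lambda>x. - (x powr (- d) / d)) has_real_derivative x powr (- d - 1)) (at x)" if "1 \<le> x" for x :: real
        using that d by (auto intro!: derivative_eq_intros)
      show "((\<lambda>x. - (x powr (- d) / d)) \<longlongrightarrow> 0) at_top"
        using d by real_asymp
    qed auto
    finally show "(\<integral>\<^sup>+x. ennreal (f x) \<partial>lborel) < \<infinity>" by simp
  qed (auto simp: f_def)
  have "integrable lborel (\<lambda>x. f (0 + (-1) * x))"
    by (rule lborel_integrable_real_affine[OF f]) simp
  then have "integrable lborel (\<lambda>x. indicator {-1..1} x + C * (f x + f (-x)))"
    using f by (intro Bochner_Integration.integrable_add integrable_mult_right integrable_real_indicator) auto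
  then show ?thesis
  proof (rule Bochner_Integration.integrable_bound)
    show "AE x in lborel. norm (?D x) \<le> norm (indicator {-1..1} x + C * (f x + f (-x)))"
    proof (rule AE_I2)
      fix x :: real
      have f0: "0 \<le> f y" for y by (simp add: f_def)
      have "norm (?D x) \<le> indicator {-1..1} x + C * (f x + f (-x))"
      proof (cases "\<bar>x\<bar> \<le> 1")
        case True
        moreover have "0 \<le> C * (f x + f (-x))" using C f0[of x] f0[of "-x"] by simp
        ultimately show ?thesis using near[of x] by (simp add: indicator_def abs_le_iff)
      next
        case False
        then have "f x + f (-x) = \<bar>x\<bar> powr (- d - 1)" by (auto simp: f_def indicator_def)
        then show ?thesis using far[of x] False by (auto simp: indicator_def)
      qed
      also have "\<dots> \<le> norm (indicator {-1..1} x + C * (f x + f (-x)))" by simp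
      finally show "norm (?D x) \<le> norm (indicator {-1..1} x + C * (f x + f (-x)))" .
    qed
  qed measurable
qed

end

section \<open>Scale mixtures\<close>

text \<open>
  With \<open>K\<close> the derivative of the characteristic function of \<open>R\<close>, that of the product law is
  \<open>x \<mapsto> \<integral> w * K (x * w) \<partial>Q\<close>. The \<open>L\<^sup>1\<close> norm of \<open>x \<mapsto> w * K (x * w)\<close> does not depend on \<open>w \<noteq> 0\<close>, so
  Fubini's theorem gives integrability for every mixing law \<open>Q\<close> with a first moment.
\<close>
lemma scale_mixture:
  fixes R Q :: "real measure"
  assumes "real_distribution R" "real_distribution Q"
    and iR: "integrable R (\<lambda>r. r)" and iQ: "integrable Q (\<lambda>w. w)"
  defines "N \<equiv> distr (R \<Otimes>\<^sub>M Q) borel (\<lambda>(r, w). r * w)"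
  shows integrable_char_deriv_scale_mixture:
    "integrable lborel (\<lambda>x. CLINT r|R. \<i> * of_real r * iexp (x * r)) \<Longrightarrow>
     integrable lborel (\<lambda>x. CLINT y|N. \<i> * of_real y * iexp (x * y))"
    and char_scale_mixture_tendsto_0:
    "(char R \<longlongrightarrow> 0) at_top \<Longrightarrow> (char R \<longlongrightarrow> 0) at_bot \<Longrightarrow> measure Q {0} = 0 \<Longrightarrow>
     (char N \<longlongrightarrow> 0) at_top \<and> (char N \<longlongrightarrow> 0) at_bot"
proof -
  interpret R: real_distribution R by fact
  interpret Q: real_distribution Q by fact
  interpret P: pair_prob_space R Q ..
  interpret QL: pair_sigma_finite Q lborel ..
  have intN: "(CLINT y|N. g y) = (CLINT w|Q. CLINT r|R. g (r * w))"
    if "g \<in> borel_measurable borel" "\<And>y. norm (g y) \<le> B + C * \<bar>y\<bar>" for g :: "real \<Rightarrow> complex" and B C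
  proof -
    note that(1)[measurable]
    have "integrable (R \<Otimes>\<^sub>M Q) (\<lambda>(r, w). r * w)"
    proof (rule P.Fubini_integrable)
      show "integrable R (\<lambda>r. LINT w|Q. norm (case (r, w) of (r, w) \<Rightarrow> r * w))"
        using integrable_mult_left[OF integrable_abs[OF iR], of "LINT w|Q. \<bar>w\<bar>"] by (simp add: abs_mult)
      show "AE r in R. integrable Q (\<lambda>w. case (r, w) of (r, w) \<Rightarrow> r * w)"
        using iQ by (intro AE_I2) auto
    qed measurable
    then have "integrable (R \<Otimes>\<^sub>M Q) (\<lambda>z. B + C * \<bar>case z of (r, w) \<Rightarrow> r * w\<bar>)"
      by (intro Bochner_Integration.integrable_add integrable_mult_right integrable_abs) auto
    then have i: "integrable (R \<Otimes>\<^sub>M Q) (\<lambda>(r, w). g (r * w))"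
      by (rule Bochner_Integration.integrable_bound) (auto intro!: AE_I2 order_trans[OF that(2)])
    have "(CLINT y|N. g y) = (CLINT z|R \<Otimes>\<^sub>M Q. (case z of (r, w) \<Rightarrow> g (r * w)))"
      unfolding N_def by (subst integral_distr) (auto simp: case_prod_beta')
    with P.integral_snd[OF i] show ?thesis by simp
  qed

  show "integrable lborel (\<lambda>x. CLINT y|N. \<i> * of_real y * iexp (x * y))"
    if K: "integrable lborel (\<lambda>x. CLINT r|R. \<i> * of_real r * iexp (x * r))"
  proof -
    define K where "K = (\<lambda>x. CLINT r|R. \<i> * of_real r * iexp (x * r))"
    have iK: "integrable lborel K" using K by (simp add: K_def)
    then have [measurable]: "K \<in> borel_measurable borel" by auto
    have eq: "(CLINT y|N. \<i> * of_real y * iexp (x * y)) = (CLINT w|Q. w *\<^sub>R K (x * w))" for x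
    proof -
      have "(CLINT y|N. \<i> * of_real y * iexp (x * y)) = (CLINT w|Q. CLINT r|R. \<i> * of_real (r * w) * iexp (x * (r * w)))"
        by (rule intN[of _ 0 1]) (auto simp: norm_mult)
      also have "\<dots> = (CLINT w|Q. w *\<^sub>R K (x * w))"
        unfolding K_def
        by (subst integral_scaleR_right[symmetric], intro Bochner_Integration.integral_cong refl)
           (simp add: scaleR_conv_of_real mult_ac)
      finally show ?thesis .
    qed
    have norm_eq: "(LINT x|lborel. norm (w *\<^sub>R K (x * w))) = (if w = 0 then 0 else LINT x|lborel. norm (K x))" for w
      using lborel_integral_real_affine[of w "\<lambda>x. norm (K x)" 0] by (simp add: mult.commute)
    have "integrable (Q \<Otimes>\<^sub>M lborel) (\<lambda>(w, x). w *\<^sub>R K (x * w))"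
    proof (rule QL.Fubini_integrable)
      show "integrable Q (\<lambda>w. LINT x|lborel. norm (case (w, x) of (w, x) \<Rightarrow> w *\<^sub>R K (x * w)))"
        using norm_eq by (intro Q.integrable_const_bound[where B = "LINT x|lborel. norm (K x)"]) auto
      show "AE w in Q. integrable lborel (\<lambda>x. case (w, x) of (w, x) \<Rightarrow> w *\<^sub>R K (x * w))"
      proof (rule AE_I2)
        fix w
        show "integrable lborel (\<lambda>x. case (w, x) of (w, x) \<Rightarrow> w *\<^sub>R K (x * w))"
          using lborel_integrable_real_affine[OF iK, of w 0]
          by (cases "w = 0") (simp_all add: mult.commute)
      qed
    qed measurable
    from QL.integrable_snd[OF this] show ?thesis
      unfolding eq by simp
  qed

  show "(char N \<longlongrightarrow> 0) at_top \<and> (char N \<longlongrightarrow> 0) at_bot"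
    if lim: "(char R \<longlongrightarrow> 0) at_top" "(char R \<longlongrightarrow> 0) at_bot" and null: "measure Q {0} = 0"
  proof -
    have ch: "char N x = (CLINT w|Q. char R (x * w))" for x
      unfolding char_def
      by (subst intN[of _ 1 0]) (auto simp: mult_ac)
    have nz: "AE w in Q. w \<noteq> 0"
      using null by (subst AE_iff_measurable[of "{0}"]) (auto simp: Q.emeasure_eq_measure)
    have seq: "(\<lambda>n. char N (X n)) \<longlonglongrightarrow> 0"
      if X: "\<And>w. w \<noteq> 0 \<Longrightarrow> (\<lambda>n. char R (X n * w)) \<longlonglongrightarrow> 0" for X
    proof -
      have "(\<lambda>n. CLINT w|Q. char R (X n * w)) \<longlonglongrightarrow> (CLINT w|Q. 0)"
      proof (rule integral_dominated_convergence[where w = "\<lambda>_. 1"])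
        show "AE w in Q. (\<lambda>n. char R (X n * w)) \<longlonglongrightarrow> 0"
          using nz by eventually_elim (rule X)
      qed (auto simp: R.cmod_char_le_1)
      then show ?thesis by (simp add: ch)
    qed
    have pos: "(\<lambda>n. char R (X n * w)) \<longlonglongrightarrow> 0" if "filterlim X at_top sequentially" "w \<noteq> 0" for X :: "nat \<Rightarrow> real" and w
    proof (cases "w > 0")
      case True
      have "filterlim (\<lambda>n. X n * w) at_top sequentially"
        using filterlim_at_top_mult_tendsto_pos[OF tendsto_const True that(1)] .
      then show ?thesis by (rule filterlim_compose[OF lim(1)])
    next
      case False
      then have "filterlim (\<lambda>n. X n * (- w)) at_top sequentially"
        using filterlim_at_top_mult_tendsto_pos[OF tendsto_const _ that(1), of "- w"] that(2) by simp
      then have "filterlim (\<lambda>n. X n * w) at_bot sequentially"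
        by (simp add: filterlim_uminus_at_bot)
      then show ?thesis by (rule filterlim_compose[OF lim(2)])
    qed
    have "(char N \<longlongrightarrow> 0) at_top"
      by (rule tendsto_at_topI_sequentially) (rule seq, rule pos)
    moreover have "((\<lambda>x. char N (- x)) \<longlongrightarrow> 0) at_top"
    proof (rule tendsto_at_topI_sequentially, rule seq)
      fix X :: "nat \<Rightarrow> real" and w :: real
      assume "filterlim X at_top sequentially" "w \<noteq> 0"
      then show "(\<lambda>n. char R (- X n * w)) \<longlonglongrightarrow> 0"
        using pos[of X "- w"] by simp
    qed
    ultimately show ?thesis by (simp add: filterlim_at_bot_mirror)
  qed
qed

section \<open>Jump chains with deterministic jump rates\<close>

text \<open>
  A jump chain \<open>Z\<close> with transition kernel \<open>K\<close> and holding times \<open>T\<close> whose rates \<open>lam n\<close> depend on the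
  number of jumps only, and not on the state.
\<close>
locale level_chain = prob_space M for M :: "'w measure" +
  fixes K :: "'s::countable \<Rightarrow> 's pmf" and z0 :: 's and lam :: "nat \<Rightarrow> real"
    and Z :: "nat \<Rightarrow> 'w \<Rightarrow> 's" and T :: "nat \<Rightarrow> 'w \<Rightarrow> real"
  assumes measurable_Z[measurable]: "\<And>n. Z n \<in> measurable M (count_space UNIV)"
    and measurable_T[measurable]: "\<And>n. T n \<in> borel_measurable M"
    and lam_pos: "\<And>n. 0 < lam n"
    and fdd: "\<And>n z t. (\<And>k. k < n \<Longrightarrow> 0 \<le> t k) \<Longrightarrow>
      prob {\<omega>\<in>space M. (\<forall>k\<le>n. Z k \<omega> = z k) \<and> (\<forall>k<n. t k < T k \<omega>)} =
        (if z 0 = z0 then \<Prod>k<n. pmf (K (z k)) (z (Suc k)) * exp (- lam k * t k) else 0)"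
begin

definition path_prob :: "nat \<Rightarrow> (nat \<Rightarrow> 's) \<Rightarrow> real" where
  "path_prob n z = (if z 0 = z0 then \<Prod>k<n. pmf (K (z k)) (z (Suc k)) else 0)"

lemma path_prob_nonneg: "0 \<le> path_prob n z"
  by (auto simp: path_prob_def intro!: prod_nonneg)

lemma path_prob_Suc: "path_prob (Suc n) (z(Suc n := w)) = path_prob n z * pmf (K (z n)) w"
proof -
  have "(\<Prod>k<n. pmf (K ((z(Suc n := w)) k)) ((z(Suc n := w)) (Suc k))) = (\<Prod>k<n. pmf (K (z k)) (z (Suc k)))"
    by (intro prod.cong) auto
  then show ?thesis by (auto simp: path_prob_def)
qed

lemma fdd_path_prob:
  assumes "\<And>k. k < n \<Longrightarrow> 0 \<le> t k"
  shows "prob {\<omega>\<in>space M. (\<forall>k\<le>n. Z k \<omega> = z k) \<and> (\<forall>k<n. t k < T k \<omega>)} =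
    path_prob n z * (\<Prod>k<n. exp (- lam k * t k))"
  using assms by (subst fdd) (auto simp: path_prob_def prod.distrib)

lemma prob_partition:
  fixes H :: "'w \<Rightarrow> 'h::countable"
  assumes [measurable]: "Measurable.pred M P" "H \<in> measurable M (count_space UNIV)"
  shows "ennreal (prob {\<omega>\<in>space M. P \<omega>}) =
    (\<integral>\<^sup>+w. ennreal (prob {\<omega>\<in>space M. P \<omega> \<and> H \<omega> = w}) \<partial>count_space UNIV)"
proof -
  have "{\<omega>\<in>space M. P \<omega>} = (\<Union>w\<in>UNIV. {\<omega>\<in>space M. P \<omega> \<and> H \<omega> = w})" by auto
  then have "emeasure M {\<omega>\<in>space M. P \<omega>} = emeasure M (\<Union>w\<in>UNIV. {\<omega>\<in>space M. P \<omega> \<and> H \<omega> = w})" by simp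
  also have "\<dots> = (\<integral>\<^sup>+w. emeasure M {\<omega>\<in>space M. P \<omega> \<and> H \<omega> = w} \<partial>count_space UNIV)"
    by (rule emeasure_UN_countable) (auto simp: disjoint_family_on_def)
  finally show ?thesis by (simp add: emeasure_eq_measure)
qed

text \<open>
  There are countably many histories of the first \<open>n\<close> steps, so an event that is null on each of them
  is null.
\<close>
lemma AE_by_history:
  assumes [measurable]: "Measurable.pred M P"
    and null: "\<And>z. prob {\<omega>\<in>space M. (\<forall>k\<le>n. Z k \<omega> = z k) \<and> \<not> P \<omega>} = 0"
  shows "AE \<omega> in M. P \<omega>"
proof -
  have "AE \<omega> in M. \<forall>h :: 's list. \<not> ((\<forall>k\<le>n. Z k \<omega> = h ! k) \<and> \<not> P \<omega>)"
    unfolding AE_all_countable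
  proof
    fix h :: "'s list"
    show "AE \<omega> in M. \<not> ((\<forall>k\<le>n. Z k \<omega> = h ! k) \<and> \<not> P \<omega>)"
      using null[of "\<lambda>k. h ! k"] by (subst AE_iff_measurable[OF _ refl]) (auto simp: emeasure_eq_measure)
  qed
  then show ?thesis
  proof eventually_elim
    fix \<omega> assume *: "\<forall>h :: 's list. \<not> ((\<forall>k\<le>n. Z k \<omega> = h ! k) \<and> \<not> P \<omega>)"
    have "\<forall>k\<le>n. Z k \<omega> = map (\<lambda>k. Z k \<omega>) [0..<Suc n] ! k"
      by (auto simp del: upt_Suc)
    with * show "P \<omega>" by blast
  qed
qed

text \<open>
  The displayed probabilities contain holding times only through events \<open>t k < T k \<omega>\<close> with
  \<open>t k \<ge> 0\<close>, so positivity has to be derived: for \<open>t = 0\<close> the probabilities of the possible next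
  states sum up to the probability of the history, which leaves no mass for \<open>T n \<omega> \<le> 0\<close>.
\<close>
lemma AE_T_pos: "AE \<omega> in M. \<forall>k. 0 < T k \<omega>"
proof -
  have "AE \<omega> in M. \<forall>k<n. 0 < T k \<omega>" for n
  proof (induction n)
    case (Suc n)
    show ?case
    proof (rule AE_by_history[where n = n])
      fix z :: "nat \<Rightarrow> 's"
      let ?C = "\<lambda>\<omega>. \<forall>k\<le>n. Z k \<omega> = z k"
      have "prob {\<omega>\<in>space M. ?C \<omega>} = prob {\<omega>\<in>space M. ?C \<omega> \<and> (\<forall>k<n. 0 < T k \<omega>)}"
        using Suc.IH by (intro finite_measure_eq_AE) auto
      also have "\<dots> = path_prob n z"
        using fdd_path_prob[of n "\<lambda>_. 0" z] by simp
      finally have C: "prob {\<omega>\<in>space M. ?C \<omega>} = path_prob n z" .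
      have "ennreal (prob {\<omega>\<in>space M. ?C \<omega> \<and> (\<forall>k<Suc n. 0 < T k \<omega>)}) =
        (\<integral>\<^sup>+w. ennreal (prob {\<omega>\<in>space M. (?C \<omega> \<and> (\<forall>k<Suc n. 0 < T k \<omega>)) \<and> Z (Suc n) \<omega> = w}) \<partial>count_space UNIV)"
        by (rule prob_partition) measurable
      also have "\<dots> = (\<integral>\<^sup>+w. ennreal (path_prob n z) * ennreal (pmf (K (z n)) w) \<partial>count_space UNIV)"
      proof (intro nn_integral_cong)
        fix w
        have "{\<omega>\<in>space M. (?C \<omega> \<and> (\<forall>k<Suc n. 0 < T k \<omega>)) \<and> Z (Suc n) \<omega> = w} =
           {\<omega>\<in>space M. (\<forall>k\<le>Suc n. Z k \<omega> = (z(Suc n := w)) k) \<and> (\<forall>k<Suc n. 0 < T k \<omega>)}"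
          by (auto simp: le_Suc_eq)
        then have "prob {\<omega>\<in>space M. (?C \<omega> \<and> (\<forall>k<Suc n. 0 < T k \<omega>)) \<and> Z (Suc n) \<omega> = w} = path_prob n z * pmf (K (z n)) w"
          using fdd_path_prob[of "Suc n" "\<lambda>_. 0" "z(Suc n := w)"] by (simp add: path_prob_Suc)
        then show "ennreal (prob {\<omega>\<in>space M. (?C \<omega> \<and> (\<forall>k<Suc n. 0 < T k \<omega>)) \<and> Z (Suc n) \<omega> = w}) =
          ennreal (path_prob n z) * ennreal (pmf (K (z n)) w)"
          by (simp add: ennreal_mult path_prob_nonneg)
      qed
      also have "\<dots> = ennreal (path_prob n z)"
        by (simp add: nn_integral_cmult nn_integral_pmf measure_pmf.emeasure_space_1[simplified])
      finally have E: "prob {\<omega>\<in>space M. ?C \<omega> \<and> (\<forall>k<Suc n. 0 < T k \<omega>)} = path_prob n z"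
        by (simp add: path_prob_nonneg)
      have "{\<omega>\<in>space M. ?C \<omega> \<and> \<not> (\<forall>k<Suc n. 0 < T k \<omega>)} =
          {\<omega>\<in>space M. ?C \<omega>} - {\<omega>\<in>space M. ?C \<omega> \<and> (\<forall>k<Suc n. 0 < T k \<omega>)}" by auto
      then show "prob {\<omega>\<in>space M. ?C \<omega> \<and> \<not> (\<forall>k<Suc n. 0 < T k \<omega>)} = 0"
        by (simp only:, subst finite_measure_Diff) (auto simp: C E)
    qed measurable
  qed simp
  then have "AE \<omega> in M. \<forall>n. \<forall>k<n. 0 < T k \<omega>" by (simp add: AE_all_countable)
  then show ?thesis by eventually_elim blast
qed

lemma prob_path: "prob {\<omega>\<in>space M. \<forall>k\<le>n. Z k \<omega> = z k} = path_prob n z"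
proof -
  have "prob {\<omega>\<in>space M. \<forall>k\<le>n. Z k \<omega> = z k} = prob {\<omega>\<in>space M. (\<forall>k\<le>n. Z k \<omega> = z k) \<and> (\<forall>k<n. 0 < T k \<omega>)}"
    using AE_T_pos by (intro finite_measure_eq_AE) auto
  then show ?thesis using fdd_path_prob[of n "\<lambda>_. 0" z] by simp
qed

text \<open>
  Here the first \<open>n + i\<close> holding times are restricted but only the first \<open>n\<close> steps of the chain are
  prescribed; the remaining steps are summed out one at a time.
\<close>
lemma prob_path_T:
  assumes t: "\<And>k. 0 \<le> t k"
  shows "prob {\<omega>\<in>space M. (\<forall>k\<le>n. Z k \<omega> = z k) \<and> (\<forall>k<n + i. t k < T k \<omega>)} =
    path_prob n z * (\<Prod>k<n + i. exp (- lam k * t k))"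
proof (induction i arbitrary: n z)
  case 0
  then show ?case using fdd_path_prob[of n t z] t by simp
next
  case (Suc i)
  let ?C = "\<lambda>\<omega>. (\<forall>k\<le>n. Z k \<omega> = z k) \<and> (\<forall>k<n + Suc i. t k < T k \<omega>)"
  let ?p = "\<Prod>k<n + Suc i. exp (- lam k * t k)"
  have p0: "0 \<le> ?p" by (intro prod_nonneg) auto
  have "ennreal (prob {\<omega>\<in>space M. ?C \<omega>}) =
      (\<integral>\<^sup>+w. ennreal (prob {\<omega>\<in>space M. ?C \<omega> \<and> Z (Suc n) \<omega> = w}) \<partial>count_space UNIV)"
    by (rule prob_partition) measurable
  also have "\<dots> = (\<integral>\<^sup>+w. ennreal (path_prob n z * ?p) * ennreal (pmf (K (z n)) w) \<partial>count_space UNIV)"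
  proof (intro nn_integral_cong)
    fix w
    have "{\<omega>\<in>space M. ?C \<omega> \<and> Z (Suc n) \<omega> = w} =
       {\<omega>\<in>space M. (\<forall>k\<le>Suc n. Z k \<omega> = (z(Suc n := w)) k) \<and> (\<forall>k<Suc n + i. t k < T k \<omega>)}"
      by (auto simp: le_Suc_eq)
    then have "prob {\<omega>\<in>space M. ?C \<omega> \<and> Z (Suc n) \<omega> = w} = (path_prob n z * ?p) * pmf (K (z n)) w"
      using Suc.IH[of "Suc n" "z(Suc n := w)"] by (simp add: path_prob_Suc mult_ac del: fun_upd_apply)
    then show "ennreal (prob {\<omega>\<in>space M. ?C \<omega> \<and> Z (Suc n) \<omega> = w}) =
        ennreal (path_prob n z * ?p) * ennreal (pmf (K (z n)) w)"
      using p0 by (simp add: ennreal_mult path_prob_nonneg)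
  qed
  also have "\<dots> = ennreal (path_prob n z * ?p)"
    by (simp add: nn_integral_cmult nn_integral_pmf measure_pmf.emeasure_space_1[simplified])
  finally show ?case
    using p0 path_prob_nonneg[of n z] by (subst (asm) ennreal_inj) auto
qed

lemma prob_path_T_finite:
  assumes "finite J"
  shows "prob {\<omega>\<in>space M. (\<forall>k\<le>n. Z k \<omega> = z k) \<and> (\<forall>k\<in>J. t k < T k \<omega>)} =
    path_prob n z * (\<Prod>k\<in>J. exp (- lam k * max 0 (t k)))"
proof -
  obtain i where i: "J \<subseteq> {..<n + i}"
    using finite_nat_set_iff_bounded[of J] assms by (metis lessThan_iff subsetI trans_less_add2)
  define s where "s = (\<lambda>k. if k \<in> J then max 0 (t k) else 0)"
  have "prob {\<omega>\<in>space M. (\<forall>k\<le>n. Z k \<omega> = z k) \<and> (\<forall>k\<in>J. t k < T k \<omega>)} =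
     prob {\<omega>\<in>space M. (\<forall>k\<le>n. Z k \<omega> = z k) \<and> (\<forall>k<n + i. s k < T k \<omega>)}"
  proof (rule finite_measure_eq_AE)
    have m: "Measurable.pred M (\<lambda>\<omega>. \<forall>k\<in>J. t k < T k \<omega>)"
      using assms by measurable
    show "AE \<omega> in M. \<omega> \<in> {\<omega>\<in>space M. (\<forall>k\<le>n. Z k \<omega> = z k) \<and> (\<forall>k\<in>J. t k < T k \<omega>)} \<longleftrightarrow>
      \<omega> \<in> {\<omega>\<in>space M. (\<forall>k\<le>n. Z k \<omega> = z k) \<and> (\<forall>k<n + i. s k < T k \<omega>)}"
      using AE_T_pos by eventually_elim (use i in \<open>auto simp: s_def\<close>)
    show "{\<omega>\<in>space M. (\<forall>k\<le>n. Z k \<omega> = z k) \<and> (\<forall>k\<in>J. t k < T k \<omega>)} \<in> events"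
      using m by measurable
  qed measurable
  also have "\<dots> = path_prob n z * (\<Prod>k<n + i. exp (- lam k * s k))"
    by (rule prob_path_T) (simp add: s_def)
  also have "(\<Prod>k<n + i. exp (- lam k * s k)) = (\<Prod>k\<in>J. exp (- lam k * max 0 (t k)))"
    by (rule prod.mono_neutral_cong_right) (use i in \<open>auto simp: s_def\<close>)
  finally show ?thesis .
qed

lemma AE_Z0: "AE \<omega> in M. Z 0 \<omega> = z0"
proof -
  have "prob {\<omega>\<in>space M. Z 0 \<omega> = z0} = 1"
    using prob_path[of 0 "\<lambda>_. z0"] by (simp add: path_prob_def)
  then show ?thesis by (simp add: prob_Collect_eq_1)
qed

lemma prob_T_finite:
  assumes "finite J"
  shows "prob {\<omega>\<in>space M. \<forall>k\<in>J. t k < T k \<omega>} = (\<Prod>k\<in>J. exp (- lam k * max 0 (t k)))"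
proof -
  have [measurable]: "Measurable.pred M (\<lambda>\<omega>. \<forall>k\<in>J. t k < T k \<omega>)"
    using assms by measurable
  have "prob {\<omega>\<in>space M. \<forall>k\<in>J. t k < T k \<omega>} = prob {\<omega>\<in>space M. (\<forall>k\<le>0. Z k \<omega> = z0) \<and> (\<forall>k\<in>J. t k < T k \<omega>)}"
    using AE_Z0 by (intro finite_measure_eq_AE) auto
  then show ?thesis
    using prob_path_T_finite[OF assms, of 0 "\<lambda>_. z0" t] by (simp add: path_prob_def)
qed

lemma distr_T: "distr M borel (T k) = exp_law (lam k)"
proof -
  have "distributed M lborel (T k) (exponential_density (lam k))"
    unfolding exponential_distributed_iff[OF lam_pos]
  proof (intro conjI allI impI)
    fix t :: real assume "0 \<le> t"
    have "{\<omega>\<in>space M. T k \<omega> \<le> t} = space M - {\<omega>\<in>space M. \<not> T k \<omega> \<le> t}" by auto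
    then have "prob {\<omega>\<in>space M. T k \<omega> \<le> t} = 1 - prob {\<omega>\<in>space M. \<not> T k \<omega> \<le> t}"
      by (simp only:) (rule prob_compl, measurable)
    also have "prob {\<omega>\<in>space M. \<not> T k \<omega> \<le> t} = exp (- lam k * t)"
      using prob_T_finite[of "{k}" "\<lambda>_. t"] \<open>0 \<le> t\<close> by (simp add: not_le)
    finally show "prob {\<omega>\<in>space M. T k \<omega> \<le> t} = 1 - exp (- t * lam k)"
      by (simp add: mult.commute)
  qed measurable
  then have "distr M lborel (T k) = exp_law (lam k)"
    by (simp add: distributed_def)
  then show ?thesis
    by (simp cong: distr_cong)
qed

definition cylinder :: "nat \<Rightarrow> (nat \<Rightarrow> 's) \<Rightarrow> 'w set" where
  "cylinder n z = {\<omega>\<in>space M. \<forall>k\<le>n. Z k \<omega> = z k}"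

lemma sets_cylinder: "cylinder n z \<in> events"
  unfolding cylinder_def by measurable

text \<open>
  Generators of the independent sigma algebras: \<open>None\<close> stands for the whole chain \<open>Z\<close> and
  \<open>Some k\<close> for the holding time \<open>T k\<close>. The empty set makes the cylinders stable under intersection.
\<close>
fun generators :: "nat option \<Rightarrow> 'w set set" where
  "generators None = insert {} {cylinder n z | n z. True}"
| "generators (Some k) = range (\<lambda>t. {\<omega>\<in>space M. t < T k \<omega>})"

declare generators.simps [simp del]

lemma generators_subset_events: "generators j \<subseteq> events"
  using sets_cylinder by (cases j) (auto simp: generators.simps)

lemma Int_stable_generators: "Int_stable (generators j)"
proof (cases j)
  case None
  have cyl: "cylinder n z \<in> generators None" for n z by (auto simp: generators.simps)
  have le: "cylinder n z \<inter> cylinder n' z' \<in> generators None" if "n \<le> n'" for n n' z z'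
  proof (cases "\<forall>k\<le>n. z k = z' k")
    case True
    then have "cylinder n z \<inter> cylinder n' z' = cylinder n' z'"
      using that by (auto simp: cylinder_def)
    then show ?thesis using cyl by simp
  next
    case False
    then obtain k where "k \<le> n" "z k \<noteq> z' k" by blast
    then have "cylinder n z \<inter> cylinder n' z' = {}"
      using that by (auto simp: cylinder_def dest!: spec[of _ k])
    then show ?thesis by (simp add: generators.simps)
  qed
  have "cylinder n z \<inter> cylinder n' z' \<in> generators None" for n n' z z'
    using le[of n n' z z'] le[of n' n z' z] by (cases "n \<le> n'") (auto simp: Int_commute)
  moreover have "A = {} \<or> (\<exists>n z. A = cylinder n z)" if "A \<in> generators None" for A
    using that by (auto simp: generators.simps)
  moreover have "{} \<in> generators None" by (simp add: generators.simps)
  ultimately show ?thesis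
    unfolding None Int_stable_def by (metis Int_empty_left Int_empty_right)
next
  case (Some k)
  show ?thesis
    unfolding Some Int_stable_def
  proof (intro ballI)
    fix A B assume "A \<in> generators (Some k)" "B \<in> generators (Some k)"
    then obtain t t' where "A = {\<omega>\<in>space M. t < T k \<omega>}" "B = {\<omega>\<in>space M. t' < T k \<omega>}"
      by (auto simp: generators.simps)
    then have "A \<inter> B = {\<omega>\<in>space M. max t t' < T k \<omega>}" by auto
    then show "A \<inter> B \<in> generators (Some k)" unfolding generators.simps by (rule range_eqI)
  qed
qed

lemma indep_generators: "indep_sets generators UNIV"
proof (rule indep_setsI)
  fix A J assume J: "J \<noteq> {}" "finite J" and A: "\<forall>j\<in>J. A j \<in> generators j"
  define I where "I = {k. Some k \<in> J}"
  have I: "finite I"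
    unfolding I_def using finite_vimageI[OF \<open>finite J\<close>, of Some] by (simp add: vimage_def)
  have "\<forall>k\<in>I. \<exists>t. A (Some k) = {\<omega>\<in>space M. t < T k \<omega>}"
  proof
    fix k assume "k \<in> I"
    then have "A (Some k) \<in> generators (Some k)" using A by (simp add: I_def)
    then show "\<exists>t. A (Some k) = {\<omega>\<in>space M. t < T k \<omega>}" by (auto simp: generators.simps)
  qed
  then obtain t where t: "\<And>k. k \<in> I \<Longrightarrow> A (Some k) = {\<omega>\<in>space M. t k < T k \<omega>}"
    by metis
  have pt: "prob (A (Some k)) = exp (- lam k * max 0 (t k))" if "k \<in> I" for k
    using prob_T_finite[of "{k}" t] t[OF that] by simp
  show "prob (\<Inter>j\<in>J. A j) = (\<Prod>j\<in>J. prob (A j))"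
  proof (cases "None \<in> J")
    case False
    then have JI: "J = Some ` I" by (auto simp: I_def image_iff) (metis not_Some_eq)
    then have "(\<Inter>j\<in>J. A j) = {\<omega>\<in>space M. \<forall>k\<in>I. t k < T k \<omega>}"
      using t J(1) by auto
    then show ?thesis
      using pt I by (simp add: prob_T_finite JI prod.reindex)
  next
    case True
    then have JI: "J = insert None (Some ` I)" by (auto simp: I_def image_iff) (metis not_Some_eq)
    have prod: "(\<Prod>j\<in>J. prob (A j)) = prob (A None) * (\<Prod>k\<in>I. exp (- lam k * max 0 (t k)))"
      using pt I by (simp add: JI prod.reindex)
    have "A None \<in> generators None" using A True by blast
    then consider "A None = {}" | n z where "A None = cylinder n z"
      by (auto simp: generators.simps)
    then show ?thesis
    proof cases
      case 1
      then show ?thesis using True unfolding prod by (simp add: Inf_lower2 JI)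
    next
      case 2
      have "(\<Inter>j\<in>J. A j) = {\<omega>\<in>space M. (\<forall>k\<le>n. Z k \<omega> = z k) \<and> (\<forall>k\<in>I. t k < T k \<omega>)}"
        using t 2 by (auto simp: JI cylinder_def)
      then show ?thesis
        using I by (simp add: prod 2 cylinder_def prob_path_T_finite prob_path)
    qed
  qed
qed (rule generators_subset_events)

text \<open>
  The holding times with index in \<open>I\<close> generate the first algebra; the chain together with all
  other holding times generates the second one.
\<close>
definition holding_algebra :: "nat set \<Rightarrow> 'w measure" where
  "holding_algebra I = sigma (space M) (\<Union>j\<in>Some ` I. generators j)"

definition rest_algebra :: "nat set \<Rightarrow> 'w measure" where
  "rest_algebra I = sigma (space M) (\<Union>j\<in>- Some ` I. generators j)"

lemma Union_generators_Pow: "(\<Union>j\<in>J. generators j) \<subseteq> Pow (space M)"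
  using generators_subset_events sets.sets_into_space by blast

lemma space_algebras [simp]:
  "space (holding_algebra I) = space M" "space (rest_algebra I) = space M"
  by (simp_all only: holding_algebra_def rest_algebra_def space_measure_of[OF Union_generators_Pow])

lemma sets_algebras:
  "sets (holding_algebra I) = sigma_sets (space M) (\<Union>j\<in>Some ` I. generators j)"
  "sets (rest_algebra I) = sigma_sets (space M) (\<Union>j\<in>- Some ` I. generators j)"
  by (simp_all only: holding_algebra_def rest_algebra_def sets_measure_of[OF Union_generators_Pow])

lemma subalgebra_algebras: "subalgebra M (holding_algebra I)" "subalgebra M (rest_algebra I)"
  unfolding subalgebra_def sets_algebras using generators_subset_events
  by (auto intro!: sets.sigma_sets_subset)

lemma measurable_T_holding: "k \<in> I \<Longrightarrow> T k \<in> borel_measurable (holding_algebra I)"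
  by (rule borel_measurableI_greater) (auto simp: sets_algebras generators.simps intro!: sigma_sets.Basic)

lemma measurable_T_rest: "k \<notin> I \<Longrightarrow> T k \<in> borel_measurable (rest_algebra I)"
  by (rule borel_measurableI_greater)
     (auto simp: sets_algebras generators.simps intro!: sigma_sets.Basic bexI[of _ "Some k"])

lemma measurable_Z_rest: "Z n \<in> measurable (rest_algebra I) (count_space UNIV)"
proof (subst measurable_count_space_eq2_countable, safe)
  fix w
  have "Z n -` {w} \<inter> space (rest_algebra I) =
    (\<Union>h\<in>{h. h ! n = w}. cylinder n (\<lambda>k. h ! k))"
  proof (intro set_eqI iffI)
    fix \<omega> assume *: "\<omega> \<in> Z n -` {w} \<inter> space (rest_algebra I)"
    have "\<forall>k\<le>n. Z k \<omega> = map (\<lambda>k. Z k \<omega>) [0..<Suc n] ! k"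
      by (auto simp del: upt_Suc)
    then have "\<exists>h. \<forall>k\<le>n. Z k \<omega> = h ! k" by blast
    then obtain h where h: "\<forall>k\<le>n. Z k \<omega> = h ! k" ..
    show "\<omega> \<in> (\<Union>h\<in>{h. h ! n = w}. cylinder n (\<lambda>k. h ! k))"
    proof (rule UN_I)
      show "h \<in> {h. h ! n = w}" using * h by auto
      show "\<omega> \<in> cylinder n (\<lambda>k. h ! k)" using * h by (simp add: cylinder_def)
    qed
  qed (auto simp: cylinder_def)
  also have "\<dots> \<in> sets (rest_algebra I)"
  proof (rule sets.countable_UN'')
    fix h :: "'s list"
    show "cylinder n (\<lambda>k. h ! k) \<in> sets (rest_algebra I)"
      unfolding sets_algebras by (intro sigma_sets.Basic UN_I[of None]) (auto simp: generators.simps)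
  qed auto
  finally show "Z n -` {w} \<inter> space (rest_algebra I) \<in> sets (rest_algebra I)" .
qed auto

lemma indep_holding_rest:
  assumes X: "X \<in> measurable (holding_algebra I) S" and Y: "Y \<in> measurable (rest_algebra I) U"
  shows "indep_var S X U Y"
proof -
  have "indep_sets (\<lambda>i. sigma_sets (space M) (\<Union>j\<in>case_bool (Some ` I) (- Some ` I) i. generators j)) UNIV"
    by (rule indep_sets_collect_sigma)
       (auto simp: indep_generators Int_stable_generators disjoint_family_on_def UNIV_bool
          intro: indep_sets_mono_index[OF _ indep_generators] split: bool.split)
  then have "indep_set (sets (holding_algebra I)) (sets (rest_algebra I))"
    unfolding indep_set_def sets_algebras
    by (rule indep_sets_mono_sets) (auto split: bool.splits)
  note ind = this
  have sX: "sigma_sets (space M) {X -` A \<inter> space M |A. A \<in> sets S} \<subseteq> sets (holding_algebra I)"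
    using measurable_sets[OF X]
      sets.sigma_sets_subset[of "{X -` A \<inter> space M |A. A \<in> sets S}" "holding_algebra I"] by auto
  have sY: "sigma_sets (space M) {Y -` A \<inter> space M |A. A \<in> sets U} \<subseteq> sets (rest_algebra I)"
    using measurable_sets[OF Y]
      sets.sigma_sets_subset[of "{Y -` A \<inter> space M |A. A \<in> sets U}" "rest_algebra I"] by auto
  have "indep_set (sigma_sets (space M) {X -` A \<inter> space M |A. A \<in> sets S})
      (sigma_sets (space M) {Y -` A \<inter> space M |A. A \<in> sets U})"
    using ind[unfolded indep_set_def] unfolding indep_set_def
    by (rule indep_sets_mono_sets) (use sX sY in \<open>auto split: bool.splits\<close>)
  then show ?thesis
    unfolding indep_var_eq
    by (intro conjI measurable_from_subalg[OF subalgebra_algebras(1) X]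
        measurable_from_subalg[OF subalgebra_algebras(2) Y])
qed

end

context level_chain
begin

definition history :: "nat \<Rightarrow> 'w \<Rightarrow> 's list" where
  "history n \<omega> = map (\<lambda>k. Z k \<omega>) [0..<Suc n]"

lemma history_eq_iff: "history n \<omega> = h \<longleftrightarrow> length h = Suc n \<and> (\<forall>k\<le>n. Z k \<omega> = h ! k)"
  unfolding history_def by (auto simp: list_eq_iff_nth_eq less_Suc_eq_le simp del: upt_Suc)

lemma measurable_history[measurable]: "history n \<in> measurable M (count_space UNIV)"
proof (subst measurable_count_space_eq2_countable, safe)
  fix h
  have "history n -` {h} \<inter> space M = {\<omega>\<in>space M. history n \<omega> = h}" by auto
  also have "\<dots> = {\<omega>\<in>space M. length h = Suc n \<and> (\<forall>k\<le>n. Z k \<omega> = h ! k)}"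
    by (simp only: history_eq_iff)
  also have "\<dots> \<in> events" by measurable
  finally show "history n -` {h} \<inter> space M \<in> events" .
qed auto

text \<open>
  Summation of the path probabilities over the histories of the first \<open>n\<close> steps.
\<close>
lemma markov_property:
  assumes "k \<le> n"
  shows "prob {\<omega>\<in>space M. (Z k \<omega> = z \<and> Z n \<omega> = w) \<and> Z (Suc n) \<omega> = w'} =
    prob {\<omega>\<in>space M. Z k \<omega> = z \<and> Z n \<omega> = w} * pmf (K w) w'"
proof -
  have eq: "prob {\<omega>\<in>space M. ((Z k \<omega> = z \<and> Z n \<omega> = w) \<and> Z (Suc n) \<omega> = w') \<and> history n \<omega> = h} =
     prob {\<omega>\<in>space M. (Z k \<omega> = z \<and> Z n \<omega> = w) \<and> history n \<omega> = h} * pmf (K w) w'" for h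
  proof (cases "length h = Suc n \<and> h ! k = z \<and> h ! n = w")
    case True
    have "{\<omega>\<in>space M. ((Z k \<omega> = z \<and> Z n \<omega> = w) \<and> Z (Suc n) \<omega> = w') \<and> history n \<omega> = h} =
        {\<omega>\<in>space M. \<forall>i\<le>Suc n. Z i \<omega> = (((!) h)(Suc n := w')) i}"
      using True assms by (auto simp: history_eq_iff le_Suc_eq)
    moreover have "{\<omega>\<in>space M. (Z k \<omega> = z \<and> Z n \<omega> = w) \<and> history n \<omega> = h} =
        {\<omega>\<in>space M. \<forall>i\<le>n. Z i \<omega> = h ! i}"
      using True assms by (auto simp: history_eq_iff)
    ultimately show ?thesis
      using True by (simp only: prob_path path_prob_Suc)
  next
    case False
    then have no: "history n \<omega> = h \<Longrightarrow> \<not> (Z k \<omega> = z \<and> Z n \<omega> = w)" for \<omega>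
      using assms by (auto simp: history_eq_iff)
    have "{\<omega>\<in>space M. ((Z k \<omega> = z \<and> Z n \<omega> = w) \<and> Z (Suc n) \<omega> = w') \<and> history n \<omega> = h} = {}"
      "{\<omega>\<in>space M. (Z k \<omega> = z \<and> Z n \<omega> = w) \<and> history n \<omega> = h} = {}"
      using no by auto
    then show ?thesis by (simp only: measure_empty mult_zero_left)
  qed
  have "ennreal (prob {\<omega>\<in>space M. (Z k \<omega> = z \<and> Z n \<omega> = w) \<and> Z (Suc n) \<omega> = w'}) =
     (\<integral>\<^sup>+h. ennreal (prob {\<omega>\<in>space M. (Z k \<omega> = z \<and> Z n \<omega> = w) \<and> history n \<omega> = h}) * ennreal (pmf (K w) w') \<partial>count_space UNIV)"
    by (subst prob_partition[where H = "history n"], measurable, intro nn_integral_cong)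
       (simp only: eq, simp add: ennreal_mult)
  also have "\<dots> = ennreal (prob {\<omega>\<in>space M. Z k \<omega> = z \<and> Z n \<omega> = w}) * ennreal (pmf (K w) w')"
  proof -
    have part: "ennreal (prob {\<omega>\<in>space M. Z k \<omega> = z \<and> Z n \<omega> = w}) =
      (\<integral>\<^sup>+h. ennreal (prob {\<omega>\<in>space M. (Z k \<omega> = z \<and> Z n \<omega> = w) \<and> history n \<omega> = h}) \<partial>count_space UNIV)"
      by (rule prob_partition) measurable
    show ?thesis unfolding part by (rule nn_integral_multc) simp
  qed
  finally show ?thesis
    by (simp add: ennreal_mult[symmetric])
qed

lemma AE_Z_in:
  assumes D0: "z0 \<in> D 0" and DS: "\<And>n w. w \<in> D n \<Longrightarrow> set_pmf (K w) \<subseteq> D (Suc n)"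
  shows "AE \<omega> in M. \<forall>n. Z n \<omega> \<in> D n"
  unfolding AE_all_countable
proof
  fix n
  show "AE \<omega> in M. Z n \<omega> \<in> D n"
  proof (rule AE_by_history[where n = n])
    fix z :: "nat \<Rightarrow> 's"
    show "prob {\<omega>\<in>space M. (\<forall>k\<le>n. Z k \<omega> = z k) \<and> Z n \<omega> \<notin> D n} = 0"
    proof (cases "path_prob n z = 0")
      case True
      have "prob {\<omega>\<in>space M. (\<forall>k\<le>n. Z k \<omega> = z k) \<and> Z n \<omega> \<notin> D n} \<le> prob {\<omega>\<in>space M. \<forall>k\<le>n. Z k \<omega> = z k}"
        by (intro finite_measure_mono) auto
      then show ?thesis using True by (simp add: prob_path measure_le_0_iff)
    next
      case False
      have "z k \<in> D k" if "k \<le> n" for k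
        using that
      proof (induction k)
        case 0
        then show ?case using False D0 by (auto simp: path_prob_def split: if_splits)
      next
        case (Suc k)
        then have "pmf (K (z k)) (z (Suc k)) \<noteq> 0"
          using False by (auto simp: path_prob_def split: if_splits)
        then show ?case using DS[of "z k" k] Suc by (auto simp: set_pmf_iff)
      qed
      then have "{\<omega>\<in>space M. (\<forall>k\<le>n. Z k \<omega> = z k) \<and> Z n \<omega> \<notin> D n} = {}" by auto
      then show ?thesis by (simp only: measure_empty)
    qed
  qed measurable
qed

lemma expectation_finite_support:
  assumes "finite D" "AE \<omega> in M. Z n \<omega> \<in> D" and [measurable]: "Measurable.pred M P"
  shows "integrable M (\<lambda>\<omega>. f (Z n \<omega>) * of_bool (P \<omega>) :: real)"
    and "expectation (\<lambda>\<omega>. f (Z n \<omega>) * of_bool (P \<omega>)) = (\<Sum>w\<in>D. f w * prob {\<omega>\<in>space M. P \<omega> \<and> Z n \<omega> = w})"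
proof -
  have eq: "AE \<omega> in M. f (Z n \<omega>) * of_bool (P \<omega>) = (\<Sum>w\<in>D. f w * indicator {\<omega>\<in>space M. P \<omega> \<and> Z n \<omega> = w} \<omega>)"
    using assms(2) AE_space
  proof eventually_elim
    fix \<omega> assume *: "Z n \<omega> \<in> D" "\<omega> \<in> space M"
    have "(\<Sum>w\<in>D. f w * indicator {\<omega>\<in>space M. P \<omega> \<and> Z n \<omega> = w} \<omega>) =
        (\<Sum>w\<in>D. if w = Z n \<omega> then f w * of_bool (P \<omega>) else 0)"
      using * by (intro sum.cong) (auto simp: indicator_def)
    then show "f (Z n \<omega>) * of_bool (P \<omega>) = (\<Sum>w\<in>D. f w * indicator {\<omega>\<in>space M. P \<omega> \<and> Z n \<omega> = w} \<omega>)"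
      using * assms(1) by simp
  qed
  have m: "(\<lambda>\<omega>. f (Z n \<omega>) * of_bool (P \<omega>)) \<in> borel_measurable M" by measurable
  have i: "integrable M (\<lambda>\<omega>. \<Sum>w\<in>D. f w * indicator {\<omega>\<in>space M. P \<omega> \<and> Z n \<omega> = w} \<omega>)"
    by (intro Bochner_Integration.integrable_sum integrable_mult_right integrable_real_indicator) (auto simp: emeasure_eq_measure)
  then show "integrable M (\<lambda>\<omega>. f (Z n \<omega>) * of_bool (P \<omega>))"
    using eq m by (subst integrable_cong_AE) auto
  have "expectation (\<lambda>\<omega>. f (Z n \<omega>) * of_bool (P \<omega>)) = expectation (\<lambda>\<omega>. \<Sum>w\<in>D. f w * indicator {\<omega>\<in>space M. P \<omega> \<and> Z n \<omega> = w} \<omega>)"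
    using eq m i by (intro integral_cong_AE) auto
  also have "\<dots> = (\<Sum>w\<in>D. f w * prob {\<omega>\<in>space M. P \<omega> \<and> Z n \<omega> = w})"
    by (subst Bochner_Integration.integral_sum) (auto intro!: integrable_mult_right integrable_real_indicator simp: emeasure_eq_measure)
  finally show "expectation (\<lambda>\<omega>. f (Z n \<omega>) * of_bool (P \<omega>)) = (\<Sum>w\<in>D. f w * prob {\<omega>\<in>space M. P \<omega> \<and> Z n \<omega> = w})" .
qed

lemma expectation_one_step:
  fixes f :: "'s \<Rightarrow> real"
  assumes fin: "\<And>n. finite (D n)" and D0: "z0 \<in> D 0"
    and DS: "\<And>n w. w \<in> D n \<Longrightarrow> set_pmf (K w) \<subseteq> D (Suc n)" and "k \<le> n"
  shows "expectation (\<lambda>\<omega>. f (Z (Suc n) \<omega>) * of_bool (Z k \<omega> = z)) =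
    expectation (\<lambda>\<omega>. measure_pmf.expectation (K (Z n \<omega>)) f * of_bool (Z k \<omega> = z))"
proof -
  have Din: "AE \<omega> in M. Z n \<omega> \<in> D n" for n
    using AE_Z_in[OF D0 DS] by auto
  have split: "prob {\<omega>\<in>space M. Z k \<omega> = z \<and> Z (Suc n) \<omega> = w'} =
     (\<Sum>w\<in>D n. prob {\<omega>\<in>space M. Z k \<omega> = z \<and> Z n \<omega> = w} * pmf (K w) w')" for w'
  proof -
    have "prob {\<omega>\<in>space M. Z k \<omega> = z \<and> Z (Suc n) \<omega> = w'} = expectation (\<lambda>\<omega>. (1::real) * of_bool (Z k \<omega> = z \<and> Z (Suc n) \<omega> = w'))"
    proof -
      have "expectation (\<lambda>\<omega>. (1::real) * of_bool (Z k \<omega> = z \<and> Z (Suc n) \<omega> = w')) =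
          expectation (indicator {\<omega>\<in>space M. Z k \<omega> = z \<and> Z (Suc n) \<omega> = w'})"
        by (intro Bochner_Integration.integral_cong refl) (auto simp: indicator_def)
      then show ?thesis by simp
    qed
    also have "\<dots> = (\<Sum>w\<in>D n. 1 * prob {\<omega>\<in>space M. (Z k \<omega> = z \<and> Z (Suc n) \<omega> = w') \<and> Z n \<omega> = w})"
      by (rule expectation_finite_support(2)[OF fin Din]) measurable
    also have "\<dots> = (\<Sum>w\<in>D n. prob {\<omega>\<in>space M. Z k \<omega> = z \<and> Z n \<omega> = w} * pmf (K w) w')"
      by (intro sum.cong refl) (simp add: markov_property[OF \<open>k \<le> n\<close>, symmetric] conj_ac)
    finally show ?thesis .
  qed
  have "expectation (\<lambda>\<omega>. f (Z (Suc n) \<omega>) * of_bool (Z k \<omega> = z)) =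
    (\<Sum>w'\<in>D (Suc n). f w' * (\<Sum>w\<in>D n. prob {\<omega>\<in>space M. Z k \<omega> = z \<and> Z n \<omega> = w} * pmf (K w) w'))"
    by (subst expectation_finite_support(2)[OF fin Din]) (auto simp: split)
  also have "\<dots> = (\<Sum>w\<in>D n. (\<Sum>w'\<in>D (Suc n). f w' * pmf (K w) w') * prob {\<omega>\<in>space M. Z k \<omega> = z \<and> Z n \<omega> = w})"
    by (subst sum_distrib_left, subst sum.swap) (simp add: sum_distrib_right mult_ac)
  also have "\<dots> = (\<Sum>w\<in>D n. measure_pmf.expectation (K w) f * prob {\<omega>\<in>space M. Z k \<omega> = z \<and> Z n \<omega> = w})"
  proof (intro sum.cong refl)
    fix w assume "w \<in> D n"
    have "measure_pmf.expectation (K w) f = (\<Sum>w'\<in>D (Suc n). f w' * pmf (K w) w')"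
      using DS[OF \<open>w \<in> D n\<close>] by (intro integral_measure_pmf_real fin) auto
    then show "(\<Sum>w'\<in>D (Suc n). f w' * pmf (K w) w') * prob {\<omega>\<in>space M. Z k \<omega> = z \<and> Z n \<omega> = w} =
      measure_pmf.expectation (K w) f * prob {\<omega>\<in>space M. Z k \<omega> = z \<and> Z n \<omega> = w}" by simp
  qed
  also have "\<dots> = expectation (\<lambda>\<omega>. measure_pmf.expectation (K (Z n \<omega>)) f * of_bool (Z k \<omega> = z))"
    by (subst expectation_finite_support(2)[OF fin Din]) auto
  finally show ?thesis .
qed

text \<open>
  Holding times can be integrated out one after the other, since each is independent of the chain
  and of the other holding times.
\<close>
lemma laplace_factor:
  assumes Y: "\<And>I. Y \<in> borel_measurable (rest_algebra I)" "integrable M Y" and r: "0 \<le> r"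
  shows "integrable M (\<lambda>\<omega>. exp (- r * (\<Sum>i\<in>{k..<n}. T i \<omega>)) * Y \<omega>) \<and>
    expectation (\<lambda>\<omega>. exp (- r * (\<Sum>i\<in>{k..<n}. T i \<omega>)) * Y \<omega>) = (\<Prod>i\<in>{k..<n}. lam i / (lam i + r)) * expectation Y"
proof (induction n)
  case (Suc n)
  show ?case
  proof (cases "k \<le> n")
    case True
    let ?X = "\<lambda>\<omega>. exp (- r * T n \<omega>)" and ?Y = "\<lambda>\<omega>. exp (- r * (\<Sum>i\<in>{k..<n}. T i \<omega>)) * Y \<omega>"
    have iX: "integrable M ?X" and eX: "expectation ?X = lam n / (lam n + r)"
    proof -
      have "integrable (distr M borel (T n)) (\<lambda>t. exp (- r * t))"
        "(LINT t|distr M borel (T n). exp (- r * t)) = lam n / (lam n - (- r))"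
        unfolding distr_T using exp_law_moment[of "lam n" "- r"] lam_pos[of n] r by auto
      then show "integrable M ?X" "expectation ?X = lam n / (lam n + r)"
        by (simp_all add: integrable_distr_eq integral_distr)
    qed
    have ind: "indep_var borel ?X borel ?Y"
    proof (rule indep_holding_rest[where I = "{n}"])
      have [measurable]: "T n \<in> borel_measurable (holding_algebra {n})"
        by (rule measurable_T_holding) simp
      show "?X \<in> borel_measurable (holding_algebra {n})" by measurable
      have [measurable]: "T i \<in> borel_measurable (rest_algebra {n})" if "i \<in> {k..<n}" for i
        using that by (intro measurable_T_rest) simp
      note Y(1)[of "{n}", measurable]
      show "?Y \<in> borel_measurable (rest_algebra {n})" by measurable
    qed
    have eq: "exp (- r * (\<Sum>i\<in>{k..<Suc n}. T i \<omega>)) * Y \<omega> = ?X \<omega> * ?Y \<omega>" for \<omega>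
      using True by (simp add: exp_add[symmetric] algebra_simps)
    show ?thesis
      unfolding eq using indep_var_integrable[OF ind iX] indep_var_lebesgue_integral[OF ind iX] Suc.IH True
      by (simp add: eX[simplified])
  qed (use Suc in simp)
qed (use Y in simp)

end

context level_chain
begin

text \<open>
  The rescaled observable \<open>u\<close> after \<open>n\<close> jumps, where time is counted from the \<open>k\<close>-th jump on.
\<close>
definition discounted :: "real \<Rightarrow> ('s \<Rightarrow> real) \<Rightarrow> nat \<Rightarrow> nat \<Rightarrow> 'w \<Rightarrow> real" where
  "discounted m u k n \<omega> = exp (- m * (\<Sum>i\<in>{k..<n}. T i \<omega>)) * u (Z n \<omega>)"

definition tail_limit :: "real \<Rightarrow> ('s \<Rightarrow> real) \<Rightarrow> nat \<Rightarrow> 'w \<Rightarrow> real" where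
  "tail_limit m u k \<omega> = lim (\<lambda>n. discounted m u k n \<omega>)"

lemma measurable_fun_Z_rest: "(\<lambda>\<omega>. f (Z n \<omega>)) \<in> borel_measurable (rest_algebra I)"
  by (rule measurable_compose[OF measurable_Z_rest]) simp

lemma measurable_discounted_rest:
  "discounted m u k n \<in> borel_measurable (rest_algebra {..<k})"
proof -
  have [measurable]: "T i \<in> borel_measurable (rest_algebra {..<k})" if "i \<in> {k..<n}" for i
    using that by (intro measurable_T_rest) simp
  note measurable_fun_Z_rest[measurable]
  show ?thesis unfolding discounted_def by measurable
qed

lemma measurable_tail_limit_rest:
  "tail_limit m u k \<in> borel_measurable (rest_algebra {..<k})"
  unfolding tail_limit_def using measurable_discounted_rest by (rule borel_measurable_lim_metric)

lemma measurable_discounted[measurable]: "discounted m u k n \<in> borel_measurable M"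
  using measurable_discounted_rest subalgebra_algebras(2) by (rule measurable_from_subalg[rotated])

lemma measurable_tail_limit[measurable]: "tail_limit m u k \<in> borel_measurable M"
  using measurable_tail_limit_rest subalgebra_algebras(2) by (rule measurable_from_subalg[rotated])

lemma discounted_split:
  assumes "k \<le> n"
  shows "discounted m u 0 n \<omega> = exp (- m * (\<Sum>i<k. T i \<omega>)) * discounted m u k n \<omega>"
proof -
  have "(\<Sum>i\<in>{0..<n}. T i \<omega>) = (\<Sum>i<k. T i \<omega>) + (\<Sum>i\<in>{k..<n}. T i \<omega>)"
    using sum.atLeastLessThan_concat[of 0 k n "\<lambda>i. T i \<omega>"] assms by (simp add: atLeast0LessThan)
  then show ?thesis
    by (simp only: discounted_def distrib_left exp_add mult.assoc)
qed

text \<open>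
  Changing the origin of time multiplies the discounted process, and hence its limit, by a
  positive factor that depends on the first \<open>k\<close> holding times only.
\<close>
lemma AE_tail_limit:
  assumes "AE \<omega> in M. (\<lambda>n. discounted m u 0 n \<omega>) \<longlonglongrightarrow> W \<omega>"
  shows "AE \<omega> in M. (\<lambda>n. discounted m u k n \<omega>) \<longlonglongrightarrow> tail_limit m u k \<omega> \<and>
    W \<omega> = exp (- m * (\<Sum>i<k. T i \<omega>)) * tail_limit m u k \<omega>"
  using assms
proof eventually_elim
  fix \<omega> assume *: "(\<lambda>n. discounted m u 0 n \<omega>) \<longlonglongrightarrow> W \<omega>"
  let ?e = "exp (- m * (\<Sum>i<k. T i \<omega>))"
  have "(\<lambda>n. discounted m u 0 n \<omega> / ?e) \<longlonglongrightarrow> W \<omega> / ?e"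
    by (intro tendsto_divide * tendsto_const) simp
  moreover have "\<forall>\<^sub>F n in sequentially. discounted m u 0 n \<omega> / ?e = discounted m u k n \<omega>"
    using eventually_ge_at_top[of k] by eventually_elim (simp add: discounted_split)
  ultimately have l: "(\<lambda>n. discounted m u k n \<omega>) \<longlonglongrightarrow> W \<omega> / ?e"
    by (rule Lim_transform_eventually)
  then have "tail_limit m u k \<omega> = W \<omega> / ?e"
    unfolding tail_limit_def by (rule limI)
  with l show "(\<lambda>n. discounted m u k n \<omega>) \<longlonglongrightarrow> tail_limit m u k \<omega> \<and> W \<omega> = ?e * tail_limit m u k \<omega>"
    by simp
qed

text \<open>
  The first two holding times are independent of the limit counted from the second jump on, so the limit
  is a product of two independent variables, and the law of one of them is explicit.
\<close>
lemma distr_limit_scale_mixture: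
  assumes lim: "AE \<omega> in M. (\<lambda>n. discounted m u 0 n \<omega>) \<longlonglongrightarrow> W \<omega>" and [measurable]: "W \<in> borel_measurable M"
  shows "distr M borel W =
    distr (scale_law m (lam 0) (lam 1) \<Otimes>\<^sub>M distr M borel (tail_limit m u 2)) borel (\<lambda>(r, w). r * w)"
proof -
  let ?R = "\<lambda>\<omega>. exp (- m * (T 0 \<omega> + T 1 \<omega>))" and ?Q = "tail_limit m u 2"
  have "indep_var borel (T 0) borel (T 1)"
    by (rule indep_holding_rest[where I = "{0}"])
       (auto intro: measurable_T_holding measurable_T_rest)
  then have "distr M borel (T 0) \<Otimes>\<^sub>M distr M borel (T 1) = distr M (borel \<Otimes>\<^sub>M borel) (\<lambda>\<omega>. (T 0 \<omega>, T 1 \<omega>))"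
    unfolding indep_var_distribution_eq by simp
  then have "scale_law m (lam 0) (lam 1) = distr (distr M (borel \<Otimes>\<^sub>M borel) (\<lambda>\<omega>. (T 0 \<omega>, T 1 \<omega>))) borel (\<lambda>(s, t). exp (- m * (s + t)))"
    unfolding scale_law_def by (simp add: distr_T)
  also have "\<dots> = distr M borel ?R"
    by (subst distr_distr) (auto simp: comp_def)
  finally have R: "scale_law m (lam 0) (lam 1) = distr M borel ?R" .
  have "indep_var borel ?R borel ?Q"
  proof (rule indep_holding_rest[where I = "{..<2}"])
    have [measurable]: "T 0 \<in> borel_measurable (holding_algebra {..<2})" "T 1 \<in> borel_measurable (holding_algebra {..<2})"
      by (auto intro: measurable_T_holding)
    show "?R \<in> borel_measurable (holding_algebra {..<2})" by measurable
  qed (rule measurable_tail_limit_rest)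
  then have RQ: "distr M borel ?R \<Otimes>\<^sub>M distr M borel ?Q = distr M (borel \<Otimes>\<^sub>M borel) (\<lambda>\<omega>. (?R \<omega>, ?Q \<omega>))"
    unfolding indep_var_distribution_eq by simp
  have "distr M borel W = distr M borel (\<lambda>\<omega>. ?R \<omega> * ?Q \<omega>)"
  proof (rule distr_cong_AE)
    show "AE \<omega> in M. W \<omega> = ?R \<omega> * ?Q \<omega>"
      using AE_tail_limit[OF lim, of 2] by eventually_elim (simp add: numeral_2_eq_2)
  qed measurable
  also have "\<dots> = distr (distr M (borel \<Otimes>\<^sub>M borel) (\<lambda>\<omega>. (?R \<omega>, ?Q \<omega>))) borel (\<lambda>(r, w). r * w)"
    by (subst distr_distr) (auto simp: comp_def)
  finally show ?thesis unfolding R RQ .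
qed

text \<open>
  By Fubini's theorem \<open>r * V\<close> is integrable for almost every value \<open>r > 0\<close> of the first factor, and one
  such value is enough.
\<close>
lemma integrable_tail_limit:
  assumes lim: "AE \<omega> in M. (\<lambda>n. discounted m u 0 n \<omega>) \<longlonglongrightarrow> W \<omega>"
    and W[measurable]: "W \<in> borel_measurable M" and iW: "integrable M W" and m: "0 < m" "m < lam 1"
  shows "integrable (distr M borel (tail_limit m u 2)) (\<lambda>w. w)"
proof -
  let ?S = "scale_law m (lam 0) (lam 1)" and ?Q = "distr M borel (tail_limit m u 2)"
  interpret S: real_distribution ?S by (rule real_distribution_scale_law[OF m(1) lam_pos m(2)])
  interpret Q: prob_space ?Q by (rule prob_space_distr) measurable
  interpret P: pair_prob_space ?S ?Q ..
  have "integrable (distr M borel W) (\<lambda>x. x)"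
    using iW by (subst integrable_distr_eq) auto
  then have "integrable (?S \<Otimes>\<^sub>M ?Q) (\<lambda>(r, w). r * w)"
    unfolding distr_limit_scale_mixture[OF lim W] by (subst (asm) integrable_distr_eq) (auto simp: case_prod_beta')
  then have "AE r in ?S. integrable ?Q (\<lambda>w. r * w)"
    by (rule P.AE_integrable_fst)
  moreover have "AE r in ?S. 0 < r \<and> r \<le> 1"
    by (rule AE_scale_law[OF m(1) lam_pos m(2)])
  ultimately have "AE r in ?S. r \<noteq> 0 \<and> integrable ?Q (\<lambda>w. r * w)"
    by eventually_elim auto
  then have "\<exists>r. r \<noteq> 0 \<and> integrable ?Q (\<lambda>w. r * w)"
    by (rule eventually_happens'[OF S.ae_filter_bot])
  then obtain r where r: "r \<noteq> 0" "integrable ?Q (\<lambda>w. r * w)" by blast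
  have "integrable ?Q (\<lambda>w. (1 / r) * (r * w))"
    by (rule integrable_mult_right) (rule r(2))
  then show ?thesis using r(1) by simp
qed

end

section \<open>Moments of the urn composition\<close>

definition urn_kernel :: "nat \<Rightarrow> nat \<Rightarrow> nat \<Rightarrow> nat \<Rightarrow> nat \<times> nat \<Rightarrow> (nat \<times> nat) pmf" where
  "urn_kernel a b c d z = (case z of (x, y) \<Rightarrow>
     map_pmf (\<lambda>red. if red then (x + a, y + b) else (x + c, y + d)) (bernoulli_pmf (real x / (real x + real y))))"

lemma expectation_urn_kernel:
  assumes "0 < x + y"
  shows "measure_pmf.expectation (urn_kernel a b c d (x, y)) f =
    real x / (real x + real y) * f (x + a, y + b) + real y / (real x + real y) * (f (x + c, y + d) :: real)"
proof -
  have p: "0 \<le> real x / (real x + real y)" "real x / (real x + real y) \<le> 1"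
    using assms by (auto simp: divide_simps)
  have "real x + real y \<noteq> 0" using assms by linarith
  then have q: "1 - real x / (real x + real y) = real y / (real x + real y)"
    by (simp add: field_simps)
  show ?thesis
    unfolding urn_kernel_def using p q by (simp add: mult.commute)
qed

text \<open>
  A draw adds \<open>s\<close> or \<open>t\<close> to \<open>u\<close> with probabilities \<open>p\<close> and \<open>q\<close>; the drift is proportional to \<open>u\<close>. The
  cubic terms of the fourth power are absorbed into the quadratic and the constant ones.
\<close>
lemma two_point_moments:
  fixes p q u s t e m :: real
  assumes p: "0 \<le> p" "0 \<le> q" "p + q = 1" and drift: "p * s + q * t = e * u"
    and st: "\<bar>s\<bar> \<le> m" "\<bar>t\<bar> \<le> m"
  shows "p * (u + s)\<^sup>2 + q * (u + t)\<^sup>2 \<ge> (1 + 2 * e) * u\<^sup>2 + p * s\<^sup>2"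
    and "p * (u + s) ^ 4 + q * (u + t) ^ 4 \<le> (1 + 4 * e) * u ^ 4 + 8 * m\<^sup>2 * u\<^sup>2 + 3 * m ^ 4"
proof -
  have q: "q = 1 - p" using p by simp
  have m: "0 \<le> m" using st by linarith
  have "p * (u + s)\<^sup>2 + q * (u + t)\<^sup>2 = (p + q) * u\<^sup>2 + 2 * u * (p * s + q * t) + p * s\<^sup>2 + q * t\<^sup>2"
    by (simp add: power2_eq_square algebra_simps)
  also have "\<dots> = (1 + 2 * e) * u\<^sup>2 + p * s\<^sup>2 + q * t\<^sup>2"
    by (simp add: p drift power2_eq_square algebra_simps)
  finally show "p * (u + s)\<^sup>2 + q * (u + t)\<^sup>2 \<ge> (1 + 2 * e) * u\<^sup>2 + p * s\<^sup>2"
    using p by simp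
  have avg: "p * X + q * Y \<le> B" if "X \<le> B" "Y \<le> B" for X Y B :: real
    using convex_bound_le[OF that p] by simp
  have s2: "x\<^sup>2 \<le> m\<^sup>2" if "\<bar>x\<bar> \<le> m" for x using that by (simp add: abs_le_square_iff[symmetric] m)
  have s4: "x ^ 4 \<le> m ^ 4" if "\<bar>x\<bar> \<le> m" for x
    using power_mono[OF that, of 4] by simp
  have s3: "u * x ^ 3 \<le> (m\<^sup>2 * u\<^sup>2 + m ^ 4) / 2" if "\<bar>x\<bar> \<le> m" for x
  proof -
    have "u * x ^ 3 = (x * u) * x\<^sup>2" by (simp add: power2_eq_square power3_eq_cube)
    also have "\<dots> \<le> ((x * u)\<^sup>2 + (x\<^sup>2)\<^sup>2) / 2"
      using sum_squares_bound[of "x * u" "x\<^sup>2"] by simp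
    also have "(x * u)\<^sup>2 \<le> m\<^sup>2 * u\<^sup>2"
      using s2[OF that] by (simp add: power_mult_distrib mult_right_mono)
    also have "(x\<^sup>2)\<^sup>2 \<le> m ^ 4"
      using s4[OF that] by simp
    finally show ?thesis by simp
  qed
  have "p * (u + s) ^ 4 + q * (u + t) ^ 4 =
      (p + q) * u ^ 4 + 4 * u ^ 3 * (p * s + q * t) + 6 * u\<^sup>2 * (p * s\<^sup>2 + q * t\<^sup>2)
      + 4 * (p * (u * s ^ 3) + q * (u * t ^ 3)) + (p * s ^ 4 + q * t ^ 4)"
    by (simp add: eval_nat_numeral algebra_simps)
  also have "\<dots> \<le> u ^ 4 + 4 * e * u ^ 4 + 6 * u\<^sup>2 * m\<^sup>2 + 4 * ((m\<^sup>2 * u\<^sup>2 + m ^ 4) / 2) + m ^ 4"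
  proof (intro add_mono mult_left_mono avg)
    show "4 * u ^ 3 * (p * s + q * t) \<le> 4 * e * u ^ 4"
      unfolding drift by (simp add: eval_nat_numeral algebra_simps)
  qed (use p st s2 s3 s4 in auto)
  also have "\<dots> = (1 + 4 * e) * u ^ 4 + 8 * m\<^sup>2 * u\<^sup>2 + 3 * m ^ 4"
    by (simp add: algebra_simps)
  finally show "p * (u + s) ^ 4 + q * (u + t) ^ 4 \<le> (1 + 4 * e) * u ^ 4 + 8 * m\<^sup>2 * u\<^sup>2 + 3 * m ^ 4" .
qed

text \<open>
  The embedded chain of the balanced urn, started from one red ball: in each state the total rate is
  the number of balls.
\<close>
locale urn_chain = level_chain M "urn_kernel a b c d" "(1, 0)" "\<lambda>n. 1 + real n * real S" Z T
  for M :: "'w measure" and a b c d S :: nat and Z :: "nat \<Rightarrow> 'w \<Rightarrow> nat \<times> nat" and T :: "nat \<Rightarrow> 'w \<Rightarrow> real" +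
  fixes m :: nat
  assumes m: "0 < m" "m < S" and bc: "1 \<le> b" "1 \<le> c"
    and abcd: "a = c + m" "d = b + m" "S = a + b"
begin

text \<open>
  Possible states after \<open>n\<close> jumps. The lower bounds on both colours are what keeps the two
  probabilities of a draw away from \<open>0\<close>.
\<close>
definition level :: "nat \<Rightarrow> (nat \<times> nat) set" where
  "level n = {(x, y). x + y = 1 + n * S \<and> n * c \<le> x \<and> n * b \<le> y}"

lemma finite_level: "finite (level n)"
  by (rule finite_subset[of _ "{..1 + n * S} \<times> {..1 + n * S}"]) (auto simp: level_def)

lemma level_0: "(1, 0) \<in> level 0"
  by (simp add: level_def)

lemma level_Suc: "w \<in> level n \<Longrightarrow> set_pmf (urn_kernel a b c d w) \<subseteq> level (Suc n)"
proof -
  assume "w \<in> level n"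
  then obtain x y where xy: "w = (x, y)" "x + y = 1 + n * S" "n * c \<le> x" "n * b \<le> y"
    by (auto simp: level_def)
  have "S = c + d" using abcd by simp
  then have "x + a + (y + b) = 1 + Suc n * S" "x + c + (y + d) = 1 + Suc n * S"
    using xy(2) abcd(3) unfolding mult_Suc by linarith+
  moreover have "Suc n * c \<le> x + a" "Suc n * c \<le> x + c" "Suc n * b \<le> y + b" "Suc n * b \<le> y + d"
    using xy(3,4) abcd(1,2) unfolding mult_Suc by linarith+
  ultimately have "(x + a, y + b) \<in> level (Suc n)" "(x + c, y + d) \<in> level (Suc n)"
    unfolding level_def by blast+
  then show ?thesis by (auto simp: xy(1) urn_kernel_def)
qed

lemma AE_level: "AE \<omega> in M. Z n \<omega> \<in> level n"
  using AE_Z_in[of level, OF level_0 level_Suc] by auto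

lemma integrable_fun_Z: "integrable M (\<lambda>\<omega>. f (Z n \<omega>) * of_bool (Z k \<omega> = z) :: real)"
  by (rule expectation_finite_support(1)[OF finite_level AE_level]) measurable

abbreviation u :: "nat \<times> nat \<Rightarrow> real" where
  "u \<equiv> u2 S b c"

abbreviation state_prob :: "nat \<Rightarrow> nat \<times> nat \<Rightarrow> real" where
  "state_prob k z \<equiv> prob {\<omega>\<in>space M. Z k \<omega> = z}"

text \<open>
  A lower bound for what the draw of a red ball adds to the conditional second moment of \<open>u\<close>, however
  small \<open>u\<close> is at present.
\<close>
definition noise :: real where
  "noise = (real m * real b / real S)\<^sup>2 / (1 + real S)"

lemma noise_pos: "0 < noise"
  using m bc by (simp add: noise_def)

lemma urn_step_moments:
  assumes w: "w \<in> level n"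
  shows "1 \<le> n \<Longrightarrow> measure_pmf.expectation (urn_kernel a b c d w) (\<lambda>z. (u z)\<^sup>2) \<ge>
      (1 + 2 * m / (1 + real n * real S)) * (u w)\<^sup>2 + noise" (is "_ \<Longrightarrow> ?E2")
    and "measure_pmf.expectation (urn_kernel a b c d w) (\<lambda>z. (u z) ^ 4) \<le>
      (1 + 4 * m / (1 + real n * real S)) * (u w) ^ 4 + 8 * (real m)\<^sup>2 * (u w)\<^sup>2 + 3 * (real m) ^ 4"
proof -
  obtain x y where xy: "w = (x, y)" "x + y = 1 + n * S" "n * c \<le> x" "n * b \<le> y"
    using w by (auto simp: level_def)
  define N where "N = 1 + real n * real S"
  have Nxy: "real x + real y = N"
    unfolding N_def using xy(2) by (metis of_nat_1 of_nat_add of_nat_mult)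
  have N: "0 < N" by (simp add: N_def add_pos_nonneg)
  have S: "0 < real S" using m by simp
  \<comment> \<open>The increments of \<open>u\<close> when a red and when a black ball is drawn.\<close>
  define s where "s = real m * real b / real S"
  define t where "t = - (real m * real c / real S)"
  have us: "u (x + a, y + b) = u w + s"
    using S by (simp add: u2_def xy(1) s_def abcd(1,2) field_simps)
  have ut: "u (x + c, y + d) = u w + t"
    using S by (simp add: u2_def xy(1) t_def abcd(1,2) field_simps)
  have p: "0 \<le> x / N" "0 \<le> y / N" "x / N + y / N = 1"
    using N Nxy by (auto simp: add_divide_distrib[symmetric])
  have drift: "x / N * s + y / N * t = m / N * u w"
    using N S by (simp add: u2_def xy(1) s_def t_def field_simps)
  have "real b \<le> real S" "real c \<le> real S" using abcd by auto
  then have st: "\<bar>s\<bar> \<le> m" "\<bar>t\<bar> \<le> m"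
    using S by (auto simp: s_def t_def field_simps intro!: mult_right_mono)
  have xy0: "0 < x + y" using xy(2) by simp
  have E: "measure_pmf.expectation (urn_kernel a b c d w) (\<lambda>z. (u z) ^ j) = x / N * (u w + s) ^ j + y / N * (u w + t) ^ j" for j
    unfolding xy(1) using us ut Nxy by (simp add: expectation_urn_kernel[OF xy0] xy(1))
  note moments = two_point_moments[OF p drift st]
  show ?E2 if "1 \<le> n"
  proof -
    have "1 + n * S \<le> n * (1 + S)" using that by simp
    also have "\<dots> \<le> x * (1 + S)" using xy(3) bc by (intro mult_right_mono) (auto intro: order_trans[of n "n * c"])
    finally have "N \<le> x * (1 + real S)"
      unfolding N_def by (metis of_nat_1 of_nat_add of_nat_mono of_nat_mult)
    then have "1 / (1 + real S) \<le> x / N" using N S by (simp add: field_simps)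
    then have "s\<^sup>2 * (1 / (1 + real S)) \<le> s\<^sup>2 * (x / N)" by (intro mult_left_mono) auto
    then have "noise \<le> x / N * s\<^sup>2" by (simp add: noise_def s_def mult.commute)
    then show ?thesis using moments(1) E[of 2] by (simp add: N_def)
  qed
  show "measure_pmf.expectation (urn_kernel a b c d w) (\<lambda>z. (u z) ^ 4) \<le>
      (1 + 4 * m / (1 + real n * real S)) * (u w) ^ 4 + 8 * (real m)\<^sup>2 * (u w)\<^sup>2 + 3 * (real m) ^ 4"
    using moments(2) E[of 4] by (simp add: N_def)
qed

text \<open>
  The \<open>j\<close>-th moment of \<open>u (Z n)\<close> on the event \<open>Z k = z\<close>, not divided by the probability of the event.
\<close>
definition moment :: "nat \<Rightarrow> nat \<times> nat \<Rightarrow> nat \<Rightarrow> nat \<Rightarrow> real" where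
  "moment k z j n = expectation (\<lambda>\<omega>. (u (Z n \<omega>)) ^ j * of_bool (Z k \<omega> = z))"

lemma moment_0: "moment k z 0 n = state_prob k z"
proof -
  have "moment k z 0 n = expectation (indicator {\<omega>\<in>space M. Z k \<omega> = z})"
    unfolding moment_def by (intro Bochner_Integration.integral_cong refl) (auto simp: indicator_def)
  then show ?thesis by simp
qed

lemma moment_refl: "moment k z j k = (u z) ^ j * state_prob k z"
proof -
  have "moment k z j k = expectation (\<lambda>\<omega>. (u z) ^ j * indicator {\<omega>\<in>space M. Z k \<omega> = z} \<omega>)"
    unfolding moment_def by (intro Bochner_Integration.integral_cong refl) (auto simp: indicator_def)
  then show ?thesis by simp
qed

lemma moment_2_nonneg: "0 \<le> moment k z 2 n"
  unfolding moment_def by (intro Bochner_Integration.integral_nonneg) auto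

lemma moment_2_Suc:
  assumes "k \<le> n" "1 \<le> n"
  shows "moment k z 2 (Suc n) \<ge> (1 + 2 * m / (1 + real n * real S)) * moment k z 2 n + noise * moment k z 0 n"
proof -
  let ?q = "1 + 2 * m / (1 + real n * real S)"
  have "?q * moment k z 2 n + noise * moment k z 0 n =
     expectation (\<lambda>\<omega>. ?q * ((u (Z n \<omega>))\<^sup>2 * of_bool (Z k \<omega> = z)) + noise * ((u (Z n \<omega>)) ^ 0 * of_bool (Z k \<omega> = z)))"
    unfolding moment_def
    by (subst Bochner_Integration.integral_add) (auto intro!: integrable_mult_right integrable_fun_Z[where f = "\<lambda>w. u w ^ _"] integrable_fun_Z[where f = "\<lambda>w. 1", simplified])
  also have "\<dots> \<le> expectation (\<lambda>\<omega>. measure_pmf.expectation (urn_kernel a b c d (Z n \<omega>)) (\<lambda>w. (u w)\<^sup>2) * of_bool (Z k \<omega> = z))"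
  proof (rule integral_mono_AE)
    show "AE \<omega> in M. ?q * ((u (Z n \<omega>))\<^sup>2 * of_bool (Z k \<omega> = z)) + noise * ((u (Z n \<omega>)) ^ 0 * of_bool (Z k \<omega> = z)) \<le>
       measure_pmf.expectation (urn_kernel a b c d (Z n \<omega>)) (\<lambda>w. (u w)\<^sup>2) * of_bool (Z k \<omega> = z)"
      using AE_level[of n]
    proof eventually_elim
      fix \<omega> assume "Z n \<omega> \<in> level n"
      from urn_step_moments(1)[OF this assms(2)]
      show "?q * ((u (Z n \<omega>))\<^sup>2 * of_bool (Z k \<omega> = z)) + noise * ((u (Z n \<omega>)) ^ 0 * of_bool (Z k \<omega> = z)) \<le>
       measure_pmf.expectation (urn_kernel a b c d (Z n \<omega>)) (\<lambda>w. (u w)\<^sup>2) * of_bool (Z k \<omega> = z)"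
        by (cases "Z k \<omega> = z") simp_all
    qed
  qed (auto intro!: Bochner_Integration.integrable_add integrable_mult_right integrable_fun_Z[where f = "\<lambda>w. u w ^ _"] integrable_fun_Z[where f = "\<lambda>w. 1", simplified]
        integrable_fun_Z[where f = "\<lambda>w. measure_pmf.expectation (urn_kernel a b c d w) (\<lambda>w. (u w)\<^sup>2)"])
  also have "\<dots> = moment k z 2 (Suc n)"
    unfolding moment_def by (rule expectation_one_step[OF finite_level level_0 level_Suc assms(1), symmetric])
  finally show ?thesis .
qed

lemma moment_4_Suc:
  assumes "k \<le> n"
  shows "moment k z 4 (Suc n) \<le> (1 + 4 * m / (1 + real n * real S)) * moment k z 4 n
     + 8 * (real m)\<^sup>2 * moment k z 2 n + 3 * (real m) ^ 4 * moment k z 0 n"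
proof -
  let ?q = "1 + 4 * m / (1 + real n * real S)"
  let ?f = "\<lambda>w. ?q * u w ^ 4 + 8 * (real m)\<^sup>2 * (u w)\<^sup>2 + 3 * (real m) ^ 4"
  have "moment k z 4 (Suc n) = expectation (\<lambda>\<omega>. measure_pmf.expectation (urn_kernel a b c d (Z n \<omega>)) (\<lambda>w. u w ^ 4) * of_bool (Z k \<omega> = z))"
    unfolding moment_def by (rule expectation_one_step[OF finite_level level_0 level_Suc assms(1)])
  also have "\<dots> \<le> expectation (\<lambda>\<omega>. ?f (Z n \<omega>) * of_bool (Z k \<omega> = z))"
  proof (rule integral_mono_AE)
    show "AE \<omega> in M. measure_pmf.expectation (urn_kernel a b c d (Z n \<omega>)) (\<lambda>w. u w ^ 4) * of_bool (Z k \<omega> = z) \<le>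
       ?f (Z n \<omega>) * of_bool (Z k \<omega> = z)"
      using AE_level[of n]
    proof eventually_elim
      fix \<omega> assume "Z n \<omega> \<in> level n"
      from urn_step_moments(2)[OF this]
      show "measure_pmf.expectation (urn_kernel a b c d (Z n \<omega>)) (\<lambda>w. u w ^ 4) * of_bool (Z k \<omega> = z) \<le>
       ?f (Z n \<omega>) * of_bool (Z k \<omega> = z)"
        by (cases "Z k \<omega> = z") simp_all
    qed
  qed (rule integrable_fun_Z)+
  also have "\<dots> = expectation (\<lambda>\<omega>. ?q * (u (Z n \<omega>) ^ 4 * of_bool (Z k \<omega> = z)) +
      8 * (real m)\<^sup>2 * ((u (Z n \<omega>))\<^sup>2 * of_bool (Z k \<omega> = z)) + 3 * (real m) ^ 4 * (u (Z n \<omega>) ^ 0 * of_bool (Z k \<omega> = z)))"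
    by (intro Bochner_Integration.integral_cong refl) (simp add: algebra_simps)
  also have "\<dots> = ?q * moment k z 4 n + 8 * (real m)\<^sup>2 * moment k z 2 n + 3 * (real m) ^ 4 * moment k z 0 n"
    unfolding moment_def
    by (subst Bochner_Integration.integral_add, (intro Bochner_Integration.integrable_add integrable_mult_right integrable_fun_Z[where f = "\<lambda>w. u w ^ _"])+,
        subst Bochner_Integration.integral_add, (intro integrable_mult_right integrable_fun_Z[where f = "\<lambda>w. u w ^ _"])+,
        simp only: integral_mult_right_zero)
  finally show ?thesis .
qed

end

text \<open>
  Induction step for \<open>B * P \<le> C * A\<^sup>2\<close>, where \<open>A\<close> and \<open>B\<close> are a second and a fourth moment on an event
  of probability \<open>P\<close>. When the new lower bound for the second moment is squared, the noise \<open>c\<close>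
  contributes \<open>2 * c * A * P + c\<^sup>2 * P\<^sup>2\<close>, and a large \<open>C\<close> lets this dominate what the fourth moment gains.
\<close>
lemma fourth_moment_step:
  fixes A B A' B' P q m c C :: real
  assumes nonneg: "0 \<le> P" "0 \<le> A" "0 \<le> q" "0 < c"
    and C: "C = 1 + 4 * m\<^sup>2 / c + 3 * m ^ 4 / c\<^sup>2"
    and A': "A' \<ge> (1 + 2 * q) * A + c * P"
    and B': "B' \<le> (1 + 4 * q) * B + 8 * m\<^sup>2 * A + 3 * m ^ 4 * P"
    and IH: "B * P \<le> C * A\<^sup>2"
  shows "B' * P \<le> C * A'\<^sup>2"
proof -
  have C0: "0 \<le> C" unfolding C using nonneg by simp
  have Cc: "4 * m\<^sup>2 \<le> C * c" "3 * m ^ 4 \<le> C * c\<^sup>2"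
  proof -
    have "C * c = c + 4 * m\<^sup>2 + 3 * m ^ 4 / c"
      unfolding C using nonneg by (simp add: field_simps power2_eq_square)
    then show "4 * m\<^sup>2 \<le> C * c" using nonneg by simp
    have "C * c\<^sup>2 = c\<^sup>2 + 4 * m\<^sup>2 * c + 3 * m ^ 4"
      unfolding C using nonneg by (simp add: field_simps power2_eq_square)
    then show "3 * m ^ 4 \<le> C * c\<^sup>2" using nonneg by simp
  qed
  have "B' * P \<le> ((1 + 4 * q) * B + 8 * m\<^sup>2 * A + 3 * m ^ 4 * P) * P"
    using B' nonneg by (intro mult_right_mono) auto
  also have "\<dots> = (1 + 4 * q) * (B * P) + 2 * ((4 * m\<^sup>2) * (A * P)) + (3 * m ^ 4) * P\<^sup>2"
    by (simp add: power2_eq_square algebra_simps)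
  also have "\<dots> \<le> (1 + 4 * q) * (C * A\<^sup>2) + 2 * ((C * c) * (A * P)) + (C * c\<^sup>2) * P\<^sup>2"
    using nonneg IH Cc by (intro add_mono mult_left_mono mult_right_mono) auto
  also have "\<dots> \<le> (1 + 4 * q) * (C * A\<^sup>2) + 2 * ((C * c) * (A * P)) + (C * c\<^sup>2) * P\<^sup>2
      + C * (4 * q\<^sup>2 * A\<^sup>2 + 4 * q * c * A * P)"
    using nonneg C0 by simp
  also have "\<dots> = C * ((1 + 2 * q) * A + c * P)\<^sup>2"
    by (simp add: power2_eq_square algebra_simps)
  also have "\<dots> \<le> C * A'\<^sup>2"
    using A' nonneg C0 by (intro mult_left_mono power_mono) auto
  finally show ?thesis .
qed

text \<open>
  The factors \<open>l / (l + 4 * m)\<close> and \<open>(l / (l + 2 * m))\<^sup>2\<close> differ by a relative error of order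
  \<open>1 / l\<^sup>2\<close>. The correction \<open>1 + A / l\<close>, whose relative change from \<open>l\<close> to \<open>l + S\<close> is of the same order,
  turns the comparison of their products into a telescoping one.
\<close>
lemma laplace_ratio_step:
  fixes l m S A :: real
  assumes "0 < l" "1 \<le> m" "1 \<le> S" "A = 4 * m\<^sup>2 * S" "m + 1 \<le> S"
  shows "l / (l + 4 * m) * (1 + A / (l + S)) \<le> (1 + A / l) * (l / (l + 2 * m))\<^sup>2"
proof -
  have "l \<le> S\<^sup>2 * l" using assms by (simp add: power2_eq_square mult_ge1_I)
  moreover have "S + A \<le> S\<^sup>2 * (4 * m)"
  proof -
    have "4 * m * (m + 1) \<le> 4 * m * S" using assms by (intro mult_left_mono) auto
    then have "4 * m\<^sup>2 + 4 * m \<le> 4 * m * S"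
      by (simp add: power2_eq_square algebra_simps)
    then have "S * (1 + 4 * m\<^sup>2) \<le> S * (4 * m * S)" using assms by (intro mult_left_mono) auto
    then show ?thesis using assms by (simp add: power2_eq_square algebra_simps)
  qed
  ultimately have "4 * m\<^sup>2 * (l + S + A) \<le> 4 * m\<^sup>2 * (S\<^sup>2 * (l + 4 * m))"
    by (intro mult_left_mono) (auto simp: algebra_simps)
  then have "4 * m\<^sup>2 * (l + S + A) \<le> A * S * (l + 4 * m)"
    using assms by (simp add: power2_eq_square algebra_simps)
  then have "(l + S + A) * (l + 2 * m)\<^sup>2 \<le> (l + A) * (l + 4 * m) * (l + S)"
    by (simp add: power2_eq_square algebra_simps)
  then have "(l + S + A) * (l + 2 * m)\<^sup>2 * l \<le> (l + A) * (l + 4 * m) * (l + S) * l"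
    using assms by (intro mult_right_mono) auto
  then show ?thesis
    using assms by (simp add: divide_simps power2_eq_square mult_ac)
qed

context urn_chain
begin

abbreviation balls :: "nat \<Rightarrow> real" where
  "balls n \<equiv> 1 + real n * real S"

lemma balls_pos: "0 < balls n"
  by (simp add: add_pos_nonneg)

text \<open>
  The random discount \<open>exp (- m * (T k + \<dots> + T (n - 1)))\<close> also has a fourth moment that is at most a
  constant times the square of its second moment.
\<close>
lemma laplace_ratio:
  assumes "k \<le> n"
  shows "(\<Prod>i\<in>{k..<n}. balls i / (balls i + 4 * m)) \<le> (1 + 4 * (real m)\<^sup>2 * S) * (\<Prod>i\<in>{k..<n}. balls i / (balls i + 2 * m))\<^sup>2"
proof -
  \<comment> \<open>As the rate tends to infinity, the step inequality requires \<open>A * S \<ge> 4 * m\<^sup>2\<close>; this larger value makes it hold at every rate.\<close>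
  define A where "A = 4 * (real m)\<^sup>2 * real S"
  have A: "0 \<le> A" by (simp add: A_def)
  have mS: "1 \<le> real m" "1 \<le> real S" "real m + 1 \<le> real S" using m by auto
  have "(\<Prod>i\<in>{k..<n}. balls i / (balls i + 4 * m)) * (1 + A / balls n) \<le> (1 + A / balls k) * (\<Prod>i\<in>{k..<n}. balls i / (balls i + 2 * m))\<^sup>2"
    using assms
  proof (induction n rule: dec_induct)
    case (step n)
    let ?p4 = "\<Prod>i\<in>{k..<n}. balls i / (balls i + 4 * m)" and ?p2 = "\<Prod>i\<in>{k..<n}. balls i / (balls i + 2 * m)"
    have p: "0 \<le> ?p4" by (intro prod_nonneg) (simp add: add_nonneg_nonneg)
    have NS: "balls (Suc n) = balls n + S" by (simp add: algebra_simps)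
    have "(\<Prod>i\<in>{k..<Suc n}. balls i / (balls i + 4 * m)) * (1 + A / balls (Suc n)) =
      ?p4 * (balls n / (balls n + 4 * m) * (1 + A / (balls n + S)))"
      using step by (simp only: NS prod.atLeastLessThan_Suc mult.assoc)
    also have "\<dots> \<le> ?p4 * ((1 + A / balls n) * (balls n / (balls n + 2 * m))\<^sup>2)"
      unfolding of_nat_mult of_nat_numeral
      by (rule mult_left_mono[OF laplace_ratio_step[OF balls_pos mS(1,2) A_def mS(3)] p[unfolded of_nat_mult of_nat_numeral]])
    also have "\<dots> = (?p4 * (1 + A / balls n)) * (balls n / (balls n + 2 * m))\<^sup>2" by simp
    also have "\<dots> \<le> ((1 + A / balls k) * ?p2\<^sup>2) * (balls n / (balls n + 2 * m))\<^sup>2"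
      using step.IH by (intro mult_right_mono) auto
    also have "\<dots> = (1 + A / balls k) * (\<Prod>i\<in>{k..<Suc n}. balls i / (balls i + 2 * m))\<^sup>2"
      using step by (simp only: prod.atLeastLessThan_Suc power_mult_distrib mult.assoc)
    finally show ?case .
  qed simp
  moreover have "(\<Prod>i\<in>{k..<n}. balls i / (balls i + 4 * m)) * 1 \<le> (\<Prod>i\<in>{k..<n}. balls i / (balls i + 4 * m)) * (1 + A / balls n)"
    using A balls_pos[of n] by (intro mult_left_mono prod_nonneg) (auto simp: add_nonneg_nonneg)
  moreover have "(1 + A / balls k) * (\<Prod>i\<in>{k..<n}. balls i / (balls i + 2 * m))\<^sup>2 \<le> (1 + A) * (\<Prod>i\<in>{k..<n}. balls i / (balls i + 2 * m))\<^sup>2"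
  proof (intro mult_right_mono add_left_mono)
    have "A / balls k \<le> A / 1" using A balls_pos[of k] by (intro divide_left_mono) auto
    then show "A / balls k \<le> A" by simp
  qed simp
  ultimately show ?thesis by (simp add: A_def)
qed

definition moment_const :: real where
  "moment_const = 1 + 4 * (real m)\<^sup>2 / noise + 3 * (real m) ^ 4 / noise\<^sup>2"

definition nonzero_const :: real where
  "nonzero_const = moment_const * (1 + 4 * (real m)\<^sup>2 * S)"

lemma moment_const_pos: "0 < moment_const"
  using noise_pos by (simp add: moment_const_def add_pos_nonneg)

lemma nonzero_const_pos: "0 < nonzero_const"
  using moment_const_pos by (simp add: nonzero_const_def add_pos_nonneg)

lemma moment_4_le:
  assumes "1 \<le> k" "k \<le> n"
  shows "moment k z 4 n * state_prob k z \<le> moment_const * (moment k z 2 n)\<^sup>2"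
  using assms(2)
proof (induction n rule: dec_induct)
  case base
  have "1 \<le> moment_const" using noise_pos by (simp add: moment_const_def)
  then have "1 * ((u z) ^ 4 * (state_prob k z)\<^sup>2) \<le> moment_const * ((u z) ^ 4 * (state_prob k z)\<^sup>2)"
    by (intro mult_right_mono) auto
  moreover have "(x\<^sup>2 * y)\<^sup>2 = x ^ 4 * y\<^sup>2" for x y :: real
    by (simp add: power_mult_distrib flip: power_mult)
  ultimately show ?case
    by (simp only: moment_refl mult_1 mult.assoc flip: power2_eq_square)
next
  case (step n)
  show ?case
  proof (rule fourth_moment_step[OF _ _ _ noise_pos moment_const_def])
    show "(1 + 2 * (m / balls n)) * moment k z 2 n + noise * state_prob k z \<le> moment k z 2 (Suc n)"
      using moment_2_Suc[of k n z] assms step by (simp add: moment_0)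
    show "moment k z 4 (Suc n) \<le> (1 + 4 * (m / balls n)) * moment k z 4 n + 8 * (real m)\<^sup>2 * moment k z 2 n
        + 3 * (real m) ^ 4 * state_prob k z"
      using moment_4_Suc[of k n z] step by (simp add: moment_0)
  qed (use step.IH moment_2_nonneg balls_pos[of n] in auto)
qed

definition disc_moment :: "nat \<Rightarrow> nat \<times> nat \<Rightarrow> nat \<Rightarrow> nat \<Rightarrow> real" where
  "disc_moment k z j n = expectation (\<lambda>\<omega>. (discounted m u k n \<omega>) ^ j * of_bool (Z k \<omega> = z))"

lemma disc_moment_facts:
  shows integrable_disc_moment: "integrable M (\<lambda>\<omega>. (discounted m u k n \<omega>) ^ j * of_bool (Z k \<omega> = z))"
    and disc_moment_eq: "disc_moment k z j n = (\<Prod>i\<in>{k..<n}. balls i / (balls i + j * m)) * moment k z j n"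
proof -
  let ?Y = "\<lambda>\<omega>. (u (Z n \<omega>)) ^ j * of_bool (Z k \<omega> = z)"
  have eq: "(discounted m u k n \<omega>) ^ j * of_bool (Z k \<omega> = z) = exp (- (j * m) * (\<Sum>i\<in>{k..<n}. T i \<omega>)) * ?Y \<omega>" for \<omega>
    by (simp add: discounted_def power_mult_distrib mult_ac flip: exp_of_nat_mult)
  have Y: "?Y \<in> borel_measurable (rest_algebra I)" for I
    using measurable_fun_Z_rest[of "\<lambda>w. (u w) ^ j" n I] measurable_fun_Z_rest[of "\<lambda>w. of_bool (w = z)" k I]
    by (intro borel_measurable_times)
  show "integrable M (\<lambda>\<omega>. (discounted m u k n \<omega>) ^ j * of_bool (Z k \<omega> = z))"
    "disc_moment k z j n = (\<Prod>i\<in>{k..<n}. balls i / (balls i + j * m)) * moment k z j n"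
    unfolding disc_moment_def eq moment_def
    using laplace_factor[OF Y integrable_fun_Z[of "\<lambda>w. (u w) ^ j"], of "real (j * m)" k n] by simp_all
qed

text \<open>
  The expected discount compensates exactly the growth \<open>1 + 2 * m / balls n\<close> of the second
  moment, so only the noise remains.
\<close>
lemma disc_moment_2_Suc:
  assumes "1 \<le> k" "k \<le> n"
  shows "disc_moment k z 2 (Suc n) \<ge> disc_moment k z 2 n + (\<Prod>i\<in>{k..<Suc n}. balls i / (balls i + 2 * m)) * (noise * state_prob k z)"
proof -
  let ?p = "\<lambda>n. \<Prod>i\<in>{k..<n}. balls i / (balls i + 2 * m)"
  have p: "0 \<le> ?p n" for n by (intro prod_nonneg) (simp add: add_nonneg_nonneg)
  have pS: "?p (Suc n) * (1 + 2 * m / balls n) = ?p n"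
  proof -
    have "balls n / (balls n + 2 * m) * (1 + 2 * m / balls n) = 1"
      using balls_pos[of n] by (simp add: field_simps add_nonneg_eq_0_iff)
    moreover have "?p (Suc n) = ?p n * (balls n / (balls n + 2 * m))"
      using assms by (simp add: prod.atLeastLessThan_Suc)
    ultimately show ?thesis by (simp only: mult.assoc mult_1_right)
  qed
  have "?p (Suc n) * ((1 + 2 * m / balls n) * moment k z 2 n + noise * state_prob k z) \<le> ?p (Suc n) * moment k z 2 (Suc n)"
    using moment_2_Suc[of k n z] assms p by (intro mult_left_mono) (auto simp: moment_0)
  then show ?thesis
    unfolding disc_moment_eq using pS by (simp add: distrib_left flip: mult.assoc)
qed

lemma disc_moment_2_mono:
  assumes "1 \<le> k" "k \<le> n" "n \<le> n'"
  shows "disc_moment k z 2 n \<le> disc_moment k z 2 n'"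
  using assms(3)
proof (induction n' rule: dec_induct)
  case (step n')
  have "0 \<le> (\<Prod>i\<in>{k..<Suc n'}. balls i / (balls i + 2 * m)) * (noise * state_prob k z)"
    using noise_pos by (intro mult_nonneg_nonneg prod_nonneg) (auto simp: add_nonneg_nonneg)
  then show ?case using disc_moment_2_Suc[of k n' z] assms step by linarith
qed simp

lemma disc_moment_2_pos:
  assumes "1 \<le> k" "0 < state_prob k z"
  shows "0 < disc_moment k z 2 (Suc k)"
proof -
  have "0 < (\<Prod>i\<in>{k..<Suc k}. balls i / (balls i + 2 * m)) * (noise * state_prob k z)"
    using assms noise_pos balls_pos by (intro mult_pos_pos prod_pos) (auto simp: add_pos_nonneg)
  moreover have "0 \<le> disc_moment k z 2 k"
    unfolding disc_moment_def by (intro Bochner_Integration.integral_nonneg) auto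
  ultimately show ?thesis using disc_moment_2_Suc[of k k z] assms by linarith
qed

lemma disc_moment_4_le:
  assumes "1 \<le> k" "k \<le> n"
  shows "disc_moment k z 4 n * state_prob k z \<le> nonzero_const * (disc_moment k z 2 n)\<^sup>2"
proof -
  let ?p2 = "\<Prod>i\<in>{k..<n}. balls i / (balls i + 2 * m)" and ?p4 = "\<Prod>i\<in>{k..<n}. balls i / (balls i + 4 * m)"
  have p4: "0 \<le> ?p4" by (intro prod_nonneg) (simp add: add_nonneg_nonneg)
  have "disc_moment k z 4 n * state_prob k z = ?p4 * (moment k z 4 n * state_prob k z)"
    by (simp add: disc_moment_eq)
  also have "\<dots> \<le> ?p4 * (moment_const * (moment k z 2 n)\<^sup>2)"
    using p4 moment_4_le[OF assms] by (intro mult_left_mono)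
  also have "\<dots> \<le> ((1 + 4 * (real m)\<^sup>2 * S) * ?p2\<^sup>2) * (moment_const * (moment k z 2 n)\<^sup>2)"
    using laplace_ratio[OF assms(2)] moment_const_pos by (intro mult_right_mono) auto
  also have "\<dots> = nonzero_const * (disc_moment k z 2 n)\<^sup>2"
    by (simp add: disc_moment_eq nonzero_const_def power_mult_distrib)
  finally show ?thesis .
qed

text \<open>
  A second moment argument in linear form. For \<open>\<beta> \<ge> 0\<close> and \<open>y \<ge> 0\<close> one has
  \<open>2 * (\<beta> * y) - (\<beta> * y)\<^sup>2 \<le> min 1 (2 * \<beta> * y)\<close>; for \<open>y\<close> the squared discounted process, the expectation of
  the left-hand side involves the second and the fourth moment only. The best \<open>\<beta>\<close> depends on
  \<open>n\<close>, but it only decreases when the second moment grows, so the value at \<open>n = Suc k\<close> serves as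
  an upper bound for all \<open>n\<close>.
\<close>
lemma truncated_second_moment_ge:
  assumes k: "1 \<le> k" and n: "Suc k \<le> n" and P: "0 < state_prob k z"
  defines "\<alpha> \<equiv> state_prob k z / (nonzero_const * disc_moment k z 2 (Suc k))"
  shows "state_prob k z / nonzero_const \<le>
    expectation (\<lambda>\<omega>. min 1 (2 * \<alpha> * (discounted m u k n \<omega>)\<^sup>2) * of_bool (Z k \<omega> = z))"
proof -
  let ?P = "state_prob k z" and ?D = "discounted m u k n" and ?I = "\<lambda>\<omega>. of_bool (Z k \<omega> = z)"
  have d0: "0 < disc_moment k z 2 (Suc k)" by (rule disc_moment_2_pos[OF k P])
  have dle: "disc_moment k z 2 (Suc k) \<le> disc_moment k z 2 n" using k n by (intro disc_moment_2_mono) auto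
  \<comment> \<open>This value maximizes \<open>2 * \<beta> * X - \<beta>\<^sup>2 * Y\<close> when \<open>Y\<close> is the bound for the fourth moment.\<close>
  define \<beta> where "\<beta> = ?P / (nonzero_const * disc_moment k z 2 n)"
  have \<beta>: "0 < \<beta>" "\<beta> \<le> \<alpha>"
    using d0 dle P nonzero_const_pos by (auto simp: \<alpha>_def \<beta>_def intro!: divide_left_mono mult_left_mono)
  have "?P / nonzero_const = 2 * \<beta> * disc_moment k z 2 n - \<beta>\<^sup>2 * (nonzero_const * (disc_moment k z 2 n)\<^sup>2 / ?P)"
    using d0 dle P nonzero_const_pos by (simp add: \<beta>_def power2_eq_square field_simps)
  also have "\<dots> \<le> 2 * \<beta> * disc_moment k z 2 n - \<beta>\<^sup>2 * disc_moment k z 4 n"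
    using disc_moment_4_le[of k n z] k n P by (intro diff_left_mono mult_left_mono) (auto simp: field_simps)
  also have "\<dots> = expectation (\<lambda>\<omega>. 2 * \<beta> * ((?D \<omega>)\<^sup>2 * ?I \<omega>) - \<beta>\<^sup>2 * ((?D \<omega>) ^ 4 * ?I \<omega>))"
    unfolding disc_moment_def
    by (subst Bochner_Integration.integral_diff) (auto intro!: integrable_mult_right integrable_disc_moment)
  also have "\<dots> \<le> expectation (\<lambda>\<omega>. min 1 (2 * \<alpha> * (?D \<omega>)\<^sup>2) * ?I \<omega>)"
  proof (rule integral_mono)
    show "integrable M (\<lambda>\<omega>. 2 * \<beta> * ((?D \<omega>)\<^sup>2 * ?I \<omega>) - \<beta>\<^sup>2 * ((?D \<omega>) ^ 4 * ?I \<omega>))"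
      by (intro Bochner_Integration.integrable_diff integrable_mult_right integrable_disc_moment)
    show "integrable M (\<lambda>\<omega>. min 1 (2 * \<alpha> * (?D \<omega>)\<^sup>2) * ?I \<omega>)"
      using \<beta> by (intro integrable_const_bound[where B = 1]) (auto intro!: AE_I2)
    fix \<omega>
    define y where "y = \<beta> * (?D \<omega>)\<^sup>2"
    have "2 * y - y\<^sup>2 \<le> 1" using zero_le_power2[of "y - 1"] by (simp add: power2_eq_square algebra_simps)
    moreover have "2 * y - y\<^sup>2 \<le> 2 * \<alpha> * (?D \<omega>)\<^sup>2"
    proof -
      have "y \<le> \<alpha> * (?D \<omega>)\<^sup>2" unfolding y_def using \<beta> by (intro mult_right_mono) auto
      then show ?thesis using zero_le_power2[of y] by linarith
    qed
    moreover have "2 * \<beta> * (?D \<omega>)\<^sup>2 - \<beta>\<^sup>2 * (?D \<omega>) ^ 4 = 2 * y - y\<^sup>2"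
      by (simp add: y_def power_mult_distrib flip: power_mult)
    ultimately show "2 * \<beta> * ((?D \<omega>)\<^sup>2 * ?I \<omega>) - \<beta>\<^sup>2 * ((?D \<omega>) ^ 4 * ?I \<omega>) \<le> min 1 (2 * \<alpha> * (?D \<omega>)\<^sup>2) * ?I \<omega>"
      by (cases "Z k \<omega> = z") auto
  qed
  finally show ?thesis .
qed

text \<open>
  The truncated function is bounded and continuous and vanishes at \<open>0\<close>, so the lower bound for its expectation
  passes to the limit and bounds the probability that the limit differs from \<open>0\<close>.
\<close>
lemma tail_limit_nonzero_prob_ge:
  assumes k: "1 \<le> k" and lim: "AE \<omega> in M. (\<lambda>n. discounted m u 0 n \<omega>) \<longlonglongrightarrow> W \<omega>"
  shows "state_prob k z / nonzero_const \<le> prob {\<omega>\<in>space M. Z k \<omega> = z \<and> tail_limit m u k \<omega> \<noteq> 0}"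
proof (cases "state_prob k z = 0")
  case False
  then have P: "0 < state_prob k z" by (simp add: zero_less_measure_iff)
  let ?I = "\<lambda>\<omega>. of_bool (Z k \<omega> = z) :: real"
  define \<alpha> where "\<alpha> = state_prob k z / (nonzero_const * disc_moment k z 2 (Suc k))"
  have \<alpha>: "0 \<le> \<alpha>" using disc_moment_2_pos[OF k P] nonzero_const_pos P by (simp add: \<alpha>_def)
  let ?f = "\<lambda>x. min 1 (2 * \<alpha> * x\<^sup>2)"
  have "(\<lambda>n. expectation (\<lambda>\<omega>. ?f (discounted m u k n \<omega>) * ?I \<omega>)) \<longlonglongrightarrow> expectation (\<lambda>\<omega>. ?f (tail_limit m u k \<omega>) * ?I \<omega>)"
  proof (rule integral_dominated_convergence[where w = "\<lambda>_. 1"])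
    show "AE \<omega> in M. (\<lambda>n. ?f (discounted m u k n \<omega>) * ?I \<omega>) \<longlonglongrightarrow> ?f (tail_limit m u k \<omega>) * ?I \<omega>"
      using AE_tail_limit[OF lim, of k] by eventually_elim (auto intro!: tendsto_intros)
  qed (use \<alpha> in auto)
  moreover have "\<forall>\<^sub>F n in sequentially. state_prob k z / nonzero_const \<le> expectation (\<lambda>\<omega>. ?f (discounted m u k n \<omega>) * ?I \<omega>)"
    using eventually_ge_at_top[of "Suc k"]
    by eventually_elim (use truncated_second_moment_ge[OF k _ P] in \<open>simp add: \<alpha>_def\<close>)
  ultimately have "state_prob k z / nonzero_const \<le> expectation (\<lambda>\<omega>. ?f (tail_limit m u k \<omega>) * ?I \<omega>)"
    by (rule tendsto_lowerbound) simp
  also have "\<dots> \<le> expectation (indicator {\<omega>\<in>space M. Z k \<omega> = z \<and> tail_limit m u k \<omega> \<noteq> 0})"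
    using \<alpha> by (intro integral_mono integrable_const_bound[where B = 1]) (auto intro!: AE_I2 simp: indicator_def)
  finally show ?thesis by simp
qed simp

end

section \<open>The limit does not vanish\<close>

context urn_chain
begin

text \<open>
  The discount accumulated up to time \<open>k\<close> is independent of the chain and of the later holding times.
  Once the state \<open>z\<close> at time \<open>k\<close> is fixed, the discounted process at time \<open>k\<close> is this discount times the
  number \<open>u z\<close>.
\<close>
lemma expectation_discounted_split:
  fixes g :: "real \<Rightarrow> real"
  assumes g[measurable]: "g \<in> borel_measurable borel" and g01: "\<And>x. 0 \<le> g x" "\<And>x. g x \<le> 1"
    and Y: "Y \<in> borel_measurable (rest_algebra {..<k})" and Y01: "\<And>\<omega>. 0 \<le> Y \<omega>" "\<And>\<omega>. Y \<omega> \<le> 1"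
  shows "expectation (\<lambda>\<omega>. g (discounted m u 0 k \<omega>) * Y \<omega>) =
    (\<Sum>z\<in>level k. expectation (\<lambda>\<omega>. g (exp (- m * (\<Sum>i<k. T i \<omega>)) * u z)) * expectation (\<lambda>\<omega>. of_bool (Z k \<omega> = z) * Y \<omega>))"
proof -
  let ?h = "\<lambda>z \<omega>. g (exp (- m * (\<Sum>i<k. T i \<omega>)) * u z)"
  have Ym[measurable]: "Y \<in> borel_measurable M"
    using Y subalgebra_algebras(2) by (rule measurable_from_subalg[rotated])
  have prod01: "\<bar>x * y\<bar> \<le> 1" if "0 \<le> x" "x \<le> 1" "0 \<le> y" "y \<le> 1" for x y :: real
    using that by (simp add: abs_mult mult_le_one)
  have h: "integrable M (?h z)" for z
    using g01 by (intro integrable_const_bound[where B = 1]) auto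
  have i: "integrable M (\<lambda>\<omega>. of_bool (Z k \<omega> = z) * Y \<omega>)" for z
    using Y01 prod01 by (intro integrable_const_bound[where B = 1]) auto
  have ind: "indep_var borel (?h z) borel (\<lambda>\<omega>. of_bool (Z k \<omega> = z) * Y \<omega>)" for z
  proof (rule indep_holding_rest[where I = "{..<k}"])
    have [measurable]: "T i \<in> borel_measurable (holding_algebra {..<k})" if "i \<in> {..<k}" for i
      using that by (rule measurable_T_holding)
    show "?h z \<in> borel_measurable (holding_algebra {..<k})" by measurable
    show "(\<lambda>\<omega>. of_bool (Z k \<omega> = z) * Y \<omega>) \<in> borel_measurable (rest_algebra {..<k})"
      using measurable_fun_Z_rest[of "\<lambda>w. of_bool (w = z)" k "{..<k}"] Y
      by (intro borel_measurable_times)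
  qed
  have "expectation (\<lambda>\<omega>. g (discounted m u 0 k \<omega>) * Y \<omega>) =
      expectation (\<lambda>\<omega>. \<Sum>z\<in>level k. ?h z \<omega> * (of_bool (Z k \<omega> = z) * Y \<omega>))"
  proof (rule integral_cong_AE)
    show "AE \<omega> in M. g (discounted m u 0 k \<omega>) * Y \<omega> = (\<Sum>z\<in>level k. ?h z \<omega> * (of_bool (Z k \<omega> = z) * Y \<omega>))"
      using AE_level[of k]
    proof eventually_elim
      fix \<omega> assume Zk: "Z k \<omega> \<in> level k"
      have "(\<Sum>z\<in>level k. ?h z \<omega> * (of_bool (Z k \<omega> = z) * Y \<omega>)) = (\<Sum>z\<in>level k. if z = Z k \<omega> then ?h z \<omega> * Y \<omega> else 0)"
        by (intro sum.cong) auto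
      also have "\<dots> = ?h (Z k \<omega>) \<omega> * Y \<omega>"
        using Zk finite_level by simp
      finally show "g (discounted m u 0 k \<omega>) * Y \<omega> = (\<Sum>z\<in>level k. ?h z \<omega> * (of_bool (Z k \<omega> = z) * Y \<omega>))"
        by (simp add: discounted_def atLeast0LessThan)
    qed
  qed measurable
  also have "\<dots> = (\<Sum>z\<in>level k. expectation (\<lambda>\<omega>. ?h z \<omega> * (of_bool (Z k \<omega> = z) * Y \<omega>)))"
    by (rule Bochner_Integration.integral_sum) (rule indep_var_integrable[OF ind h i])
  also have "\<dots> = (\<Sum>z\<in>level k. expectation (?h z) * expectation (\<lambda>\<omega>. of_bool (Z k \<omega> = z) * Y \<omega>))"
    by (intro sum.cong refl) (rule indep_var_lebesgue_integral[OF ind h i])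
  finally show ?thesis .
qed

lemma expectation_discounted_nonzero_ge:
  fixes g :: "real \<Rightarrow> real"
  assumes lim: "AE \<omega> in M. (\<lambda>n. discounted m u 0 n \<omega>) \<longlonglongrightarrow> W \<omega>" and [measurable]: "W \<in> borel_measurable M"
    and g[measurable]: "g \<in> borel_measurable borel" and g01: "\<And>x. 0 \<le> g x" "\<And>x. g x \<le> 1" and k: "1 \<le> k"
  shows "expectation (\<lambda>\<omega>. g (discounted m u 0 k \<omega>)) / nonzero_const \<le>
    expectation (\<lambda>\<omega>. g (discounted m u 0 k \<omega>) * of_bool (W \<omega> \<noteq> 0))"
proof -
  let ?V = "tail_limit m u k"
  let ?e = "\<lambda>z. expectation (\<lambda>\<omega>. g (exp (- m * (\<Sum>i<k. T i \<omega>)) * u z))"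
  have Y: "(\<lambda>\<omega>. of_bool (?V \<omega> \<noteq> 0) :: real) \<in> borel_measurable (rest_algebra {..<k})"
    using measurable_tail_limit_rest by measurable
  have e0: "0 \<le> ?e z" for z using g01 by (intro Bochner_Integration.integral_nonneg)
  have p1: "expectation (\<lambda>\<omega>. of_bool (Z k \<omega> = z) * 1) = state_prob k z" for z
    using moment_0[of k z 0] by (simp add: moment_def)
  have p2: "expectation (\<lambda>\<omega>. of_bool (Z k \<omega> = z) * (of_bool (?V \<omega> \<noteq> 0) :: real)) = prob {\<omega>\<in>space M. Z k \<omega> = z \<and> ?V \<omega> \<noteq> 0}" for z
  proof -
    have "expectation (\<lambda>\<omega>. of_bool (Z k \<omega> = z) * (of_bool (?V \<omega> \<noteq> 0) :: real)) = expectation (indicator {\<omega>\<in>space M. Z k \<omega> = z \<and> ?V \<omega> \<noteq> 0})"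
      by (intro Bochner_Integration.integral_cong refl) (auto simp: indicator_def)
    then show ?thesis by simp
  qed
  have "expectation (\<lambda>\<omega>. g (discounted m u 0 k \<omega>)) / nonzero_const = (\<Sum>z\<in>level k. ?e z * (state_prob k z / nonzero_const))"
    using expectation_discounted_split[OF g g01, of "\<lambda>_. 1" k] p1 by (simp add: sum_divide_distrib)
  also have "\<dots> \<le> (\<Sum>z\<in>level k. ?e z * prob {\<omega>\<in>space M. Z k \<omega> = z \<and> ?V \<omega> \<noteq> 0})"
    by (intro sum_mono mult_left_mono e0 tail_limit_nonzero_prob_ge[OF k lim])
  also have "\<dots> = expectation (\<lambda>\<omega>. g (discounted m u 0 k \<omega>) * of_bool (?V \<omega> \<noteq> 0))"
    using expectation_discounted_split[OF g g01 Y] p2 by simp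
  also have "\<dots> = expectation (\<lambda>\<omega>. g (discounted m u 0 k \<omega>) * of_bool (W \<omega> \<noteq> 0))"
  proof (rule integral_cong_AE)
    show "AE \<omega> in M. g (discounted m u 0 k \<omega>) * of_bool (?V \<omega> \<noteq> 0) = g (discounted m u 0 k \<omega>) * of_bool (W \<omega> \<noteq> 0)"
      using AE_tail_limit[OF lim, of k] by eventually_elim auto
  qed measurable
  finally show ?thesis .
qed

text \<open>
  A zero-one argument without conditional expectations. Take for \<open>g\<close> a tent of height \<open>1\<close> that is
  concentrated near \<open>0\<close>. The lower bound of the preceding lemma passes to the limit \<open>k \<rightarrow> \<infinity>\<close> and says
  that \<open>E (g W; W \<noteq> 0)\<close> is at least a fixed fraction of \<open>E (g W) \<ge> P (W = 0)\<close>. When the tent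
  shrinks to the point \<open>0\<close>, the left-hand side tends to \<open>0\<close>.
\<close>
lemma AE_limit_nonzero:
  assumes lim: "AE \<omega> in M. (\<lambda>n. discounted m u 0 n \<omega>) \<longlonglongrightarrow> W \<omega>" and W[measurable]: "W \<in> borel_measurable M"
  shows "AE \<omega> in M. W \<omega> \<noteq> 0"
proof -
  define g where "g = (\<lambda>(j::nat) x::real. max 0 (1 - real (Suc j) * \<bar>x\<bar>))"
  have [measurable]: "g j \<in> borel_measurable borel" for j unfolding g_def by measurable
  have g01: "0 \<le> g j x" "g j x \<le> 1" for j x by (auto simp: g_def)
  have ge: "prob {\<omega>\<in>space M. W \<omega> = 0} / nonzero_const \<le> expectation (\<lambda>\<omega>. g j (W \<omega>) * of_bool (W \<omega> \<noteq> 0))" for j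
  proof -
    have cont: "(\<lambda>k. g j (X k)) \<longlonglongrightarrow> g j x" if "X \<longlonglongrightarrow> x" for X x
      unfolding g_def by (intro tendsto_intros that)
    have 1: "(\<lambda>k. expectation (\<lambda>\<omega>. g j (discounted m u 0 k \<omega>)) / nonzero_const) \<longlonglongrightarrow> expectation (\<lambda>\<omega>. g j (W \<omega>)) / nonzero_const"
    proof (intro tendsto_divide tendsto_const integral_dominated_convergence[where w = "\<lambda>_. 1"])
      show "AE \<omega> in M. (\<lambda>k. g j (discounted m u 0 k \<omega>)) \<longlonglongrightarrow> g j (W \<omega>)"
        using lim by eventually_elim (rule cont)
    qed (use g01 nonzero_const_pos in auto)
    have 2: "(\<lambda>k. expectation (\<lambda>\<omega>. g j (discounted m u 0 k \<omega>) * of_bool (W \<omega> \<noteq> 0))) \<longlonglongrightarrow> expectation (\<lambda>\<omega>. g j (W \<omega>) * of_bool (W \<omega> \<noteq> 0))"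
    proof (rule integral_dominated_convergence[where w = "\<lambda>_. 1"])
      show "AE \<omega> in M. (\<lambda>k. g j (discounted m u 0 k \<omega>) * of_bool (W \<omega> \<noteq> 0)) \<longlonglongrightarrow> g j (W \<omega>) * of_bool (W \<omega> \<noteq> 0)"
        using lim by eventually_elim (intro tendsto_mult tendsto_const cont)
    qed (use g01 in auto)
    have "prob {\<omega>\<in>space M. W \<omega> = 0} / nonzero_const = expectation (indicator {\<omega>\<in>space M. W \<omega> = 0}) / nonzero_const" by simp
    also have "\<dots> \<le> expectation (\<lambda>\<omega>. g j (W \<omega>)) / nonzero_const"
      using nonzero_const_pos g01
      by (intro divide_right_mono integral_mono integrable_const_bound[where B = 1])
         (auto intro!: AE_I2 simp: indicator_def g_def)
    also have "\<dots> \<le> expectation (\<lambda>\<omega>. g j (W \<omega>) * of_bool (W \<omega> \<noteq> 0))"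
    proof (rule LIMSEQ_le[OF 1 2])
      show "\<exists>n0. \<forall>k\<ge>n0. expectation (\<lambda>\<omega>. g j (discounted m u 0 k \<omega>)) / nonzero_const \<le> expectation (\<lambda>\<omega>. g j (discounted m u 0 k \<omega>) * of_bool (W \<omega> \<noteq> 0))"
        using expectation_discounted_nonzero_ge[OF lim W, of "g j"] g01 by (intro exI[of _ 1]) auto
    qed
    finally show ?thesis .
  qed
  have "(\<lambda>j. expectation (\<lambda>\<omega>. g j (W \<omega>) * of_bool (W \<omega> \<noteq> 0))) \<longlonglongrightarrow> expectation (\<lambda>\<omega>. 0)"
  proof (rule integral_dominated_convergence[where w = "\<lambda>_. 1"])
    show "AE \<omega> in M. (\<lambda>j. g j (W \<omega>) * of_bool (W \<omega> \<noteq> 0)) \<longlonglongrightarrow> 0"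
    proof (rule AE_I2)
      fix \<omega>
      show "(\<lambda>j. g j (W \<omega>) * of_bool (W \<omega> \<noteq> 0)) \<longlonglongrightarrow> 0"
      proof (cases "W \<omega> = 0")
        case False
        obtain j0 :: nat where j0: "1 / \<bar>W \<omega>\<bar> < real j0" using reals_Archimedean2 by blast
        have "\<forall>\<^sub>F j in sequentially. g j (W \<omega>) * of_bool (W \<omega> \<noteq> 0) = 0"
          using eventually_ge_at_top[of j0]
        proof eventually_elim
          fix j assume "j0 \<le> j"
          then have "1 / \<bar>W \<omega>\<bar> \<le> real (Suc j)" using j0 by linarith
          then have "1 \<le> real (Suc j) * \<bar>W \<omega>\<bar>" using False by (simp add: divide_simps split: if_splits)
          then show "g j (W \<omega>) * of_bool (W \<omega> \<noteq> 0) = 0" by (simp add: g_def)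
        qed
        then show ?thesis by (rule tendsto_eventually)
      qed simp
    qed
  qed (use g01 in auto)
  then have "prob {\<omega>\<in>space M. W \<omega> = 0} / nonzero_const \<le> expectation (\<lambda>\<omega>. 0)"
    using ge by (intro tendsto_lowerbound[OF _ always_eventually]) auto
  then have "prob {\<omega>\<in>space M. W \<omega> = 0} = 0"
    using nonzero_const_pos by (simp add: divide_le_0_iff measure_le_0_iff)
  then show ?thesis
    by (subst AE_iff_measurable[OF _ refl]) (auto simp: emeasure_eq_measure)
qed

text \<open>
  At \<open>r = S\<close> the Laplace transforms of the holding times telescope, because the next rate is \<open>S\<close> larger.
\<close>
lemma laplace_telescope: "(\<Prod>i\<in>{0..<n}. balls i / (balls i + S)) = 1 / balls n"
proof (induction n)
  case (Suc n)
  have "balls (Suc n) = balls n + S" by (simp add: algebra_simps)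
  then show ?case using Suc balls_pos[of n] balls_pos[of "Suc n"] by (simp add: prod.atLeastLessThan_Suc)
qed simp

text \<open>
  By Markov's inequality the \<open>n\<close>-th jump time is at most \<open>B\<close> with probability at most
  \<open>exp (S * B) / balls n\<close>, which tends to \<open>0\<close>.
\<close>
lemma AE_nonexplosion: "AE \<omega> in M. filterlim (\<lambda>n. \<Sum>i<n. T i \<omega>) at_top sequentially"
proof -
  have "AE \<omega> in M. \<not> (\<forall>n. (\<Sum>i<n. T i \<omega>) \<le> real B)" for B :: nat
  proof -
    have le: "prob {\<omega>\<in>space M. \<forall>n. (\<Sum>i<n. T i \<omega>) \<le> real B} \<le> exp (real S * B) * (1 / balls n)" for n
    proof -
      let ?E = "\<lambda>\<omega>. exp (- real S * (\<Sum>i\<in>{0..<n}. T i \<omega>)) * 1"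
      have "(\<lambda>_. 1) \<in> borel_measurable (rest_algebra I)" for I by simp
      from laplace_factor[OF this, of "real S" 0 n]
      have E: "integrable M ?E" "expectation ?E = 1 / balls n"
        using laplace_telescope[of n] by (simp_all add: prob_space)
      have "prob {\<omega>\<in>space M. \<forall>n. (\<Sum>i<n. T i \<omega>) \<le> real B} = expectation (indicator {\<omega>\<in>space M. \<forall>n. (\<Sum>i<n. T i \<omega>) \<le> real B})"
        by simp
      also have "\<dots> \<le> expectation (\<lambda>\<omega>. exp (real S * B) * ?E \<omega>)"
      proof (rule integral_mono)
        show "integrable M (\<lambda>\<omega>. exp (real S * B) * ?E \<omega>)" using E(1) by (rule integrable_mult_right)
        show "integrable M (indicator {\<omega>\<in>space M. \<forall>n. (\<Sum>i<n. T i \<omega>) \<le> real B} :: 'w \<Rightarrow> real)"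
          by (intro integrable_real_indicator) (auto simp: emeasure_eq_measure)
        fix \<omega>
        have "1 \<le> exp (real S * (B - (\<Sum>i<n. T i \<omega>)))" if "(\<Sum>i<n. T i \<omega>) \<le> real B"
          using that by (simp add: mult_nonneg_nonneg)
        moreover have "exp (real S * (B - (\<Sum>i<n. T i \<omega>))) = exp (real S * B) * ?E \<omega>"
          by (simp add: atLeast0LessThan algebra_simps flip: exp_add)
        ultimately show "indicator {\<omega>\<in>space M. \<forall>n. (\<Sum>i<n. T i \<omega>) \<le> real B} \<omega> \<le> exp (real S * B) * ?E \<omega>"
          by (auto simp: indicator_def)
      qed
      also have "\<dots> = exp (real S * B) * (1 / balls n)"
        by (simp only: integral_mult_right_zero E(2))
      finally show ?thesis .
    qed
    have "(\<lambda>n. exp (real S * B) * (1 / balls n)) \<longlonglongrightarrow> 0"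
      using m by real_asymp
    then have "prob {\<omega>\<in>space M. \<forall>n. (\<Sum>i<n. T i \<omega>) \<le> real B} \<le> 0"
      using le by (intro tendsto_lowerbound[OF _ always_eventually]) auto
    then have "prob {\<omega>\<in>space M. \<not> \<not> (\<forall>n. (\<Sum>i<n. T i \<omega>) \<le> real B)} = 0"
      by (simp add: measure_le_0_iff)
    then show ?thesis
      by (subst AE_iff_measurable[OF _ refl]) (auto simp: emeasure_eq_measure)
  qed
  then have "AE \<omega> in M. \<forall>B::nat. \<not> (\<forall>n. (\<Sum>i<n. T i \<omega>) \<le> real B)" by (simp add: AE_all_countable)
  with AE_T_pos show ?thesis
  proof eventually_elim
    fix \<omega> assume pos: "\<forall>k. 0 < T k \<omega>" and B: "\<forall>B::nat. \<not> (\<forall>n. (\<Sum>i<n. T i \<omega>) \<le> real B)"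
    show "filterlim (\<lambda>n. \<Sum>i<n. T i \<omega>) at_top sequentially"
      unfolding filterlim_at_top
    proof
      fix x :: real
      obtain B' :: nat where "x \<le> real B'" using real_arch_simple by blast
      moreover obtain n0 where "real B' < (\<Sum>i<n0. T i \<omega>)" using B by (meson not_le)
      moreover have "(\<Sum>i<n0. T i \<omega>) \<le> (\<Sum>i<n. T i \<omega>)" if "n0 \<le> n" for n
        using that pos by (intro sum_mono2) (auto intro: less_imp_le)
      ultimately show "\<forall>\<^sub>F n in sequentially. x \<le> (\<Sum>i<n. T i \<omega>)"
        by (intro eventually_sequentiallyI[of n0]) (meson less_imp_le order_trans)
    qed
  qed
qed

text \<open>
  Since the jump times tend to infinity, the limit in continuous time may be taken along them.
\<close>
lemma AE_discounted_limit:
  fixes U :: "real \<Rightarrow> 'w \<Rightarrow> nat \<times> nat"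
  assumes path: "AE \<omega> in M. \<forall>n t. (\<Sum>k<n. T k \<omega>) \<le> t \<and> t < (\<Sum>k<Suc n. T k \<omega>) \<longrightarrow> U t \<omega> = Z n \<omega>"
    and lim: "AE \<omega> in M. ((\<lambda>t. exp (- real m * t) * u (U t \<omega>)) \<longlongrightarrow> W \<omega>) at_top"
  shows "AE \<omega> in M. (\<lambda>n. discounted m u 0 n \<omega>) \<longlonglongrightarrow> W \<omega>"
  using path lim AE_nonexplosion AE_T_pos
proof eventually_elim
  fix \<omega>
  assume path: "\<forall>n t. (\<Sum>k<n. T k \<omega>) \<le> t \<and> t < (\<Sum>k<Suc n. T k \<omega>) \<longrightarrow> U t \<omega> = Z n \<omega>"
    and lim: "((\<lambda>t. exp (- real m * t) * u (U t \<omega>)) \<longlongrightarrow> W \<omega>) at_top"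
    and J: "filterlim (\<lambda>n. \<Sum>i<n. T i \<omega>) at_top sequentially" and pos: "\<forall>k. 0 < T k \<omega>"
  have "U (\<Sum>i<n. T i \<omega>) \<omega> = Z n \<omega>" for n
    using path[rule_format, of n "\<Sum>i<n. T i \<omega>"] pos[rule_format, of n] by simp
  then show "(\<lambda>n. discounted m u 0 n \<omega>) \<longlonglongrightarrow> W \<omega>"
    using filterlim_compose[OF lim J] by (simp add: discounted_def atLeast0LessThan)
qed

end

section \<open>From the jump process to its chain\<close>

lemma total_rate_urn:
  assumes "a \<noteq> c"
  shows "total_rate (urn_rate a b c d) (x, y) = real x + real y"
proof -
  let ?p = "(x + a, y + b)" and ?q = "(x + c, y + d)"
  have "total_rate (urn_rate a b c d) (x, y) = (\<Sum>\<^sub>\<infinity>z'\<in>{?p, ?q}. urn_rate a b c d (x, y) z')"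
    unfolding total_rate_def by (rule infsum_cong_neutral) (auto simp: urn_rate_def)
  also have "\<dots> = (\<Sum>z'\<in>{?p, ?q}. urn_rate a b c d (x, y) z')"
    by (rule infsum_finite) simp
  also have "\<dots> = real x + real y"
    using assms by (simp add: urn_rate_def)
  finally show ?thesis .
qed

lemma pmf_urn_kernel:
  assumes "a \<noteq> c" "0 < x + y"
  shows "pmf (urn_kernel a b c d (x, y)) z' = urn_rate a b c d (x, y) z' / total_rate (urn_rate a b c d) (x, y)"
proof -
  have "pmf (urn_kernel a b c d (x, y)) z' = measure_pmf.expectation (urn_kernel a b c d (x, y)) (indicator {z'})"
    by (simp add: measure_pmf_single)
  also have "\<dots> = urn_rate a b c d (x, y) z' / (real x + real y)"
    unfolding expectation_urn_kernel[OF assms(2)]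
    by (auto simp: urn_rate_def indicator_def add_divide_distrib)
  finally show ?thesis by (simp add: total_rate_urn[OF assms(1)])
qed

text \<open>
  On a path of positive density every step adds \<open>S\<close> balls, so the total rates are the deterministic
  ones; on all other paths both products vanish.
\<close>
lemma urn_path_density_eq:
  assumes "a \<noteq> c" "a + b = S" "c + d = S" "z 0 = (1, 0)"
  shows "(\<Prod>k<n. urn_rate a b c d (z k) (z (Suc k)) / total_rate (urn_rate a b c d) (z k) *
            exp (- total_rate (urn_rate a b c d) (z k) * t k)) =
         (\<Prod>k<n. pmf (urn_kernel a b c d (z k)) (z (Suc k)) * exp (- (1 + real k * real S) * t k)) \<and>
         ((\<Prod>k<n. urn_rate a b c d (z k) (z (Suc k)) / total_rate (urn_rate a b c d) (z k) *
            exp (- total_rate (urn_rate a b c d) (z k) * t k)) \<noteq> 0 \<longrightarrow> fst (z n) + snd (z n) = 1 + n * S)"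
    (is "?L n = ?R n \<and> (?L n \<noteq> 0 \<longrightarrow> ?size n)")
proof (induction n)
  case 0
  then show ?case using assms(4) by simp
next
  case (Suc n)
  show ?case
  proof (cases "?L n = 0")
    case True
    have "?R n = 0" by (rule trans[OF sym[OF conjunct1[OF Suc]] True])
    with True have L0: "?L (Suc n) = 0" and R0: "?R (Suc n) = 0"
      by (simp_all only: prod.lessThan_Suc mult_zero_left)
    show ?thesis unfolding L0 R0 by simp
  next
    case False
    obtain x y where z: "z n = (x, y)" by (cases "z n")
    have xy: "x + y = 1 + n * S" using mp[OF conjunct2[OF Suc] False] z by simp
    have tot: "total_rate (urn_rate a b c d) (z n) = 1 + real n * real S"
      unfolding z total_rate_urn[OF assms(1)] using xy by (metis of_nat_1 of_nat_add of_nat_mult)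
    have pmf: "pmf (urn_kernel a b c d (z n)) (z (Suc n)) = urn_rate a b c d (z n) (z (Suc n)) / total_rate (urn_rate a b c d) (z n)"
      unfolding z using xy by (intro pmf_urn_kernel assms(1)) simp
    have "?L (Suc n) = ?R (Suc n)"
      by (simp only: prod.lessThan_Suc pmf tot conjunct1[OF Suc])
    moreover have "?size (Suc n)" if "?L (Suc n) \<noteq> 0"
    proof -
      have "urn_rate a b c d (x, y) (z (Suc n)) \<noteq> 0" using that z by auto
      then have "z (Suc n) = (x + a, y + b) \<or> z (Suc n) = (x + c, y + d)"
        by (auto simp: urn_rate_def)
      then show ?thesis using xy assms(2,3) by auto
    qed
    ultimately show ?thesis by blast
  qed
qed

lemma urn_chain_of_markov_jump_process:
  fixes m S a b c d :: nat
  assumes "prob_space M" and "markov_jump_process M (urn_rate a b c d) (1, 0) U"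
    and urn: "0 < m" "m < S" "1 \<le> b" "1 \<le> c" "a = c + m" "d = b + m" "S = a + b"
  obtains Z T where "urn_chain M a b c d S Z T m"
    "AE \<omega> in M. \<forall>n t. (\<Sum>k<n. T k \<omega>) \<le> t \<and> t < (\<Sum>k<Suc n. T k \<omega>) \<longrightarrow> U t \<omega> = Z n \<omega>"
proof -
  interpret prob_space M by fact
  obtain Z T where Z: "\<And>n. Z n \<in> measurable M (count_space UNIV)" and T: "\<And>n. T n \<in> borel_measurable M"
    and fdd: "\<And>n z t. (\<forall>k<n. 0 \<le> t k) \<Longrightarrow>
           measure M {\<omega> \<in> space M. (\<forall>k\<le>n. Z k \<omega> = z k) \<and> (\<forall>k<n. t k < T k \<omega>)} =
             (if z 0 = (1, 0)
              then (\<Prod>k<n. urn_rate a b c d (z k) (z (Suc k)) / total_rate (urn_rate a b c d) (z k) *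
                            exp (- total_rate (urn_rate a b c d) (z k) * t k))
              else 0)"
    and path: "AE \<omega> in M. \<forall>n t. (\<Sum>k<n. T k \<omega>) \<le> t \<and> t < (\<Sum>k<Suc n. T k \<omega>) \<longrightarrow> U t \<omega> = Z n \<omega>"
    using assms(2) unfolding markov_jump_process_def by blast
  have "urn_chain M a b c d S Z T m"
  proof (unfold_locales)
    show "prob {\<omega>\<in>space M. (\<forall>k\<le>n. Z k \<omega> = z k) \<and> (\<forall>k<n. t k < T k \<omega>)} =
        (if z 0 = (1, 0) then \<Prod>k<n. pmf (urn_kernel a b c d (z k)) (z (Suc k)) * exp (- (1 + real k * real S) * t k) else 0)"
      if t: "\<And>k. k < n \<Longrightarrow> 0 \<le> t k" for n z t
    proof -
      have "a \<noteq> c" "a + b = S" "c + d = S" using urn by auto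
      from urn_path_density_eq[OF this, where z = z and n = n and t = t] show ?thesis
        using t by (subst fdd) auto
    qed
  qed (use Z T urn in \<open>auto simp: add_pos_nonneg\<close>)
  with path show ?thesis by (rule that[rotated])
qed

theorem theorem7p4:
  fixes m S a b c d :: nat
    and M :: "'w measure"
    and U :: "real \<Rightarrow> 'w \<Rightarrow> nat \<times> nat"
    and X :: "real \<Rightarrow> 'w \<Rightarrow> real"
    and W :: "'w \<Rightarrow> real"
    and F :: "real \<Rightarrow> complex"
  assumes "m + 2 \<le> S" and "S \<le> 2 * m - 1" and "1 \<le> b" and "b \<le> S - m - 1"
    and "a = S - b" and "c = S - m - b" and "d = m + b"
    and "prob_space M"
    and "markov_jump_process M (urn_rate a b c d) (1, 0) U"
    and "X = (\<lambda>t \<omega>. exp (- real m * t) * u2 S b c (U t \<omega>))"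
    and "W \<in> borel_measurable M"
    and "as_limit M X W"
    and "\<And>r. r \<ge> 1 \<Longrightarrow> Lp_limit M r X W"
    and "F = char (distr M borel W)"
  shows "(\<forall>t. F differentiable (at t)) \<and>
    integrable lborel (\<lambda>t. vector_derivative F (at t)) \<and>
    (\<exists>p :: real \<Rightarrow> real.
       (\<forall>x. 0 \<le> p x) \<and>
       distributed M lborel W (\<lambda>x. ennreal (p x)) \<and>
       (\<forall>x. x \<noteq> 0 \<longrightarrow>
          complex_of_real (p x) =
            1 / (2 * \<i> * complex_of_real pi * complex_of_real x) *
            (\<integral>t. exp (- \<i> * complex_of_real t * complex_of_real x) *
                 vector_derivative F (at t) \<partial>lborel)))"
proof -
  have urn: "0 < m" "m < S" "1 \<le> b" "1 \<le> c" "a = c + m" "d = b + m" "S = a + b"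
    using assms(1-7) by auto
  obtain Z T where chain: "urn_chain M a b c d S Z T m"
    and path: "AE \<omega> in M. \<forall>n t. (\<Sum>k<n. T k \<omega>) \<le> t \<and> t < (\<Sum>k<Suc n. T k \<omega>) \<longrightarrow> U t \<omega> = Z n \<omega>"
    using urn_chain_of_markov_jump_process[OF assms(8,9) urn] .
  interpret urn_chain M a b c d S Z T m by (rule chain)
  note W[measurable] = assms(11)
  have lim: "AE \<omega> in M. (\<lambda>n. discounted m u 0 n \<omega>) \<longlonglongrightarrow> W \<omega>"
    using path assms(10,12) by (intro AE_discounted_limit) (auto simp: as_limit_def)
  have "integrable M (\<lambda>\<omega>. \<bar>W \<omega>\<bar> powr 1)"
    using assms(13)[of 1] by (simp add: Lp_limit_def)
  then have iW: "integrable M W"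
    by (simp add: integrable_abs_iff)
  have W0: "AE \<omega> in M. W \<omega> \<noteq> 0"
    by (rule AE_limit_nonzero[OF lim W])

  define R where "R = scale_law m 1 (1 + real S)"
  define Q where "Q = distr M borel (tail_limit m u 2)"
  define \<nu> where "\<nu> = distr M borel W"
  have m01: "0 < real m" "0 < (1::real)" "real m < 1 + real S" using m by auto
  interpret \<nu>: real_distribution \<nu> unfolding \<nu>_def by (rule real_distribution_distr) measurable
  have RD: "real_distribution R" unfolding R_def by (rule real_distribution_scale_law[OF m01])
  have QD: "real_distribution Q" unfolding Q_def by (rule real_distribution_distr) measurable
  interpret Q: real_distribution Q by (rule QD)
  have \<nu>: "\<nu> = distr (R \<Otimes>\<^sub>M Q) borel (\<lambda>(r, w). r * w)"
    using distr_limit_scale_mixture[OF lim W] by (simp add: R_def Q_def \<nu>_def)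
  have iR: "integrable R (\<lambda>r. r)" unfolding R_def by (rule integrable_scale_law[OF m01])
  have iQ: "integrable Q (\<lambda>w. w)"
    unfolding Q_def using integrable_tail_limit[OF lim W iW] m by simp
  have i\<nu>: "integrable \<nu> (\<lambda>x. x)"
    unfolding \<nu>_def using iW by (subst integrable_distr_eq) auto
  have F: "F = char \<nu>" using assms(14) by (simp add: \<nu>_def)
  note D = \<nu>.char_has_vector_derivative[OF i\<nu>]
  have F': "vector_derivative F (at t) = (CLINT y|\<nu>. \<i> * of_real y * iexp (t * y))" for t
    unfolding F by (rule vector_derivative_at[OF D])
  have diff: "F differentiable (at t)" for t
    unfolding F using D by (rule differentiableI_vector)
  have intF': "integrable lborel (\<lambda>t. vector_derivative (char \<nu>) (at t))"
    unfolding F[symmetric] F' unfolding \<nu>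
    using integrable_char_scale_law_deriv[OF m01]
    by (intro integrable_char_deriv_scale_mixture[OF RD QD iR iQ]) (simp add: R_def)
  have null: "measure (distr M borel Y) {0} = 0"
    if "AE \<omega> in M. Y \<omega> \<noteq> 0" and [measurable]: "Y \<in> borel_measurable M" for Y :: "'w \<Rightarrow> real"
  proof -
    have "prob (Y -` {0} \<inter> space M) = prob {}"
      using that(1) by (intro finite_measure_eq_AE) auto
    then show ?thesis by (simp add: measure_distr)
  qed
  have nullQ: "measure Q {0} = 0"
  proof -
    have "AE \<omega> in M. tail_limit m u 2 \<omega> \<noteq> 0"
      using W0 AE_tail_limit[OF lim, of 2] by eventually_elim auto
    then show ?thesis
      unfolding Q_def by (rule null) measurable
  qed
  have null\<nu>: "measure \<nu> {0} = 0"
    unfolding \<nu>_def using W0 W by (rule null)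
  have lim0: "(char \<nu> \<longlongrightarrow> 0) at_top" "(char \<nu> \<longlongrightarrow> 0) at_bot"
    using char_scale_mixture_tendsto_0[OF RD QD iR iQ _ _ nullQ] char_scale_law_tendsto_0[OF m01]
    by (simp_all add: R_def[symmetric] \<nu>[symmetric])
  obtain p where p: "\<And>x. 0 \<le> p x" "p \<in> borel_measurable borel"
    "\<nu> = density lborel (\<lambda>x. ennreal (p x))"
    "\<And>x. x \<noteq> 0 \<Longrightarrow> complex_of_real (p x) = inversion_density \<nu> x"
    using \<nu>.density_from_char_derivative[OF i\<nu> intF' lim0 null\<nu>] by blast
  note [measurable] = p(2)
  have "distributed M lborel W (\<lambda>x. ennreal (p x))"
    unfolding distributed_def using p(3) by (simp add: \<nu>_def cong: distr_cong)
  moreover have "complex_of_real (p x) =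
            1 / (2 * \<i> * complex_of_real pi * complex_of_real x) *
            (\<integral>t. exp (- \<i> * complex_of_real t * complex_of_real x) *
                 vector_derivative F (at t) \<partial>lborel)" if "x \<noteq> 0" for x
    using p(4)[OF that] by (simp add: inversion_density_def F mult.assoc)
  ultimately show ?thesis
    using diff intF' p(1) unfolding F by blast
qed

end
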